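(* Let $\Omega$ be a finite connected $d$-regular graph with $d\geq 3$, and let $\Gamma$ be a random $n$-covering of $\Omega$ in the model $\mathcal{C}_{n,\Omega}$. Then \[ \lambda_A(\Gamma)<\rho_A(\Omega)+0.84=2\sqrt{d-1}+0.84 \] asymptotically almost surely (as $n\to\infty$).
   Context: Graphs may have loops and multiple edges. The model $\mathcal{C}_{n,\Omega}$: the vertex set of $\Gamma$ is $V(\Omega)\times[n]$; orient each edge of $\Omega$ arbitrarily; for each edge $e=(u,v)$ of $\Omega$ choose independently a uniformly random permutation $\sigma_e\in S_n$, and for every $i\in[n]$ put an edge between $(u,i)$ and $(v,\sigma_e(i))$. The covering map $\pi:\Gamma\to\Omega$ sends $(v,i)\mapsto v$. The adjacency operator is $(A_G f)(u)=\sum_{v\sim u}f(v)$ (neighbors counted with edge multiplicity). Every eigenvalue of $A_\Omega$ (with multiplicity) is an eigenvalue of $A_\Gamma$; $\lambda_A(\Gamma)$ is the largest absolute value of an element of the multiset difference $\mathrm{Spec}(A_\Gamma)\setminus\mathrm{Spec}(A_\Omega)$. $\rho_A(\Omega)$ is the spectral radius of the adjacency operator of the universal covering tree of $\Omega$, which for $d$-regular $\Omega$ is the $d$-regular tree, with spectral radius $2\sqrt{d-1}$. *)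

theory Defs
  imports
    "Graph_Theory.Digraph_Component"
    "Graph_Theory.Arc_Walk"
    "Jordan_Normal_Form.Char_Poly"
    "HOL-Probability.Product_PMF"
begin

text \<open>
  An undirected multigraph, loops and parallel edges allowed, together with an orientation of each
  of its edges is a \<open>pre_digraph\<close>: its arcs are the edges, and tail and head record the chosen
  orientation. Everything below except the covering construction ignores the orientation, because
  it goes through the symmetric digraph of darts, which contains each edge once in either direction.
  A loop therefore gives two darts at its vertex: it contributes 2 to the degree and to the diagonal
  entry of the adjacency matrix.
\<close>

definition darts :: "('v, 'e) pre_digraph \<Rightarrow> ('v, 'e \<times> bool) pre_digraph" where
  "darts G = \<lparr>verts = verts G, arcs = arcs G \<times> UNIV,
     tail = (\<lambda>(e, b). if b then tail G e else head G e),
     head = (\<lambda>(e, b). if b then head G e else tail G e)\<rparr>"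

fun rev_dart :: "'e \<times> bool \<Rightarrow> 'e \<times> bool" where
  "rev_dart (e, b) = (e, \<not> b)"

definition regular_graph :: "('v, 'e) pre_digraph \<Rightarrow> nat \<Rightarrow> bool" where
  "regular_graph G d \<longleftrightarrow> (\<forall>v \<in> verts G. out_degree (darts G) v = d)"

definition adj_op :: "('v, 'e) pre_digraph \<Rightarrow> ('v \<Rightarrow> complex) \<Rightarrow> 'v \<Rightarrow> complex" where
  "adj_op G f u = (\<Sum>a \<in> out_arcs (darts G) u. f (head (darts G) a))"


subsection \<open>Spectrum of a finite graph\<close>

text \<open>
  The matrix of the adjacency operator in the basis of indicator functions of vertices, with respect
  to an arbitrary enumeration of the vertices (which does not affect the spectrum).
\<close>

definition vertex_list :: "('v, 'e) pre_digraph \<Rightarrow> 'v list" where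
  "vertex_list G = (SOME xs. distinct xs \<and> set xs = verts G)"

definition adj_mat :: "('v, 'e) pre_digraph \<Rightarrow> complex Matrix.mat" where
  "adj_mat G = (let xs = vertex_list G in
     Matrix.mat (length xs) (length xs) (\<lambda>(i, j). adj_op G (\<lambda>v. of_bool (v = xs ! j)) (xs ! i)))"

definition adj_spec :: "('v, 'e) pre_digraph \<Rightarrow> complex multiset" where
  "adj_spec G = proots (char_poly (adj_mat G))"

text \<open>
  The largest absolute value of a new eigenvalue of a covering \<open>\<Gamma>\<close> of \<open>\<Omega>\<close>. The value is
  unspecified if there is none, that is, for one-sheeted coverings.
\<close>

definition lambda_A :: "('v, 'e) pre_digraph \<Rightarrow> ('w, 'f) pre_digraph \<Rightarrow> real" where
  "lambda_A \<Omega> \<Gamma> = Max (cmod ` set_mset (adj_spec \<Gamma> - adj_spec \<Omega>))"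


subsection \<open>Random coverings\<close>

definition covering ::
    "('v, 'e) pre_digraph \<Rightarrow> nat \<Rightarrow> ('e \<Rightarrow> nat \<Rightarrow> nat) \<Rightarrow> ('v \<times> nat, 'e \<times> nat) pre_digraph" where
  "covering \<Omega> n \<sigma> = \<lparr>verts = verts \<Omega> \<times> {1..n}, arcs = arcs \<Omega> \<times> {1..n},
     tail = (\<lambda>(e, i). (tail \<Omega> e, i)),
     head = (\<lambda>(e, i). (head \<Omega> e, \<sigma> e i))\<rparr>"

definition random_covering ::
    "nat \<Rightarrow> ('v, 'e) pre_digraph \<Rightarrow> ('v \<times> nat, 'e \<times> nat) pre_digraph pmf" where
  "random_covering n \<Omega> = map_pmf (covering \<Omega> n)
     (Pi_pmf (arcs \<Omega>) id (\<lambda>_. pmf_of_set {p. p permutes {1..n}}))"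


subsection \<open>The universal covering tree\<close>

text \<open>
  Its vertices are the non-backtracking walks from a base vertex \<open>r\<close>, represented by their lists of
  darts; every nonempty such walk is joined by an edge to the walk without its last step.
\<close>

definition nb_walks :: "('v, 'e) pre_digraph \<Rightarrow> 'v \<Rightarrow> ('e \<times> bool) list set" where
  "nb_walks G r = {p. (\<exists>v. pre_digraph.awalk (darts G) r p v) \<and>
     successively (\<lambda>a b. b \<noteq> rev_dart a) p}"

definition universal_cover ::
    "('v, 'e) pre_digraph \<Rightarrow> 'v \<Rightarrow> (('e \<times> bool) list, ('e \<times> bool) list) pre_digraph" where
  "universal_cover G r = \<lparr>verts = nb_walks G r, arcs = nb_walks G r - {[]},
     tail = butlast, head = id\<rparr>"


subsection \<open>Spectral radius of the adjacency operator on square-summable functions\<close>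

definition ell2 :: "'v set \<Rightarrow> ('v \<Rightarrow> complex) set" where
  "ell2 V = {f. (\<forall>x. x \<notin> V \<longrightarrow> f x = 0) \<and> (\<lambda>x. (cmod (f x))\<^sup>2) summable_on V}"

definition ell2_norm :: "'v set \<Rightarrow> ('v \<Rightarrow> complex) \<Rightarrow> real" where
  "ell2_norm V f = sqrt (\<Sum>\<^sub>\<infinity>x\<in>V. (cmod (f x))\<^sup>2)"

definition bounded_op :: "'v set \<Rightarrow> (('v \<Rightarrow> complex) \<Rightarrow> ('v \<Rightarrow> complex)) \<Rightarrow> bool" where
  "bounded_op V T \<longleftrightarrow>
     (\<forall>f \<in> ell2 V. T f \<in> ell2 V) \<and>
     (\<forall>f \<in> ell2 V. \<forall>g \<in> ell2 V. T (\<lambda>x. f x + g x) = (\<lambda>x. T f x + T g x)) \<and>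
     (\<forall>c. \<forall>f \<in> ell2 V. T (\<lambda>x. c * f x) = (\<lambda>x. c * T f x)) \<and>
     (\<exists>C. \<forall>f \<in> ell2 V. ell2_norm V (T f) \<le> C * ell2_norm V f)"

definition op_spectrum :: "'v set \<Rightarrow> (('v \<Rightarrow> complex) \<Rightarrow> ('v \<Rightarrow> complex)) \<Rightarrow> complex set" where
  "op_spectrum V T = {z. \<not> (\<exists>R. bounded_op V R \<and>
     (\<forall>f \<in> ell2 V. R (\<lambda>x. T f x - z * f x) = f \<and> (\<lambda>x. T (R f) x - z * R f x) = f))}"

definition op_spectral_radius :: "'v set \<Rightarrow> (('v \<Rightarrow> complex) \<Rightarrow> ('v \<Rightarrow> complex)) \<Rightarrow> real" where
  "op_spectral_radius V T = Sup (cmod ` op_spectrum V T)"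

text \<open>For connected graphs the choice of the base vertex is immaterial.\<close>

definition rho_A :: "('v, 'e) pre_digraph \<Rightarrow> real" where
  "rho_A \<Omega> = (let T = universal_cover \<Omega> (SOME r. r \<in> verts \<Omega>)
     in op_spectral_radius (verts T) (adj_op T))"

end

theory Submission
  imports Defs "HOL-Analysis.Analysis" "HOL-Real_Asymp.Real_Asymp" "Jordan_Normal_Form.Schur_Decomposition"
begin

text \<open>
  The proof is the polynomial method of Chen, Garza-Vargas, Tropp and van Handel; it works with any
  positive constant in place of 0.84. Write \<open>q = d - 1\<close> and expand a polynomial \<open>h\<close> of degree \<open>K\<close> in
  Dickson polynomials. The trace of the \<open>k\<close>-th Dickson polynomial of the adjacency operator counts
  the cyclically reduced closed walks of length \<open>k\<close>, up to an explicit multiple of the number of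
  vertices. Sorting the closed walks of the covering by which of their vertices coincide shows that
  the expected sum of \<open>h\<close> over the new spectrum is, after division by \<open>n\<close>, a rational function of
  \<open>1/n\<close> whose degree is linear in \<open>K\<close>. It is bounded by the supremum of \<open>h\<close> on \<open>[-d, d]\<close>, so by an
  inequality of Markov type it differs from its linear part at \<open>1/n = 0\<close> by at most a power of \<open>K\<close>
  divided by \<open>n\<^sup>2\<close>. The first two coefficients only see \<open>h\<close> on \<open>[-2\<surd>q, 2\<surd>q]\<close>: a cyclically reduced
  walk whose quotient graph has Euler characteristic 0 runs around a cycle, and there are few walks
  that run around it more than once. Take \<open>h = P\<^sup>m\<close> with \<open>m\<close> about \<open>log\<^sub>4 n\<close> and \<open>P\<close> at most 1/64 on
  that interval and at least 1/2 beyond \<open>2\<surd>q + \<epsilon>\<close>; Markov's inequality for the expectation finishes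
  the proof.
\<close>

text \<open>These simplification rules turn sums of \<open>of_bool\<close> into cardinalities, which hides the kernel
  products computed below.\<close>

declare sum_of_bool_eq [simp del] sum_mult_of_bool_eq [simp del] sum_of_bool_mult_eq [simp del]

section \<open>Polynomials and their values near zero\<close>

text \<open>Markov's inequality for \<open>P ^ m\<close> loses a factor \<open>2 ^ m\<close>, about
  the square root of n, so an expectation known up to a bounded error would be useless. This is why
  the expansion in 1/n is carried to its second coefficient: the error is then a power of log n
  divided by n. The base 4 makes that error beat \<open>2 ^ m\<close>, and 1/64 leaves room for the
  leading term, which is multiplied by n. As the degree is of order log n, losses polynomial in the
  degree are harmless and crude inequalities suffice. The obstacle is that there are about q^k
  cyclically reduced walks of length k, while the k-th coefficient of \<open>h\<close> is only of
  order (sqrt q)^(-k). The second coefficient is saved by an exact cancellation: walks that lift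
  with pairwise distinct vertices contribute precisely the count for the base graph, which is what
  removing the old spectrum subtracts. The remaining walks around a cycle have a period of at most
  k/2, so that their number is of order k (sqrt q)^k at most, the same square root as in the bound
  for the coefficient.\<close>

fun dickson :: "real \<Rightarrow> nat \<Rightarrow> real poly" where
  "dickson a 0 = [:2:]"
| "dickson a (Suc 0) = [:0, 1:]"
| "dickson a (Suc (Suc k)) = pCons 0 (dickson a (Suc k)) - Polynomial.smult a (dickson a k)"

text \<open>These are Chebyshev polynomials rescaled to [-2s, 2s]. Two scalings occur:
  \<open>s = sqrt q\<close> makes the interval the spectrum of the tree, and \<open>s = 1/2\<close>
  makes it [-1, 1], with 2^(1-k) T_k as the k-th polynomial.\<close>

lemma poly_dickson_cos:
  "poly (dickson (s\<^sup>2) k) (2 * s * cos t) = 2 * s ^ k * cos (real k * t)"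
proof (induction "s\<^sup>2" k rule: dickson.induct)
  case (3 k)
  have "cos (real (Suc (Suc k)) * t) = cos (real (Suc k) * t + t)"
    by (simp add: algebra_simps)
  moreover have "cos (real k * t) = cos (real (Suc k) * t - t)"
    by (simp add: algebra_simps)
  ultimately have *: "cos (real (Suc (Suc k)) * t) = 2 * cos t * cos (real (Suc k) * t) - cos (real k * t)"
    by (simp only: cos_add cos_diff) simp
  have "poly (dickson (s\<^sup>2) (Suc (Suc k))) (2 * s * cos t)
     = 2 * s * cos t * (2 * s ^ Suc k * cos (real (Suc k) * t)) - s\<^sup>2 * (2 * s ^ k * cos (real k * t))"
    using 3 by simp
  also have "\<dots> = 2 * s ^ Suc (Suc k) * (2 * cos t * cos (real (Suc k) * t) - cos (real k * t))"
    by (simp add: algebra_simps power2_eq_square)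
  finally show ?case using * by simp
qed auto

lemma smult_sum_right: "Polynomial.smult c (\<Sum>i\<in>A. f i) = (\<Sum>i\<in>A. Polynomial.smult c (f i))"
  by (induction A rule: infinite_finite_induct) (auto simp: smult_add_right)

text \<open>Multiplication by x turns a Dickson polynomial into a combination of its two neighbours,
  so induction on the degree stays within the span. Index 0 is exceptional because
  \<open>dickson a 0\<close> is the constant 2.\<close>

lemma dickson_expansion_exists:
  assumes "degree p \<le> K"
  shows "\<exists>b. p = (\<Sum>k\<le>K. Polynomial.smult (b k) (dickson a k))"
  using assms
proof (induction K arbitrary: p)
  case 0
  then obtain c where "p = [:c:]" by (metis degree_eq_zeroE le_zero_eq)
  then show ?case by (intro exI[of _ "\<lambda>_. c / 2"]) auto
next
  case (Suc K)
  obtain c p' where p: "p = pCons c p'" by (cases p)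
  with Suc.prems have "degree p' \<le> K" by (auto split: if_splits)
  from Suc.IH[OF this] obtain b where b: "p' = (\<Sum>k\<le>K. Polynomial.smult (b k) (dickson a k))" by blast
  have shift: "pCons 0 (dickson a k) = (if k = 0 then Polynomial.smult 2 (dickson a 1)
      else dickson a (Suc k) + Polynomial.smult a (dickson a (k - 1)))" for k
    by (cases k) auto
  have span: "\<exists>b. pCons 0 (dickson a k) = (\<Sum>j\<le>Suc K. Polynomial.smult (b j) (dickson a j))" if "k \<le> K" for k
  proof (cases "k = 0")
    case True
    show ?thesis unfolding shift using True that
      by (intro exI[of _ "\<lambda>j. if j = 1 then 2 else 0"])
         (simp add: if_distrib[of "\<lambda>c. Polynomial.smult c _"] sum.delta cong: if_cong)
  next
    case False
    have "(\<Sum>j\<le>Suc K. Polynomial.smult ((if j = Suc k then 1 else 0) + (if j = k - 1 then a else 0)) (dickson a j))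
      = (\<Sum>j\<le>Suc K. (if j = Suc k then dickson a j else 0) + (if j = k - 1 then Polynomial.smult a (dickson a j) else 0))"
      by (rule sum.cong) auto
    also have "\<dots> = dickson a (Suc k) + Polynomial.smult a (dickson a (k - 1))"
      unfolding sum.distrib using that by (simp add: sum.delta del: dickson.simps sum.atMost_Suc)
    finally have *: "(\<Sum>j\<le>Suc K. Polynomial.smult ((if j = Suc k then 1 else 0) + (if j = k - 1 then a else 0)) (dickson a j))
      = dickson a (Suc k) + Polynomial.smult a (dickson a (k - 1))" .
    show ?thesis unfolding shift if_not_P[OF False] by (rule exI) (rule *[symmetric])
  qed
  define S where "S = {p. \<exists>b. p = (\<Sum>j\<le>Suc K. Polynomial.smult (b j) (dickson a j))}"
  have add: "x + y \<in> S" if "x \<in> S" "y \<in> S" for x y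
  proof -
    from that obtain b b' where "x = (\<Sum>j\<le>Suc K. Polynomial.smult (b j) (dickson a j))"
      "y = (\<Sum>j\<le>Suc K. Polynomial.smult (b' j) (dickson a j))" unfolding S_def by blast
    then have "x + y = (\<Sum>j\<le>Suc K. Polynomial.smult (b j + b' j) (dickson a j))"
      by (simp only: smult_add_left sum.distrib)
    then show ?thesis unfolding S_def mem_Collect_eq by (rule exI[of _ "\<lambda>j. b j + b' j"])
  qed
  have scale: "Polynomial.smult c x \<in> S" if "x \<in> S" for x c
  proof -
    from that obtain b where "x = (\<Sum>j\<le>Suc K. Polynomial.smult (b j) (dickson a j))" unfolding S_def by blast
    then have "Polynomial.smult c x = (\<Sum>j\<le>Suc K. Polynomial.smult (c * b j) (dickson a j))"
      by (simp only: smult_sum_right smult_smult)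
    then show ?thesis unfolding S_def mem_Collect_eq by (rule exI[of _ "\<lambda>j. c * b j"])
  qed
  have const: "[:c:] \<in> S"
  proof -
    have "[:c:] = (\<Sum>j\<le>Suc K. Polynomial.smult (if j = 0 then c / 2 else 0) (dickson a j))"
      by (simp add: if_distrib[of "\<lambda>c. Polynomial.smult c _"] sum.delta cong: if_cong del: sum.atMost_Suc)
    then show ?thesis unfolding S_def mem_Collect_eq by (rule exI[of _ "\<lambda>j. if j = 0 then c / 2 else 0"])
  qed
  have sums: "(\<Sum>k\<in>A. f k) \<in> S" if "finite A" "\<And>k. k \<in> A \<Longrightarrow> f k \<in> S" for A and f :: "nat \<Rightarrow> real poly"
    using that
  proof (induction A rule: finite_induct)
    case empty
    show ?case using scale[OF const, of 0] by simp
  qed (auto intro: add)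
  have "p = [:c:] + (\<Sum>k\<le>K. Polynomial.smult (b k) (pCons 0 (dickson a k)))"
  proof -
    have "(\<Sum>k\<le>K. Polynomial.smult (b k) (pCons 0 (dickson a k))) = [:0, 1:] * (\<Sum>k\<le>K. Polynomial.smult (b k) (dickson a k))"
      by (simp add: sum_distrib_left mult_smult_right)
    then show ?thesis by (simp add: p b)
  qed
  moreover have "\<dots> \<in> S"
    using span unfolding S_def[symmetric] by (intro add const sums scale) (auto simp: S_def)
  ultimately show ?case unfolding S_def by (simp only: mem_Collect_eq)
qed

text \<open>For positive m the sum is the real part of a geometric series over an N-th root of
  unity, which differs from 1 because m < N.\<close>

lemma sum_cos_equidistant:
  fixes N m :: nat
  assumes "m < N"
  shows "(\<Sum>i<N. cos (real m * (2 * pi * real i / real N))) = (if m = 0 then real N else 0)"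
proof (cases "m = 0")
  case False
  define z where "z = cis (2 * pi * real m / real N)"
  have "z \<noteq> 1"
  proof
    assume "z = 1"
    then have "cos (2 * pi * real m / real N) = 1"
      by (metis z_def cis.simps(1) one_complex.simps(1))
    then obtain k :: int where "2 * pi * real m / real N = of_int k * 2 * pi"
      using cos_one_2pi_int by auto
    then have "real m = of_int k * real N"
      using assms by (simp add: field_simps)
    then have "int m = k * int N" by (metis of_int_eq_iff of_int_mult of_int_of_nat_eq)
    then show False using assms False
      by (metis dvd_triv_right int_dvd_int_iff nat_dvd_not_less neq0_conv)
  qed
  moreover have "z ^ N = 1"
  proof -
    have "z ^ N = cis (2 * pi * real m)"
      unfolding z_def Complex.DeMoivre using assms by (intro arg_cong[where f = cis]) simp
    also have "\<dots> = 1" by (rule cis_multiple_2pi) simp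
    finally show ?thesis .
  qed
  ultimately have "(\<Sum>i<N. z ^ i) = 0"
    using geometric_sum[of z N] by simp
  then have "Re (\<Sum>i<N. z ^ i) = 0" by simp
  moreover have "Re (z ^ i) = cos (real m * (2 * pi * real i / real N))" for i
    by (simp add: z_def Complex.DeMoivre mult_ac)
  ultimately show ?thesis using False by simp
qed auto

text \<open>Discrete Fourier inversion: averaging \<open>poly p\<close> at
  \<open>2 * s * cos t\<close> against cos(kt) over equidistant angles isolates
  \<open>b k * s ^ k\<close>. Only values on [-2s, 2s] enter, which is how the behaviour of a
  polynomial on the tree spectrum controls its expansion.\<close>

lemma dickson_coeff_bound:
  assumes p: "p = (\<Sum>k\<le>K. Polynomial.smult (b k) (dickson (s\<^sup>2) k))" and s: "s \<ge> 0"
    and bd: "\<And>x. \<bar>x\<bar> \<le> 2 * s \<Longrightarrow> \<bar>poly p x\<bar> \<le> S" and k: "k \<le> K"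
  shows "\<bar>b k\<bar> * s ^ k \<le> S"
proof -
  \<comment> \<open>Products of two cosines have frequencies up to 2K, and
    \<open>sum_cos_equidistant\<close> needs them below \<open>N\<close>.\<close>
  define N where "N = 2 * K + 1"
  define \<theta> where "\<theta> i = 2 * pi * real i / real N" for i
  have cosprod: "(\<Sum>i<N. 2 * cos (real j * \<theta> i) * cos (real k * \<theta> i))
      = (if j = k then (if k = 0 then 2 * real N else real N) else 0)" if "j \<le> K" for j
  proof -
    have "2 * cos (real j * t) * cos (real k * t) = cos (real (j + k) * t) + cos (real (max j k - min j k) * t)" for t
    proof (cases "j \<le> k")
      case True
      then have "real (max j k - min j k) * t = real k * t - real j * t" by (simp add: of_nat_diff algebra_simps)
      then show ?thesis by (simp add: cos_diff cos_add distrib_right)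
    next
      case False
      then have "real (max j k - min j k) * t = real j * t - real k * t" by (simp add: of_nat_diff algebra_simps)
      then show ?thesis by (simp add: cos_diff cos_add distrib_right)
    qed
    then have "(\<Sum>i<N. 2 * cos (real j * \<theta> i) * cos (real k * \<theta> i))
      = (\<Sum>i<N. cos (real (j + k) * \<theta> i)) + (\<Sum>i<N. cos (real (max j k - min j k) * \<theta> i))"
      by (simp add: sum.distrib)
    also have "\<dots> = (if j + k = 0 then real N else 0) + (if max j k - min j k = 0 then real N else 0)"
      unfolding \<theta>_def using that k by (subst (1 2) sum_cos_equidistant) (auto simp: N_def)
    also have "\<dots> = (if j = k then (if k = 0 then 2 * real N else real N) else 0)"
      by (auto simp: max_def min_def)
    finally show ?thesis .
  qed
  have "(\<Sum>i<N. poly p (2 * s * cos (\<theta> i)) * cos (real k * \<theta> i))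
     = (\<Sum>i<N. \<Sum>j\<le>K. b j * s ^ j * (2 * cos (real j * \<theta> i) * cos (real k * \<theta> i)))"
    unfolding p poly_sum poly_smult poly_dickson_cos sum_distrib_right by (simp add: mult_ac)
  also have "\<dots> = (\<Sum>j\<le>K. b j * s ^ j * (\<Sum>i<N. 2 * cos (real j * \<theta> i) * cos (real k * \<theta> i)))"
    by (subst sum.swap) (simp add: sum_distrib_left)
  also have "\<dots> = (\<Sum>j\<le>K. if j = k then b k * s ^ k * (if k = 0 then 2 * real N else real N) else 0)"
    by (rule sum.cong) (auto simp: cosprod)
  also have "\<dots> = b k * s ^ k * (if k = 0 then 2 * real N else real N)"
    using k by (simp add: sum.delta)
  finally have eq: "(\<Sum>i<N. poly p (2 * s * cos (\<theta> i)) * cos (real k * \<theta> i))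
     = b k * s ^ k * (if k = 0 then 2 * real N else real N)" .
  have "\<bar>b k * s ^ k\<bar> * real N \<le> \<bar>b k * s ^ k\<bar> * (if k = 0 then 2 * real N else real N)"
    by (intro mult_left_mono) auto
  also have "\<dots> = \<bar>\<Sum>i<N. poly p (2 * s * cos (\<theta> i)) * cos (real k * \<theta> i)\<bar>"
    unfolding eq by (simp add: abs_mult)
  also have "\<dots> \<le> (\<Sum>i<N. S)"
  proof (rule order_trans[OF sum_abs sum_mono])
    fix i
    have "\<bar>2 * s * cos (\<theta> i)\<bar> \<le> 2 * s * 1"
      unfolding abs_mult using s by (intro mult_mono) auto
    then have "\<bar>poly p (2 * s * cos (\<theta> i))\<bar> \<le> S" using bd by simp
    then show "\<bar>poly p (2 * s * cos (\<theta> i)) * cos (real k * \<theta> i)\<bar> \<le> S"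
      unfolding abs_mult
      by (metis abs_cos_le_one abs_ge_zero mult_left_le order_trans)
  qed
  finally have "\<bar>b k * s ^ k\<bar> * real N \<le> S * real N" by (simp add: mult.commute)
  then have "\<bar>b k * s ^ k\<bar> \<le> S" by (simp add: N_def)
  then show ?thesis using s by (simp add: abs_mult)
qed

section \<open>Markov's inequality for derivatives of polynomials\<close>

lemma abs_sin_multiple_le: "\<bar>sin (real k * t)\<bar> \<le> real k * \<bar>sin t\<bar>"
proof (induction k)
  case (Suc k)
  have "\<bar>sin (real (Suc k) * t)\<bar> = \<bar>sin (real k * t) * cos t + cos (real k * t) * sin t\<bar>"
    by (simp add: sin_add algebra_simps)
  also have "\<dots> \<le> \<bar>sin (real k * t)\<bar> * \<bar>cos t\<bar> + \<bar>cos (real k * t)\<bar> * \<bar>sin t\<bar>"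
    by (metis abs_mult abs_triangle_ineq)
  also have "\<dots> \<le> \<bar>sin (real k * t)\<bar> * 1 + 1 * \<bar>sin t\<bar>"
    by (intro add_mono mult_mono) auto
  finally show ?case using Suc by (simp add: algebra_simps)
qed auto

text \<open>Along x = cos t the polynomial is a multiple of cos(kt), so its derivative is a multiple
  of k sin(kt) / sin t, which \<open>abs_sin_multiple_le\<close> bounds by k^2. The division needs
  sin t to be nonzero, whence the open interval.\<close>

lemma pderiv_dickson_bound:
  assumes "\<bar>x\<bar> < 1"
  shows "2 ^ k * \<bar>poly (pderiv (dickson (1/4) k)) x\<bar> \<le> 2 * real k ^ 2"
proof -
  define t where "t = arccos x"
  have x: "cos t = x" and st: "sin t \<noteq> 0"
    using assms by (auto simp: t_def sin_arccos_nonzero)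
  have d1: "((\<lambda>u. poly (dickson (1/4) k) (cos u)) has_real_derivative
      poly (pderiv (dickson (1/4) k)) (cos t) * (- sin t)) (at t)"
    by (rule DERIV_chain'[OF DERIV_cos poly_DERIV])
  have "poly (dickson (1/4) k) (cos u) = 2 * (1/2) ^ k * cos (real k * u)" for u
    using poly_dickson_cos[of "1/2" k u] by (simp add: power2_eq_square)
  then have "((\<lambda>u. poly (dickson (1/4) k) (cos u)) has_real_derivative
      2 * (1/2) ^ k * (- sin (real k * t) * real k)) (at t)"
    by (auto intro!: derivative_eq_intros)
  from DERIV_unique[OF d1 this]
  have "poly (pderiv (dickson (1/4) k)) x * sin t = 2 * (1/2) ^ k * (sin (real k * t) * real k)"
    by (simp add: x)
  then have "\<bar>poly (pderiv (dickson (1/4) k)) x\<bar> * \<bar>sin t\<bar> = 2 * (1/2) ^ k * real k * \<bar>sin (real k * t)\<bar>"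
    by (subst abs_mult[symmetric]) (simp add: abs_mult)
  also have "\<dots> \<le> 2 * (1/2) ^ k * real k * (real k * \<bar>sin t\<bar>)"
    by (intro mult_left_mono abs_sin_multiple_le) auto
  finally have "\<bar>poly (pderiv (dickson (1/4) k)) x\<bar> * \<bar>sin t\<bar> \<le> (2 * (1/2) ^ k * real k ^ 2) * \<bar>sin t\<bar>"
    by (simp add: power2_eq_square)
  then have "\<bar>poly (pderiv (dickson (1/4) k)) x\<bar> \<le> 2 * (1/2) ^ k * real k ^ 2"
    using st by simp
  then show ?thesis by (simp add: field_simps power_one_over)
qed

lemma bound_open_imp_closed_interval:
  fixes f :: "real \<Rightarrow> real"
  assumes "continuous_on UNIV f" "\<And>x. \<lbrakk>a < x; x < b\<rbrakk> \<Longrightarrow> \<bar>f x\<bar> \<le> C" "a < b" "a \<le> x" "x \<le> b"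
  shows "\<bar>f x\<bar> \<le> C"
proof -
  have "closed {x. \<bar>f x\<bar> \<le> C}"
    using assms(1) by (intro closed_Collect_le continuous_intros)
  moreover have "{a<..<b} \<subseteq> {x. \<bar>f x\<bar> \<le> C}" using assms(2) by auto
  ultimately have "closure {a<..<b} \<subseteq> {x. \<bar>f x\<bar> \<le> C}" by (rule closure_minimal[rotated])
  then show ?thesis using assms by (auto simp: closure_greaterThanLessThan)
qed

text \<open>A weak form of Markov's inequality; any bound polynomial in the degree suffices below.\<close>

lemma markov_weak:
  assumes deg: "degree p \<le> M" and bd: "\<And>x. \<bar>x\<bar> \<le> 1 \<Longrightarrow> \<bar>poly p x\<bar> \<le> S" and x: "\<bar>x\<bar> \<le> 1"
  shows "\<bar>poly (pderiv p) x\<bar> \<le> 4 * real M ^ 3 * S"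
proof -
  from bd[of 0] have S: "S \<ge> 0" by simp
  \<comment> \<open>This is the Chebyshev basis of [-1, 1]. Adding up the derivatives of its
    members, each with a coefficient controlled by \<open>S\<close>, costs one factor
    \<open>M\<close> more than the sharp inequality.\<close>
  obtain b where b: "p = (\<Sum>k\<le>M. Polynomial.smult (b k) (dickson (1/4) k))"
    using dickson_expansion_exists[OF deg] by blast
  have bk: "\<bar>b k\<bar> * (1/2) ^ k \<le> S" if "k \<le> M" for k
    by (rule dickson_coeff_bound[where s = "1/2" and p = p and K = M])
       (use b bd that in \<open>auto simp: power2_eq_square\<close>)
  have *: "\<bar>poly (pderiv p) x\<bar> \<le> 4 * real M ^ 3 * S" if x: "-1 < x" "x < 1" for x
  proof -
    have ax: "\<bar>x\<bar> < 1" using x by auto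
    have "pderiv p = (\<Sum>k\<le>M. Polynomial.smult (b k) (pderiv (dickson (1/4) k)))"
      using higher_pderiv_sum[of 1 "\<lambda>k. Polynomial.smult (b k) (dickson (1/4) k)" "{..M}"]
      by (simp add: b pderiv_smult)
    then have "\<bar>poly (pderiv p) x\<bar> = \<bar>\<Sum>k\<le>M. b k * poly (pderiv (dickson (1/4) k)) x\<bar>"
      by (simp add: poly_sum)
    also have "\<dots> \<le> (\<Sum>k\<le>M. if k = 0 then 0 else S * (2 * real M ^ 2))"
    proof (rule order_trans[OF sum_abs sum_mono])
      fix k assume "k \<in> {..M}"
      then have kM: "k \<le> M" by simp
      have "\<bar>b k * poly (pderiv (dickson (1/4) k)) x\<bar>
         = (\<bar>b k\<bar> * (1/2) ^ k) * (2 ^ k * \<bar>poly (pderiv (dickson (1/4) k)) x\<bar>)"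
        by (simp add: abs_mult power_one_over)
      also have "\<dots> \<le> S * (2 * real k ^ 2)"
        by (intro mult_mono bk[OF kM] pderiv_dickson_bound[OF ax]) (use S in auto)
      also have "\<dots> \<le> (if k = 0 then 0 else S * (2 * real M ^ 2))"
        using kM S by (auto intro!: mult_left_mono power_mono)
      finally show "\<bar>b k * poly (pderiv (dickson (1/4) k)) x\<bar> \<le> (if k = 0 then 0 else S * (2 * real M ^ 2))" .
    qed
    also have "\<dots> = (\<Sum>k\<in>{..M} - {0}. S * (2 * real M ^ 2))"
      by (intro sum.mono_neutral_cong_right) auto
    also have "\<dots> = 2 * real M ^ 3 * S"
      by (simp add: card_Diff_subset power3_eq_cube power2_eq_square)
    also have "\<dots> \<le> 4 * real M ^ 3 * S" using S by simp
    finally show ?thesis .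
  qed
  show ?thesis
    by (rule bound_open_imp_closed_interval[of "\<lambda>x. poly (pderiv p) x" "-1" 1])
       (use * x in \<open>auto intro!: continuous_intros\<close>)
qed

lemma markov_weak_interval:
  assumes deg: "degree p \<le> M" and \<delta>: "\<delta> > 0"
    and bd: "\<And>x. \<lbrakk>0 \<le> x; x \<le> \<delta>\<rbrakk> \<Longrightarrow> \<bar>poly p x\<bar> \<le> S" and x: "0 \<le> x" "x \<le> \<delta>"
  shows "\<bar>poly (pderiv p) x\<bar> \<le> 8 * real M ^ 3 * S / \<delta>"
proof -
  define r where "r = pcompose p [:\<delta>/2, \<delta>/2:]"
  have "degree r \<le> M"
    using deg \<delta> by (simp add: r_def degree_pcompose)
  moreover have "\<bar>poly r y\<bar> \<le> S" if "\<bar>y\<bar> \<le> 1" for y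
  proof -
    have "poly r y = poly p (\<delta> / 2 + y * (\<delta> / 2))" by (simp add: r_def poly_pcompose)
    moreover have "0 \<le> \<delta> / 2 * (1 + y)" "\<delta> / 2 * (1 + y) \<le> \<delta> / 2 * 2"
      using that \<delta> by (auto intro!: mult_left_mono simp: abs_le_iff)
    ultimately show ?thesis using bd[of "\<delta> / 2 + y * (\<delta> / 2)"] by (simp add: algebra_simps)
  qed
  moreover have "\<bar>2 * x / \<delta> - 1\<bar> \<le> 1" using x \<delta> by (auto simp: abs_le_iff field_simps)
  ultimately have "\<bar>poly (pderiv r) (2 * x / \<delta> - 1)\<bar> \<le> 4 * real M ^ 3 * S"
    by (rule markov_weak)
  moreover have "poly (pderiv r) (2 * x / \<delta> - 1) = poly (pderiv p) x * (\<delta> / 2)"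
    using \<delta> by (simp add: r_def pderiv_pcompose poly_pcompose pderiv_pCons field_simps)
  ultimately show ?thesis using \<delta> by (simp add: abs_mult field_simps)
qed

section \<open>From bounds at reciprocals of integers to bounds on an interval\<close>

lemma exists_near_reciprocal:
  fixes x :: real
  assumes "0 \<le> x" "x \<le> 1 / real L" "L \<ge> 1"
  shows "\<exists>n\<ge>L. \<bar>x - 1 / real n\<bar> \<le> (1 / real L)\<^sup>2"
proof (cases "x = 0")
  case True
  have "L \<le> L\<^sup>2" using assms by (simp add: power2_eq_square)
  then show ?thesis using True by (intro exI[of _ "L\<^sup>2"]) (simp add: power_one_over)
next
  case False
  with assms have x: "x > 0" by simp
  \<comment> \<open>Rounding 1/x up keeps 1/n below x, and the gap x - 1/n is at most x/n, a product
    of two numbers that are at most 1/L.\<close>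
  define n where "n = nat \<lceil>1 / x\<rceil>"
  have n1: "1 / x \<le> real n" and n2: "real n < 1 / x + 1"
    unfolding n_def using x by (auto simp: of_nat_ceiling) linarith
  have "real L \<le> 1 / x" using assms x by (simp add: field_simps)
  with n1 have Ln: "L \<le> n" by linarith
  have n0: "real n > 0" using Ln assms by linarith
  have nx: "1 \<le> real n * x" using n1 x by (simp add: field_simps)
  have nx2: "real n * x < 1 + x" using n2 x by (simp add: field_simps)
  have "0 \<le> x - 1 / real n" using nx n0 by (simp add: field_simps)
  moreover have "x - 1 / real n \<le> x * (1 / real n)"
  proof -
    have "x - 1 / real n = (real n * x - 1) / real n" using n0 by (simp add: field_simps)
    also have "\<dots> \<le> x / real n" using nx2 n0 by (intro divide_right_mono) auto
    finally show ?thesis by simp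
  qed
  moreover have "x * (1 / real n) \<le> (1 / real L) * (1 / real L)"
    using assms x Ln by (intro mult_mono) (auto simp: field_simps)
  ultimately show ?thesis using Ln by (intro exI[of _ n]) (auto simp: power2_eq_square)
qed

text \<open>The points \<open>1/n\<close> near 0 are so dense that a bound there controls a polynomial on a whole
  interval \<open>[0, \<delta>]\<close>, with \<open>\<delta>\<close> only polynomially small in the degree.\<close>

lemma poly_bound_from_reciprocals:
  assumes deg: "degree G \<le> M" and L: "L \<ge> 16 * M ^ 3" "L \<ge> 1"
    and bd: "\<And>n. n \<ge> L \<Longrightarrow> \<bar>poly G (1 / real n)\<bar> \<le> B"
    and x: "0 \<le> x" "x \<le> 1 / real L"
  shows "\<bar>poly G x\<bar> \<le> 2 * B"
proof -
  define \<delta> where "\<delta> = 1 / real L"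
  have \<delta>: "\<delta> > 0" using L by (simp add: \<delta>_def)
  have "\<exists>y\<in>{0..\<delta>}. \<forall>z\<in>{0..\<delta>}. \<bar>poly G z\<bar> \<le> \<bar>poly G y\<bar>"
    using \<delta> by (intro continuous_attains_sup) (auto intro!: continuous_intros)
  then obtain y where y: "0 \<le> y" "y \<le> \<delta>" and ymax: "\<And>z. \<lbrakk>0 \<le> z; z \<le> \<delta>\<rbrakk> \<Longrightarrow> \<bar>poly G z\<bar> \<le> \<bar>poly G y\<bar>"
    by auto
  \<comment> \<open>\<open>S\<close> is the unknown maximum, attained at \<open>y\<close>. Markov's
    inequality bounds the slope by a multiple of \<open>S\<close> itself, and some reciprocal is so
    close to \<open>y\<close> that the value changes by at most \<open>S / 2\<close> on the way; the
    bound at reciprocals then caps \<open>S\<close>.\<close>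
  define S where "S = \<bar>poly G y\<bar>"
  obtain n where n: "n \<ge> L" "\<bar>y - 1 / real n\<bar> \<le> \<delta>\<^sup>2"
    using exists_near_reciprocal[of y L] y L unfolding \<delta>_def by auto
  have n\<delta>: "0 \<le> 1 / real n" "1 / real n \<le> \<delta>" using n L by (auto simp: \<delta>_def field_simps)
  have "norm (poly G y - poly G (1 / real n)) \<le> (8 * real M ^ 3 * S / \<delta>) * norm (y - 1 / real n)"
  proof (rule field_differentiable_bound[of "{0..\<delta>}" "poly G" "poly (pderiv G)"])
    show "norm (poly (pderiv G) z) \<le> 8 * real M ^ 3 * S / \<delta>" if "z \<in> {0..\<delta>}" for z
      unfolding real_norm_def
      by (rule markov_weak_interval[OF deg \<delta>]) (use that ymax in \<open>auto simp: S_def\<close>)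
  qed (use y n\<delta> in \<open>auto intro: poly_DERIV DERIV_subset\<close>)
  also have "\<dots> \<le> (8 * real M ^ 3 * S / \<delta>) * \<delta>\<^sup>2"
    using n(2) \<delta> by (intro mult_left_mono) (auto simp: S_def)
  also have "\<dots> = 8 * real M ^ 3 * S * \<delta>"
    using \<delta> by (simp add: power2_eq_square)
  also have "\<dots> = (16 * real M ^ 3 * \<delta>) * (S / 2)" by simp
  also have "\<dots> \<le> 1 * (S / 2)"
  proof (intro mult_right_mono)
    have "16 * real M ^ 3 \<le> real L" using L(1) by (metis of_nat_le_iff of_nat_mult of_nat_numeral of_nat_power)
    then show "16 * real M ^ 3 * \<delta> \<le> 1" using L by (simp add: \<delta>_def field_simps)
  qed (simp add: S_def)
  finally have "\<bar>poly G y - poly G (1 / real n)\<bar> \<le> S / 2" by simp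
  then have "S \<le> \<bar>poly G (1 / real n)\<bar> + S / 2" unfolding S_def by linarith
  then have "S \<le> 2 * B" using bd[OF n(1)] by linarith
  then show ?thesis using ymax[of x] x unfolding S_def \<delta>_def by linarith
qed

text \<open>Taylor expansion with a second-order remainder: applying
  \<open>markov_weak_interval\<close> twice bounds the second derivative on [0, \<delta>]. As
  1/\<delta> is 16 M^3, each application costs 128 M^6, and 16384 is 128 squared. The last factor 2
  comes from \<open>poly_bound_from_reciprocals\<close>.\<close>

lemma poly_first_order_bound:
  assumes deg: "degree G \<le> M" and M: "M \<ge> 1" "M \<ge> N0"
    and bd: "\<And>n. n \<ge> N0 \<Longrightarrow> \<bar>poly G (1 / real n)\<bar> \<le> B"
    and n: "n \<ge> 16 * M ^ 3"
  shows "\<bar>poly G (1 / real n)\<bar> \<le> \<bar>poly G 0\<bar> + \<bar>poly (pderiv G) 0\<bar> / real n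
    + 16384 * real M ^ 12 * B * 2 / (real n)\<^sup>2"
proof -
  define L where "L = 16 * M ^ 3"
  define \<delta> where "\<delta> = 1 / real L"
  have "M * 1 \<le> M * M\<^sup>2" using M by (intro mult_le_mono) auto
  then have "M \<le> M ^ 3" by (simp add: power3_eq_cube power2_eq_square)
  then have L: "L \<ge> 1" "L \<ge> N0" using M by (auto simp: L_def)
  have \<delta>: "\<delta> > 0" using L by (simp add: \<delta>_def)
  have b0: "\<bar>poly G x\<bar> \<le> 2 * B" if "0 \<le> x" "x \<le> \<delta>" for x
    by (rule poly_bound_from_reciprocals[OF deg, of L]) (use that bd L in \<open>auto simp: L_def \<delta>_def\<close>)
  have b1: "\<bar>poly (pderiv G) x\<bar> \<le> 8 * real M ^ 3 * (2 * B) / \<delta>" if "0 \<le> x" "x \<le> \<delta>" for x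
    by (rule markov_weak_interval[OF deg \<delta> b0 that]) auto
  have deg': "degree (pderiv G) \<le> M" using deg by (simp add: degree_pderiv)
  define C where "C = 8 * real M ^ 3 * (8 * real M ^ 3 * (2 * B) / \<delta>) / \<delta>"
  have b2: "\<bar>poly (pderiv (pderiv G)) x\<bar> \<le> C" if "0 \<le> x" "x \<le> \<delta>" for x
    unfolding C_def by (rule markov_weak_interval[OF deg' \<delta> b1 that]) auto
  define x where "x = 1 / real n"
  have n0: "n \<ge> 1" using n L unfolding L_def by linarith
  have x: "0 < x" "x \<le> \<delta>" using n n0 L unfolding x_def \<delta>_def L_def[symmetric] by (auto simp: field_simps)
  have "\<bar>poly (pderiv G) z - poly (pderiv G) 0\<bar> \<le> C * x" if z: "0 \<le> z" "z \<le> x" for z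
  proof -
    have "norm (poly (pderiv G) z - poly (pderiv G) 0) \<le> C * norm (z - 0)"
    proof (rule field_differentiable_bound[of "{0..\<delta>}" _ "poly (pderiv (pderiv G))"])
      show "norm (poly (pderiv (pderiv G)) z) \<le> C" if "z \<in> {0..\<delta>}" for z
        using b2 that by auto
    qed (use z x in \<open>auto intro: poly_DERIV DERIV_subset\<close>)
    also have "\<dots> \<le> C * x"
      using z b2[of 0] \<delta> by (intro mult_left_mono) auto
    finally show ?thesis by simp
  qed
  then have b3: "\<bar>poly (pderiv G) z\<bar> \<le> \<bar>poly (pderiv G) 0\<bar> + C * x" if "0 \<le> z" "z \<le> x" for z
    using that by (smt (verit))
  have "norm (poly G x - poly G 0) \<le> (\<bar>poly (pderiv G) 0\<bar> + C * x) * norm (x - 0)"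
  proof (rule field_differentiable_bound[of "{0..x}" _ "poly (pderiv G)"])
    show "norm (poly (pderiv G) z) \<le> \<bar>poly (pderiv G) 0\<bar> + C * x" if "z \<in> {0..x}" for z
      using b3 that by auto
  qed (use x in \<open>auto intro: poly_DERIV DERIV_subset\<close>)
  then have "\<bar>poly G x\<bar> \<le> \<bar>poly G 0\<bar> + \<bar>poly (pderiv G) 0\<bar> * x + C * x\<^sup>2"
    using x by (simp add: power2_eq_square algebra_simps)
  moreover have "C = 16384 * real M ^ 12 * B * 2"
    unfolding C_def \<delta>_def L_def by (simp add: field_simps) 
  ultimately show ?thesis by (simp add: x_def power_one_over)
qed

section \<open>Non-backtracking walks in a regular graph\<close>

primrec kpow :: "'a set \<Rightarrow> ('a \<Rightarrow> 'a \<Rightarrow> real) \<Rightarrow> nat \<Rightarrow> 'a \<Rightarrow> 'a \<Rightarrow> real" where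
  "kpow V a 0 = (\<lambda>x y. of_bool (x = y))"
| "kpow V a (Suc k) = (\<lambda>x y. \<Sum>z\<in>V. a x z * kpow V a k z y)"

text \<open>Kernels replace matrices so that the same lemmas serve the adjacency of vertices and the
  non-backtracking steps of darts, without enumerating either.\<close>

definition kpoly :: "'a set \<Rightarrow> ('a \<Rightarrow> 'a \<Rightarrow> real) \<Rightarrow> real poly \<Rightarrow> 'a \<Rightarrow> 'a \<Rightarrow> real" where
  "kpoly V a p x y = (\<Sum>i\<le>degree p. coeff p i * kpow V a i x y)"

lemma sum_of_bool_collapse:
  assumes "finite V" "x \<in> V"
  shows "(\<Sum>z\<in>V. of_bool (x = z) * f z) = (f x :: real)" "(\<Sum>z\<in>V. of_bool (z = x) * f z) = (f x :: real)"
    "(\<Sum>z\<in>V. f z * of_bool (x = z)) = (f x :: real)" "(\<Sum>z\<in>V. f z * of_bool (z = x)) = (f x :: real)"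
  using assms by (simp_all add: of_bool_def if_distrib[of "\<lambda>c. c * _"] if_distrib[of "\<lambda>c. _ * c"] sum.delta sum.delta' cong: if_cong)

lemma sum_of_bool_single: "finite V \<Longrightarrow> x \<in> V \<Longrightarrow> (\<Sum>z\<in>V. of_bool (z = x)) = (1 :: real)"
  by (simp add: of_bool_def)

lemma kpow_add:
  assumes "finite V" "x \<in> V"
  shows "kpow V a (i + j) x y = (\<Sum>z\<in>V. kpow V a i x z * kpow V a j z y)"
  using assms(2)
proof (induction i arbitrary: x)
  case 0
  then show ?case using assms by (simp add: sum_of_bool_collapse)
next
  case (Suc i)
  have "kpow V a (Suc i + j) x y = (\<Sum>u\<in>V. \<Sum>z\<in>V. a x u * kpow V a i u z * kpow V a j z y)"
    by (simp add: Suc sum_distrib_left mult.assoc)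
  also have "\<dots> = (\<Sum>z\<in>V. kpow V a (Suc i) x z * kpow V a j z y)"
    by (subst sum.swap) (simp add: sum_distrib_right)
  finally show ?case .
qed

lemma kpow_1: "finite V \<Longrightarrow> y \<in> V \<Longrightarrow> kpow V a (Suc 0) x y = a x y"
  by (simp add: sum_of_bool_collapse)

lemma kpow_Suc_right:
  assumes "finite V" "x \<in> V" "y \<in> V"
  shows "kpow V a (Suc k) x y = (\<Sum>z\<in>V. kpow V a k x z * a z y)"
  using kpow_add[OF assms(1,2), of a k "Suc 0" y] assms by (simp add: kpow_1 del: kpow.simps)

lemma kpow_sym:
  assumes "finite V" "\<And>x y. x \<in> V \<Longrightarrow> y \<in> V \<Longrightarrow> a x y = a y x" "x \<in> V" "y \<in> V"
  shows "kpow V a k x y = kpow V a k y x"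
  using assms(3,4)
proof (induction k arbitrary: x y)
  case (Suc k)
  have "kpow V a (Suc k) x y = (\<Sum>z\<in>V. kpow V a k y z * a z x)"
    using Suc assms(2) by (simp add: mult.commute)
  then show ?case using Suc.prems assms(1) by (simp add: kpow_Suc_right del: kpow.simps)
qed auto

lemma kpoly_superset: "degree p \<le> n \<Longrightarrow> kpoly V a p x y = (\<Sum>i\<le>n. coeff p i * kpow V a i x y)"
  unfolding kpoly_def by (rule sum.mono_neutral_left) (auto simp: coeff_eq_0)

lemma kpoly_0 [simp]: "kpoly V a 0 x y = 0"
  by (simp add: kpoly_def)

lemma kpoly_const [simp]: "kpoly V a [:c:] x y = c * of_bool (x = y)"
  by (simp add: kpoly_def)

lemma kpoly_add: "kpoly V a (p + r) x y = kpoly V a p x y + kpoly V a r x y"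
proof -
  define n where "n = max (degree p) (degree r)"
  have "degree (p + r) \<le> n" "degree p \<le> n" "degree r \<le> n"
    by (auto simp: n_def degree_add_le_max)
  then show ?thesis by (simp add: kpoly_superset[of _ n] sum.distrib distrib_right)
qed

lemma kpoly_smult: "kpoly V a (Polynomial.smult c p) x y = c * kpoly V a p x y"
  by (simp add: kpoly_superset[of "Polynomial.smult c p" "degree p"] kpoly_def sum_distrib_left mult.assoc)

lemma kpoly_diff: "kpoly V a (p - r) x y = kpoly V a p x y - kpoly V a r x y"
  using kpoly_add[of V a p "Polynomial.smult (- 1) r" x y] unfolding kpoly_smult by simp

lemma kpoly_pCons_0: "kpoly V a (pCons 0 p) x y = (\<Sum>z\<in>V. a x z * kpoly V a p z y)"
proof -
  have "kpoly V a (pCons 0 p) x y = (\<Sum>i\<le>Suc (degree p). coeff (pCons 0 p) i * kpow V a i x y)"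
    by (rule kpoly_superset) (simp add: degree_pCons_le)
  also have "\<dots> = (\<Sum>i\<le>degree p. \<Sum>z\<in>V. a x z * (coeff p i * kpow V a i z y))"
    by (simp add: sum.atMost_Suc_shift sum_distrib_left mult_ac del: sum.atMost_Suc)
  also have "\<dots> = (\<Sum>z\<in>V. a x z * kpoly V a p z y)"
    by (subst sum.swap) (simp add: kpoly_def sum_distrib_left)
  finally show ?thesis .
qed

lemma kpoly_pCons: "kpoly V a (pCons c p) x y = c * of_bool (x = y) + (\<Sum>z\<in>V. a x z * kpoly V a p z y)"
proof -
  have "pCons c p = [:c:] + pCons 0 p" by simp
  then show ?thesis by (simp only: kpoly_add kpoly_const kpoly_pCons_0)
qed

lemma kpoly_mult:
  assumes "finite V" "x \<in> V"
  shows "kpoly V a (p * r) x y = (\<Sum>z\<in>V. kpoly V a p x z * kpoly V a r z y)"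
  using assms(2)
proof (induction p arbitrary: x)
  case (pCons c p)
  have "kpoly V a (pCons c p * r) x y = c * kpoly V a r x y
      + (\<Sum>u\<in>V. \<Sum>z\<in>V. a x u * kpoly V a p u z * kpoly V a r z y)"
    using pCons by (simp add: kpoly_add kpoly_smult kpoly_pCons_0 sum_distrib_left mult.assoc)
  also have "\<dots> = c * kpoly V a r x y + (\<Sum>z\<in>V. (\<Sum>u\<in>V. a x u * kpoly V a p u z) * kpoly V a r z y)"
    by (subst sum.swap) (simp add: sum_distrib_right)
  also have "\<dots> = (\<Sum>z\<in>V. kpoly V a (pCons c p) x z * kpoly V a r z y)"
    using assms pCons.prems
    by (simp only: kpoly_pCons distrib_right sum.distrib mult.assoc sum_distrib_left[symmetric] sum_of_bool_collapse)
  finally show ?case .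
qed simp

lemma kpoly_sym:
  assumes "finite V" "\<And>x y. x \<in> V \<Longrightarrow> y \<in> V \<Longrightarrow> a x y = a y x" "x \<in> V" "y \<in> V"
  shows "kpoly V a p x y = kpoly V a p y x"
  unfolding kpoly_def using kpow_sym[where a = a, OF assms] by simp

section \<open>Non-backtracking walks as polynomials in the adjacency kernel\<close>

definition adjacency :: "('v, 'e) pre_digraph \<Rightarrow> 'v \<Rightarrow> 'v \<Rightarrow> real" where
  "adjacency G u v = (\<Sum>a\<in>out_arcs (darts G) u. of_bool (head (darts G) a = v))"

definition nb_step :: "('v, 'e) pre_digraph \<Rightarrow> 'e \<times> bool \<Rightarrow> 'e \<times> bool \<Rightarrow> bool" where
  "nb_step G a b \<longleftrightarrow> head (darts G) a = tail (darts G) b \<and> b \<noteq> rev_dart a"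

text \<open>This is the Hashimoto matrix of the graph.\<close>

abbreviation nb_kernel :: "('v, 'e) pre_digraph \<Rightarrow> 'e \<times> bool \<Rightarrow> 'e \<times> bool \<Rightarrow> real" where
  "nb_kernel G a b \<equiv> of_bool (nb_step G a b)"

lemma rev_dart_rev_dart [simp]: "rev_dart (rev_dart a) = a"
  by (cases a) auto

lemma rev_dart_neq [simp]: "rev_dart a \<noteq> a" "a \<noteq> rev_dart a"
  by (cases a; auto)+

lemma rev_dart_eq_iff: "rev_dart a = b \<longleftrightarrow> a = rev_dart b"
  by (metis rev_dart_rev_dart)

lemma tail_rev_dart [simp]: "tail (darts G) (rev_dart a) = head (darts G) a"
  and head_rev_dart [simp]: "head (darts G) (rev_dart a) = tail (darts G) a"
  and rev_dart_in_darts [simp]: "rev_dart a \<in> arcs (darts G) \<longleftrightarrow> a \<in> arcs (darts G)"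
  by (cases a; auto simp: darts_def)+

lemma bij_betw_rev_dart: "bij_betw rev_dart (arcs (darts G)) (arcs (darts G))"
  by (rule bij_betwI[of _ _ _ rev_dart]) auto

text \<open>Evaluated at the adjacency matrix, \<open>nb_poly q m\<close> counts non-backtracking walks of length \<open>m + 1\<close>.\<close>

fun nb_poly :: "real \<Rightarrow> nat \<Rightarrow> real poly" where
  "nb_poly q 0 = [:0, 1:]"
| "nb_poly q (Suc 0) = [:- (q + 1), 0, 1:]"
| "nb_poly q (Suc (Suc m)) = pCons 0 (nb_poly q (Suc m)) - Polynomial.smult q (nb_poly q m)"

text \<open>Both sides obey the recursion of the Dickson polynomials in \<open>m\<close>, so only
  the irregular start of \<open>nb_poly\<close> at \<open>m = 0\<close> and \<open>m = 1\<close> has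
  to be checked.\<close>

lemma nb_poly_dickson:
  "nb_poly q (m + 2) - Polynomial.smult q (nb_poly q m) = dickson q (m + 3) - dickson q (m + 1)"
proof (induction m rule: nat_less_induct)
  case (1 m)
  consider "m = 0" | "m = 1" | k where "m = Suc (Suc k)"
    by (metis One_nat_def not0_implies_Suc)
  then show ?case
  proof cases
    case 3
    have eq1: "nb_poly q (k + 3) = dickson q (k + 4) - dickson q (k + 2) + Polynomial.smult q (nb_poly q (k + 1))"
      using 1[rule_format, of "k + 1"] 3 by (simp add: numeral_eq_Suc algebra_simps del: nb_poly.simps dickson.simps)
    have eq2: "nb_poly q (k + 2) = dickson q (k + 3) - dickson q (k + 1) + Polynomial.smult q (nb_poly q k)"
      using 1[rule_format, of k] 3 by (simp add: numeral_eq_Suc algebra_simps del: nb_poly.simps dickson.simps)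
    have r1: "nb_poly q (m + 2) = pCons 0 (nb_poly q (k + 3)) - Polynomial.smult q (nb_poly q (k + 2))"
      and r2: "nb_poly q m = pCons 0 (nb_poly q (k + 1)) - Polynomial.smult q (nb_poly q k)"
      and r3: "dickson q (m + 3) = pCons 0 (dickson q (k + 4)) - Polynomial.smult q (dickson q (k + 3))"
      and r4: "dickson q (m + 1) = pCons 0 (dickson q (k + 2)) - Polynomial.smult q (dickson q (k + 1))"
      by (simp_all add: 3 numeral_eq_Suc)
    have pC: "pCons 0 (x + y) = pCons 0 x + pCons 0 y" "pCons 0 (x - y) = pCons 0 x - pCons 0 y"
      "pCons 0 (Polynomial.smult q x) = Polynomial.smult q (pCons 0 x)" for x y :: "real poly"
      by simp_all
    show ?thesis
      unfolding r1 r2 r3 r4 eq1 eq2 pC by (simp add: smult_add_right smult_diff_right del: nb_poly.simps dickson.simps)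
  qed (simp_all add: numeral_eq_Suc algebra_simps)
qed

text \<open>The number \<open>q\<close> of non-backtracking continuations of a dart is kept as a
  real number, which avoids truncated subtraction and lets it serve as a coefficient of
  polynomials.\<close>

locale regular_multigraph =
  fixes G :: "('v, 'e) pre_digraph" and d :: nat and q :: real
  assumes fin: "fin_digraph G" and reg: "regular_graph G d" and q: "real d = q + 1" 
begin

abbreviation "V \<equiv> verts G"
abbreviation "D \<equiv> arcs (darts G)"
abbreviation "src \<equiv> tail (darts G)"
abbreviation "tgt \<equiv> head (darts G)"
abbreviation "B \<equiv> nb_kernel G"

lemma finite_V [simp]: "finite V" and finite_D [simp]: "finite D"
  using fin by (auto simp: fin_digraph_def fin_digraph_axioms_def darts_def)

lemma src_in_V [simp]: "a \<in> D \<Longrightarrow> src a \<in> V" and tgt_in_V [simp]: "a \<in> D \<Longrightarrow> tgt a \<in> V"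
  using fin by (auto simp: fin_digraph_def wf_digraph_def darts_def split: if_splits)

lemma out_count: "u \<in> V \<Longrightarrow> (\<Sum>a\<in>D. of_bool (src a = u)) = real d"
proof -
  assume u: "u \<in> V"
  have "(\<Sum>a\<in>D. of_bool (src a = u)) = real (card {a \<in> D. src a = u})"
    by (simp add: sum_of_bool_eq Int_def conj_commute)
  also have "{a \<in> D. src a = u} = out_arcs (darts G) u" by (auto simp: out_arcs_def)
  also have "card \<dots> = d" using reg u by (simp add: regular_graph_def out_degree_def)
  finally show ?thesis .
qed

lemma sum_rev_dart: "(\<Sum>a\<in>D. f (rev_dart a)) = (\<Sum>a\<in>D. f a)"
  by (rule sum.reindex_bij_betw[OF bij_betw_rev_dart])

lemma adjacency_altdef: "adjacency G u v = (\<Sum>a\<in>D. of_bool (src a = u) * of_bool (tgt a = v))"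
proof -
  have "adjacency G u v = (\<Sum>a\<in>D. if src a = u then of_bool (tgt a = v) else 0)"
    unfolding adjacency_def out_arcs_def by (simp add: sum.If_cases Int_def)
  also have "\<dots> = (\<Sum>a\<in>D. of_bool (src a = u) * of_bool (tgt a = v))"
    by (rule sum.cong) auto
  finally show ?thesis .
qed

lemma adjacency_sym: "adjacency G u v = adjacency G v u"
  unfolding adjacency_altdef by (subst sum_rev_dart[symmetric]) (simp add: mult.commute)

text \<open>The difference is exact because the reverse of \<open>a\<close> always starts where
  \<open>a\<close> ends. It splits sums over non-backtracking continuations into an unrestricted sum
  and a correction.\<close>

lemma B_split: "B a c = of_bool (tgt a = src c) - of_bool (c = rev_dart a)"
  by (auto simp: nb_step_def)

definition W :: "nat \<Rightarrow> 'v \<Rightarrow> 'v \<Rightarrow> real" where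
  "W m u v = (\<Sum>a\<in>D. \<Sum>b\<in>D. of_bool (src a = u) * kpow D B m a b * of_bool (tgt b = v))"

lemma W_0: "W 0 u v = adjacency G u v"
  unfolding W_def adjacency_altdef
  by (rule sum.cong) (auto simp: mult.assoc sum_of_bool_collapse simp flip: sum_distrib_left)

lemma sum_V_of_bool: "a \<in> D \<Longrightarrow> (\<Sum>z\<in>V. of_bool (tgt a = z) * f z) = (f (tgt a) :: real)"
  by (simp add: sum_of_bool_collapse)

lemma sum_V_adjacency:
  "(\<Sum>z\<in>V. adjacency G u z * f z) = (\<Sum>a\<in>D. of_bool (src a = u) * f (tgt a))"
proof -
  have "(\<Sum>z\<in>V. adjacency G u z * f z) = (\<Sum>a\<in>D. of_bool (src a = u) * (\<Sum>z\<in>V. of_bool (tgt a = z) * f z))"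
    unfolding adjacency_altdef by (simp add: sum_distrib_right sum_distrib_left mult.assoc) (rule sum.swap)
  also have "\<dots> = (\<Sum>a\<in>D. of_bool (src a = u) * f (tgt a))"
    by (intro sum.cong) (simp_all add: sum_V_of_bool)
  finally show ?thesis .
qed

text \<open>A step put in front of a non-backtracking walk either prolongs it to another one or is
  undone at once; the last sum collects the second case.\<close>

lemma W_rec:
  "(\<Sum>z\<in>V. adjacency G u z * W m z v) = W (Suc m) u v
    + (\<Sum>a\<in>D. of_bool (src a = u) * (\<Sum>b\<in>D. kpow D B m (rev_dart a) b * of_bool (tgt b = v)))"
proof -
  have "(\<Sum>z\<in>V. adjacency G u z * W m z v)
    = (\<Sum>a\<in>D. of_bool (src a = u) * (\<Sum>c\<in>D. of_bool (tgt a = src c) * (\<Sum>b\<in>D. kpow D B m c b * of_bool (tgt b = v))))"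
  proof -
    have "src c = tgt a \<longleftrightarrow> tgt a = src c" for a c by (rule eq_commute)
    then show ?thesis unfolding sum_V_adjacency W_def by (simp add: sum_distrib_left mult.assoc)
  qed
  also have "\<dots> = (\<Sum>a\<in>D. of_bool (src a = u) * (\<Sum>c\<in>D. B a c * (\<Sum>b\<in>D. kpow D B m c b * of_bool (tgt b = v))
        + of_bool (c = rev_dart a) * (\<Sum>b\<in>D. kpow D B m c b * of_bool (tgt b = v))))"
    unfolding B_split by (simp add: algebra_simps)
  also have "\<dots> = (\<Sum>a\<in>D. of_bool (src a = u) * (\<Sum>c\<in>D. B a c * (\<Sum>b\<in>D. kpow D B m c b * of_bool (tgt b = v))))
    + (\<Sum>a\<in>D. of_bool (src a = u) * (\<Sum>b\<in>D. kpow D B m (rev_dart a) b * of_bool (tgt b = v)))"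
    unfolding sum.distrib distrib_left
    by (intro arg_cong2[where f = "(+)"] refl sum.cong) (subst sum_of_bool_collapse(2); simp)
  also have "(\<Sum>a\<in>D. of_bool (src a = u) * (\<Sum>c\<in>D. B a c * (\<Sum>b\<in>D. kpow D B m c b * of_bool (tgt b = v)))) = W (Suc m) u v"
  proof -
    have "(\<Sum>c\<in>D. B a c * (\<Sum>b\<in>D. kpow D B m c b * of_bool (tgt b = v)))
      = (\<Sum>b\<in>D. kpow D B (Suc m) a b * of_bool (tgt b = v))" for a
      by (simp add: sum_distrib_left sum_distrib_right mult.assoc) (rule sum.swap)
    then show ?thesis unfolding W_def by (simp add: sum_distrib_left mult.assoc del: kpow.simps)
  qed
  finally show ?thesis .
qed

lemma W_1: "u \<in> V \<Longrightarrow> (\<Sum>z\<in>V. adjacency G u z * W 0 z v) = W (Suc 0) u v + (q + 1) * of_bool (u = v)"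
proof -
  assume u: "u \<in> V"
  have "(\<Sum>a\<in>D. of_bool (src a = u) * (\<Sum>b\<in>D. kpow D B 0 (rev_dart a) b * of_bool (tgt b = v)))
     = (\<Sum>a\<in>D. of_bool (src a = u) * of_bool (u = v))"
    by (intro sum.cong refl) (auto simp: sum_of_bool_collapse)
  also have "\<dots> = (q + 1) * of_bool (u = v)"
    unfolding sum_distrib_right[symmetric] out_count[OF u] q ..
  finally show ?thesis by (simp only: W_rec)
qed

text \<open>If the step in front is undone at once, a walk from \<open>u\<close> is left, and the
  step may have been any dart at \<open>u\<close> except the first one of that walk, hence
  \<open>q\<close> choices. In \<open>W_1\<close> nothing is left, and all \<open>q + 1\<close>
  darts at \<open>u\<close> count.\<close>

lemma W_2: "u \<in> V \<Longrightarrow> (\<Sum>z\<in>V. adjacency G u z * W (Suc m) z v) = W (Suc (Suc m)) u v + q * W m u v"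
proof -
  assume u: "u \<in> V"
  define F where "F c = (\<Sum>b\<in>D. kpow D B m c b * of_bool (tgt b = v))" for c
  have Bsum: "(\<Sum>b\<in>D. kpow D B (Suc m) a b * of_bool (tgt b = v)) = (\<Sum>c\<in>D. B a c * F c)" for a
    by (simp add: F_def sum_distrib_left sum_distrib_right mult.assoc) (rule sum.swap)
  have "(\<Sum>a\<in>D. of_bool (src a = u) * (\<Sum>b\<in>D. kpow D B (Suc m) (rev_dart a) b * of_bool (tgt b = v)))
     = (\<Sum>c\<in>D. (\<Sum>a\<in>D. of_bool (src a = u) * B (rev_dart a) c) * F c)"
    unfolding Bsum by (simp add: sum_distrib_left sum_distrib_right mult.assoc) (rule sum.swap)
  also have "\<dots> = (\<Sum>c\<in>D. q * of_bool (src c = u) * F c)"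
  proof (intro sum.cong refl)
    fix c assume c: "c \<in> D"
    have "(\<Sum>a\<in>D. of_bool (src a = u) * B (rev_dart a) c)
       = (\<Sum>a\<in>D. of_bool (src c = u) * of_bool (src a = u) - of_bool (src c = u) * of_bool (a = c))"
      by (intro sum.cong refl) (auto simp: nb_step_def)
    also have "\<dots> = of_bool (src c = u) * q"
      unfolding sum_subtractf sum_distrib_left[symmetric] out_count[OF u] using c q by (simp add: sum_of_bool_single)
    finally show "(\<Sum>a\<in>D. of_bool (src a = u) * B (rev_dart a) c) * F c = q * of_bool (src c = u) * F c" by simp
  qed
  also have "\<dots> = q * W m u v"
    by (simp add: W_def F_def sum_distrib_left mult.assoc)
  finally show ?thesis by (simp only: W_rec)
qed

lemma W_kpoly: "u \<in> V \<Longrightarrow> v \<in> V \<Longrightarrow> W m u v = kpoly V (adjacency G) (nb_poly q m) u v"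
proof (induction m arbitrary: u rule: nat_less_induct)
  case (1 m)
  have X: "kpoly V (adjacency G) [:0, 1:] u v = adjacency G u v" if "u \<in> V" for u
    using 1(3) by (simp add: kpoly_pCons kpoly_pCons_0 sum_of_bool_collapse)
  consider "m = 0" | "m = 1" | k where "m = Suc (Suc k)"
    by (metis One_nat_def not0_implies_Suc)
  then show ?case
  proof cases
    case 2
    have "kpoly V (adjacency G) (nb_poly q (Suc 0)) u v
       = - (q + 1) * of_bool (u = v) + (\<Sum>z\<in>V. adjacency G u z * kpoly V (adjacency G) [:0, 1:] z v)"
      by (simp add: kpoly_pCons[of _ _ "- (q + 1)"] kpoly_pCons[of _ _ "- 1 - q"] algebra_simps)
    also have "(\<Sum>z\<in>V. adjacency G u z * kpoly V (adjacency G) [:0, 1:] z v) = (\<Sum>z\<in>V. adjacency G u z * W 0 z v)"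
      by (intro sum.cong) (auto simp: X W_0)
    finally show ?thesis using 2 W_1[OF 1(2), of v] by simp
  next
    case 3
    have "kpoly V (adjacency G) (nb_poly q m) u v = (\<Sum>z\<in>V. adjacency G u z * W (Suc k) z v) - q * W k u v"
      using 1 3 by (simp add: kpoly_diff kpoly_smult kpoly_pCons_0)
    then show ?thesis using W_2[OF 1(2), of k v] 3 by simp
  qed (use X 1 W_0 in auto)
qed

section \<open>Cyclically reduced closed walks and traces of Dickson polynomials\<close>

definition closed_nb :: "nat \<Rightarrow> real" where
  "closed_nb k = (\<Sum>a\<in>D. kpow D B k a a)"

text \<open>These are the closed non-backtracking walks that fail to be cyclically reduced, their
  last dart undoing the first.\<close>

definition backtrack :: "nat \<Rightarrow> real" where
  "backtrack m = (\<Sum>a\<in>D. kpow D B m a (rev_dart a))"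

definition trW :: "nat \<Rightarrow> real" where
  "trW m = (\<Sum>u\<in>V. W m u u)"

lemma trW_altdef: "trW m = (\<Sum>a\<in>D. \<Sum>b\<in>D. kpow D B m a b * of_bool (tgt b = src a))"
proof -
  have "trW m = (\<Sum>u\<in>V. \<Sum>p\<in>D\<times>D. of_bool (src (fst p) = u) * (kpow D B m (fst p) (snd p) * of_bool (tgt (snd p) = u)))"
    unfolding trW_def W_def by (simp add: sum.cartesian_product case_prod_beta mult.assoc)
  also have "\<dots> = (\<Sum>p\<in>D\<times>D. kpow D B m (fst p) (snd p) * of_bool (tgt (snd p) = src (fst p)))"
    by (subst sum.swap, intro sum.cong refl, subst sum_of_bool_collapse(1)) auto
  finally show ?thesis by (simp add: sum.cartesian_product case_prod_beta)
qed

lemma closed_nb_Suc: "closed_nb (Suc m) = trW m - backtrack m"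
proof -
  have "closed_nb (Suc m) = (\<Sum>a\<in>D. \<Sum>b\<in>D. kpow D B m a b * B b a)"
    unfolding closed_nb_def by (intro sum.cong refl kpow_Suc_right) auto
  also have "\<dots> = (\<Sum>a\<in>D. \<Sum>b\<in>D. kpow D B m a b * of_bool (tgt b = src a) - kpow D B m a b * of_bool (b = rev_dart a))"
    unfolding B_split by (intro sum.cong refl) (auto simp: algebra_simps rev_dart_eq_iff)
  also have "\<dots> = trW m - (\<Sum>a\<in>D. \<Sum>b\<in>D. kpow D B m a b * of_bool (b = rev_dart a))"
    by (simp only: sum_subtractf trW_altdef)
  also have "(\<Sum>a\<in>D. \<Sum>b\<in>D. kpow D B m a b * of_bool (b = rev_dart a)) = backtrack m"
    unfolding backtrack_def by (intro sum.cong refl) (subst sum_of_bool_collapse(4); simp)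
  finally show ?thesis .
qed

lemma backtrack_0: "backtrack 0 = 0" and backtrack_1: "backtrack (Suc 0) = 0"
proof -
  show "backtrack 0 = 0" by (simp add: backtrack_def)
  have "backtrack (Suc 0) = (\<Sum>a\<in>D. B a (rev_dart a))"
    unfolding backtrack_def by (intro sum.cong refl kpow_1) auto
  then show "backtrack (Suc 0) = 0" by (simp add: nb_step_def)
qed

text \<open>Stripping the first dart and its reverse from such a walk leaves a closed
  non-backtracking walk. That walk arises from \<open>q - 1\<close> darts if it is cyclically
  reduced and from \<open>q\<close> darts if it is not: \<open>q - 1\<close> for every closed walk
  and one more for each that backtracks again.\<close>

lemma backtrack_rec: "backtrack (Suc (Suc m)) = (q - 1) * trW m + backtrack m"
proof -
  have "backtrack (Suc (Suc m)) = (\<Sum>a\<in>D. \<Sum>c\<in>D. \<Sum>e\<in>D. B a c * (kpow D B m c e * B e (rev_dart a)))"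
    unfolding backtrack_def
    by (intro sum.cong refl, subst kpow.simps(2)) (simp add: kpow_Suc_right sum_distrib_left del: kpow.simps)
  also have "\<dots> = (\<Sum>c\<in>D. \<Sum>a\<in>D. \<Sum>e\<in>D. B a c * (kpow D B m c e * B e (rev_dart a)))"
    by (rule sum.swap)
  also have "\<dots> = (\<Sum>c\<in>D. \<Sum>e\<in>D. \<Sum>a\<in>D. B a c * (kpow D B m c e * B e (rev_dart a)))"
    by (intro sum.cong refl sum.swap)
  also have "\<dots> = (\<Sum>c\<in>D. \<Sum>e\<in>D. kpow D B m c e * (\<Sum>a\<in>D. B (rev_dart a) c * B e a))"
    by (subst sum_rev_dart[symmetric]) (simp add: sum_distrib_left mult_ac)
  also have "\<dots> = (\<Sum>c\<in>D. \<Sum>e\<in>D. (q - 1) * (kpow D B m c e * of_bool (tgt e = src c)) + kpow D B m c e * of_bool (e = rev_dart c))"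
  proof (intro sum.cong refl)
    fix c e assume c: "c \<in> D" and e: "e \<in> D"
    have "(\<Sum>a\<in>D. B (rev_dart a) c * B e a)
      = (\<Sum>a\<in>D. of_bool (tgt e = src c) * of_bool (src a = src c) - of_bool (tgt e = src c) * of_bool (a = c)
           - of_bool (tgt e = src c) * of_bool (a = rev_dart e) + of_bool (e = rev_dart c) * of_bool (a = c))"
    proof (intro sum.cong refl)
      fix a
      \<comment> \<open>The identity only depends on which of six conditions hold and on the
        implications between them, so it is checked by truth table.\<close>
      have bool: "of_bool (S \<and> \<not> A) * of_bool (T \<and> \<not> R) = of_bool t * of_bool S - of_bool t * of_bool A
          - of_bool t * of_bool R + of_bool C * (of_bool A :: real)"
        if "T \<and> S \<longleftrightarrow> t \<and> S" "A \<longrightarrow> S" "R \<longrightarrow> T" "C \<longrightarrow> t" "A \<and> R \<longrightarrow> C" "A \<and> C \<longrightarrow> R" "t \<and> T \<longrightarrow> S" for S A T R t C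
        using that by (cases S; cases A; cases T; cases R; cases t; cases C) simp_all
      have B: "B (rev_dart a) c = of_bool (src a = src c \<and> a \<noteq> c)" "B e a = of_bool (tgt e = src a \<and> a \<noteq> rev_dart e)"
        by (auto simp: nb_step_def)
      show "B (rev_dart a) c * B e a = of_bool (tgt e = src c) * of_bool (src a = src c) - of_bool (tgt e = src c) * of_bool (a = c)
           - of_bool (tgt e = src c) * of_bool (a = rev_dart e) + of_bool (e = rev_dart c) * of_bool (a = c)"
        unfolding B by (rule bool) (auto simp: rev_dart_eq_iff)
    qed
    also have "\<dots> = of_bool (tgt e = src c) * (q - 1) + of_bool (e = rev_dart c)"
      unfolding sum_subtractf sum.distrib sum_distrib_left[symmetric] out_count[OF src_in_V[OF c]]
      using c e q by (simp add: sum_of_bool_single algebra_simps)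
    finally have *: "(\<Sum>a\<in>D. B (rev_dart a) c * B e a) = of_bool (tgt e = src c) * (q - 1) + of_bool (e = rev_dart c)" .
    show "kpow D B m c e * (\<Sum>a\<in>D. B (rev_dart a) c * B e a)
      = (q - 1) * (kpow D B m c e * of_bool (tgt e = src c)) + kpow D B m c e * of_bool (e = rev_dart c)"
      unfolding * by (simp only: distrib_left mult_ac)
  qed
  also have "\<dots> = (q - 1) * trW m + (\<Sum>c\<in>D. \<Sum>e\<in>D. kpow D B m c e * of_bool (e = rev_dart c))"
    unfolding sum.distrib trW_altdef by (simp only: sum_distrib_left)
  also have "(\<Sum>c\<in>D. \<Sum>e\<in>D. kpow D B m c e * of_bool (e = rev_dart c)) = backtrack m"
    unfolding backtrack_def by (intro sum.cong refl) (subst sum_of_bool_collapse(4); simp)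
  finally show ?thesis .
qed

text \<open>By \<open>closed_nb_Suc\<close> and \<open>backtrack_rec\<close> the counts for lengths
  m + 3 and m + 1 differ by the trace of a difference of \<open>nb_poly\<close>, which
  \<open>nb_poly_dickson\<close> rewrites in Dickson polynomials. The parity term enters at length
  2, where x^2 - (q + 1) exceeds the Dickson polynomial x^2 - 2q by q - 1.\<close>

lemma closed_nb_eq_trace_dickson:
  assumes "k \<ge> 1"
  shows "closed_nb k = (\<Sum>u\<in>V. kpoly V (adjacency G) (dickson q k) u u)
     + (if even k then (q - 1) * real (card V) else 0)"
  using assms
proof (induction k rule: nat_less_induct)
  case (1 k)
  have tr: "trW m = (\<Sum>u\<in>V. kpoly V (adjacency G) (nb_poly q m) u u)" for m
    unfolding trW_def by (intro sum.cong refl W_kpoly) auto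
  consider "k = 1" | "k = 2" | m where "k = m + 3"
    using 1(2) by (metis One_nat_def Suc_1 add.commute le_Suc_ex numeral_3_eq_3 le_antisym not_less_eq_eq)
  then show ?case
  proof cases
    case 1
    have "closed_nb 1 = trW 0" using closed_nb_Suc[of 0] backtrack_0 by simp
    then show ?thesis using 1 tr[of 0] by simp
  next
    case 2
    have "closed_nb 2 = trW (Suc 0)" using closed_nb_Suc[of 1] backtrack_1 by (simp add: numeral_2_eq_2)
    moreover have "nb_poly q (Suc 0) = dickson q 2 + [:q - 1:]" by (simp add: numeral_2_eq_2)
    ultimately show ?thesis using 2 by (simp add: tr kpoly_add sum.distrib mult.commute del: nb_poly.simps)
  next
    case 3
    have "closed_nb k = trW (m + 2) - q * trW m + closed_nb (m + 1)"
      using closed_nb_Suc[of "m + 2"] closed_nb_Suc[of m] backtrack_rec[of m] 3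
      by (simp add: numeral_eq_Suc algebra_simps)
    also have "trW (m + 2) - q * trW m = (\<Sum>u\<in>V. kpoly V (adjacency G) (nb_poly q (m + 2) - Polynomial.smult q (nb_poly q m)) u u)"
      by (simp only: tr kpoly_diff kpoly_smult sum_subtractf sum_distrib_left)
    also have "\<dots> = (\<Sum>u\<in>V. kpoly V (adjacency G) (dickson q k) u u) - (\<Sum>u\<in>V. kpoly V (adjacency G) (dickson q (m + 1)) u u)"
      unfolding nb_poly_dickson kpoly_diff sum_subtractf 3 ..
    finally show ?thesis using 1(1)[rule_format, of "m + 1"] 3 by simp
  qed
qed

end

section \<open>Spectra and coverings\<close>

definition mat_trace :: "'a :: comm_ring_1 mat \<Rightarrow> 'a" where
  "mat_trace A = (\<Sum>i<dim_row A. A $$ (i, i))"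

lemma mat_trace_comm:
  assumes "A \<in> carrier_mat n m" "B \<in> carrier_mat m n"
  shows "mat_trace (A * B) = mat_trace (B * A)"
proof -
  have "mat_trace (A * B) = (\<Sum>i<n. \<Sum>j<m. A $$ (i, j) * B $$ (j, i))"
    using assms by (auto simp: mat_trace_def scalar_prod_def atLeast0LessThan intro!: sum.cong)
  also have "\<dots> = (\<Sum>j<m. \<Sum>i<n. B $$ (j, i) * A $$ (i, j))"
    by (subst sum.swap) (simp add: mult.commute)
  also have "\<dots> = mat_trace (B * A)"
    using assms by (auto simp: mat_trace_def scalar_prod_def atLeast0LessThan intro!: sum.cong)
  finally show ?thesis .
qed

lemma upper_triangular_times:
  fixes A B :: "'a :: comm_ring_1 mat"
  assumes A: "A \<in> carrier_mat n n" "upper_triangular A" and B: "B \<in> carrier_mat n n" "upper_triangular B"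
  shows "upper_triangular (A * B)" "\<And>i. i < n \<Longrightarrow> (A * B) $$ (i, i) = A $$ (i, i) * B $$ (i, i)"
proof -
  have prod: "(A * B) $$ (i, j) = (\<Sum>k<n. A $$ (i, k) * B $$ (k, j))" if "i < n" "j < n" for i j
    using assms that by (auto simp: scalar_prod_def atLeast0LessThan intro!: sum.cong)
  have zero: "A $$ (i, k) * B $$ (k, j) = 0" if "i < n" "k < n" "k < i \<or> j < k" for i j k
    using assms that by (auto dest: upper_triangularD)
  show "upper_triangular (A * B)"
  proof
    fix i j assume ij: "j < i" "i < dim_row (A * B)"
    then have "i < n" "j < n" using A by auto
    then show "(A * B) $$ (i, j) = 0"
      unfolding prod[OF \<open>i < n\<close> \<open>j < n\<close>] using ij by (intro sum.neutral ballI zero) auto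
  qed
  show "(A * B) $$ (i, i) = A $$ (i, i) * B $$ (i, i)" if i: "i < n" for i
  proof -
    have "(A * B) $$ (i, i) = (\<Sum>k\<in>{i}. A $$ (i, k) * B $$ (k, i))"
      unfolding prod[OF i i] using i by (intro sum.mono_neutral_right ballI zero) auto
    then show ?thesis by simp
  qed
qed

lemma upper_triangular_pow:
  fixes A :: "'a :: comm_ring_1 mat"
  assumes A: "A \<in> carrier_mat n n" "upper_triangular A"
  shows "upper_triangular (A ^\<^sub>m k) \<and> (\<forall>i<n. (A ^\<^sub>m k) $$ (i, i) = (A $$ (i, i)) ^ k)"
proof (induction k)
  case 0
  then show ?case using A by auto
next
  case (Suc k)
  have P: "A ^\<^sub>m k \<in> carrier_mat n n" using A by simp
  show ?case
    using upper_triangular_times[OF P _ A] Suc by (simp add: mult.commute)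
qed

text \<open>The Schur decomposition gives a similar upper triangular matrix with the roots of the
  characteristic polynomial on its diagonal. Powers keep that shape, and the trace is invariant
  under similarity.\<close>

lemma sum_proots_char_poly_power:
  fixes A :: "complex mat"
  assumes A: "A \<in> carrier_mat n n"
  shows "(\<Sum>x\<in>#proots (char_poly A). x ^ k) = mat_trace (A ^\<^sub>m k)"
proof -
  obtain es where es: "char_poly A = (\<Prod>a\<leftarrow>es. [:- a, 1:])"
    using char_poly_factorized[OF A] by blast
  from schur_decomposition_exists[OF A es] obtain B where B: "B \<in> carrier_mat n n" "upper_triangular B"
    and sim: "similar_mat A B" by blast
  then obtain P Q where wit: "similar_mat_wit A B P Q" unfolding similar_mat_def by blast
  from similar_mat_witD2[OF A wit] have PQ: "Q * P = 1\<^sub>m n" "P \<in> carrier_mat n n" "Q \<in> carrier_mat n n"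
    by auto
  have Bk: "B ^\<^sub>m k \<in> carrier_mat n n" using B by simp
  have "proots (char_poly A) = proots (char_poly B)"
    using char_poly_similar[OF sim] by simp
  also have "\<dots> = mset (diag_mat B)"
  proof -
    have "proots (\<Prod>a\<leftarrow>xs. [:- a, 1:]) = mset xs" for xs :: "complex list"
    proof (induction xs)
      case (Cons a xs)
      have "(\<Prod>a\<leftarrow>xs. [:- a, 1:]) \<noteq> 0" by (auto simp: prod_list_zero_iff)
      then have "proots ([:- a, 1:] * (\<Prod>a\<leftarrow>xs. [:- a, 1:])) = add_mset a (mset xs)"
        using Cons by (subst proots_mult) auto
      then show ?case by (simp only: list.map prod_list.Cons mset.simps)
    qed simp
    then show ?thesis using char_poly_upper_triangular[OF B] by simp
  qed
  finally have "(\<Sum>x\<in>#proots (char_poly A). x ^ k) = (\<Sum>i<n. (B $$ (i, i)) ^ k)"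
    using B by (simp add: diag_mat_def sum_mset_sum_list interv_sum_list_conv_sum_set_nat atLeast0LessThan
        flip: mset_map)
  also have "\<dots> = mat_trace (B ^\<^sub>m k)"
    using upper_triangular_pow[OF B, of k] B by (simp add: mat_trace_def)
  also have "B ^\<^sub>m k = (Q * P) * B ^\<^sub>m k"
    unfolding PQ(1) by (rule left_mult_one_mat[OF Bk, symmetric])
  also have "mat_trace ((Q * P) * B ^\<^sub>m k) = mat_trace (Q * (P * B ^\<^sub>m k))"
    by (simp only: assoc_mult_mat[OF PQ(3,2) Bk])
  also have "\<dots> = mat_trace (P * B ^\<^sub>m k * Q)"
    using PQ Bk by (intro mat_trace_comm[of _ n n]) auto
  also have "P * B ^\<^sub>m k * Q = A ^\<^sub>m k" using similar_mat_wit_pow_id[OF wit] by simp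
  finally show ?thesis .
qed

lemma vertex_list:
  assumes "finite (verts G)"
  shows "distinct (vertex_list G)" "set (vertex_list G) = verts G"
proof -
  obtain xs where "distinct xs \<and> set xs = verts G"
    using finite_distinct_list[OF assms] by blast
  from someI[of "\<lambda>xs. distinct xs \<and> set xs = verts G", OF this]
  show "distinct (vertex_list G)" "set (vertex_list G) = verts G"
    by (auto simp: vertex_list_def)
qed

lemma sum_nth_vertex_list:
  assumes "finite (verts G)"
  shows "(\<Sum>i<length (vertex_list G). f (vertex_list G ! i)) = (\<Sum>v\<in>verts G. f v)"
  by (rule sum.reindex_bij_betw[OF bij_betw_nth]) (use vertex_list[OF assms] in auto)

lemma adj_mat_carrier: "adj_mat G \<in> carrier_mat (length (vertex_list G)) (length (vertex_list G))"
  by (simp add: adj_mat_def Let_def)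

lemma adj_mat_nth:
  assumes "i < length (vertex_list G)" "j < length (vertex_list G)"
  shows "adj_mat G $$ (i, j) = of_real (adjacency G (vertex_list G ! i) (vertex_list G ! j))"
  using assms by (simp add: adj_mat_def Let_def adj_op_def adjacency_def of_bool_def if_distrib[of complex_of_real] cong: if_cong)

lemma adj_mat_pow_nth:
  assumes "finite (verts G)" "i < length (vertex_list G)" "j < length (vertex_list G)"
  shows "(adj_mat G ^\<^sub>m k) $$ (i, j) = of_real (kpow (verts G) (adjacency G) k (vertex_list G ! i) (vertex_list G ! j))"
  using assms(2,3)
proof (induction k arbitrary: i j)
  case 0
  then show ?case using vertex_list[OF assms(1)] adj_mat_carrier[of G] by (auto simp: nth_eq_iff_index_eq)
next
  case (Suc k)
  let ?n = "length (vertex_list G)"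
  have "(adj_mat G ^\<^sub>m Suc k) $$ (i, j) = (\<Sum>l<?n. (adj_mat G ^\<^sub>m k) $$ (i, l) * adj_mat G $$ (l, j))"
    using Suc.prems adj_mat_carrier[of G] by (auto simp: scalar_prod_def atLeast0LessThan intro!: sum.cong)
  also have "\<dots> = (\<Sum>l<?n. of_real (kpow (verts G) (adjacency G) k (vertex_list G ! i) (vertex_list G ! l)
      * adjacency G (vertex_list G ! l) (vertex_list G ! j)))"
    using Suc by (intro sum.cong) (auto simp: adj_mat_nth)
  also have "\<dots> = of_real (\<Sum>l<?n. kpow (verts G) (adjacency G) k (vertex_list G ! i) (vertex_list G ! l)
      * adjacency G (vertex_list G ! l) (vertex_list G ! j))" by simp
  also have "(\<Sum>l<?n. kpow (verts G) (adjacency G) k (vertex_list G ! i) (vertex_list G ! l)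
      * adjacency G (vertex_list G ! l) (vertex_list G ! j))
     = kpow (verts G) (adjacency G) (Suc k) (vertex_list G ! i) (vertex_list G ! j)"
  proof -
    have "vertex_list G ! i \<in> verts G" "vertex_list G ! j \<in> verts G"
      using Suc.prems vertex_list(2)[OF assms(1)] nth_mem by blast+
    then show ?thesis
      using assms(1) by (subst sum_nth_vertex_list) (simp_all add: kpow_Suc_right del: kpow.simps)
  qed
  finally show ?case .
qed

lemma sum_adj_spec_power:
  assumes "finite (verts G)"
  shows "(\<Sum>x\<in>#adj_spec G. x ^ k) = of_real (\<Sum>v\<in>verts G. kpow (verts G) (adjacency G) k v v)"
proof -
  let ?n = "length (vertex_list G)"
  have "(\<Sum>x\<in>#adj_spec G. x ^ k) = mat_trace (adj_mat G ^\<^sub>m k)"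
    unfolding adj_spec_def by (rule sum_proots_char_poly_power[OF adj_mat_carrier])
  also have "\<dots> = (\<Sum>i<?n. of_real (kpow (verts G) (adjacency G) k (vertex_list G ! i) (vertex_list G ! i)))"
    unfolding mat_trace_def using assms adj_mat_carrier[of G] by (intro sum.cong) (auto simp: adj_mat_pow_nth)
  also have "\<dots> = of_real (\<Sum>v\<in>verts G. kpow (verts G) (adjacency G) k v v)"
    using sum_nth_vertex_list[OF assms, of "\<lambda>v. kpow (verts G) (adjacency G) k v v"]
    by (simp flip: of_real_sum)
  finally show ?thesis .
qed

lemma size_adj_spec: "finite (verts G) \<Longrightarrow> size (adj_spec G) = card (verts G)"
  using degree_monic_char_poly[OF adj_mat_carrier, of G] vertex_list[of G]
  by (simp add: adj_spec_def size_proots_complex) (metis distinct_card)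

lemma adj_spec_eigenvector:
  assumes "finite (verts G)" "x \<in># adj_spec G"
  obtains f where "\<exists>v\<in>verts G. f v \<noteq> 0"
    "\<And>u. u \<in> verts G \<Longrightarrow> (\<Sum>v\<in>verts G. of_real (adjacency G u v) * f v) = x * f u"
proof -
  let ?xs = "vertex_list G"
  let ?n = "length ?xs"
  note xs = vertex_list[OF assms(1)]
  have "poly (char_poly (adj_mat G)) x = 0"
  proof (cases "char_poly (adj_mat G) = 0")
    case False
    then show ?thesis using assms(2) by (simp add: adj_spec_def)
  qed simp
  then have "eigenvalue (adj_mat G) x" using eigenvalue_root_char_poly[OF adj_mat_carrier] by blast
  then obtain w where w: "w \<in> carrier_vec ?n" "w \<noteq> 0\<^sub>v ?n" "adj_mat G *\<^sub>v w = x \<cdot>\<^sub>v w"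
    using adj_mat_carrier[of G] unfolding eigenvalue_def eigenvector_def by auto
  define f where "f v = w $ (THE i. i < ?n \<and> ?xs ! i = v)" for v
  have f: "f (?xs ! i) = w $ i" if "i < ?n" for i
  proof -
    have "(THE j. j < ?n \<and> ?xs ! j = ?xs ! i) = i"
      using that xs by (auto simp: nth_eq_iff_index_eq)
    then show ?thesis by (simp add: f_def)
  qed
  from w(1,2) obtain i where "i < ?n" "w $ i \<noteq> 0" by (metis carrier_vecD eq_vecI index_zero_vec)
  then have "\<exists>v\<in>verts G. f v \<noteq> 0" using f xs by (metis nth_mem)
  moreover have "(\<Sum>v\<in>verts G. of_real (adjacency G u v) * f v) = x * f u" if "u \<in> verts G" for u
  proof -
    from that obtain i where i: "i < ?n" "u = ?xs ! i" using xs by (metis in_set_conv_nth)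
    have "x * f u = (x \<cdot>\<^sub>v w) $ i" using w(1) i f by simp
    also have "\<dots> = (adj_mat G *\<^sub>v w) $ i" by (simp only: w(3))
    also have "\<dots> = (\<Sum>j<?n. adj_mat G $$ (i, j) * w $ j)"
      using i w(1) adj_mat_carrier[of G] by (auto simp: scalar_prod_def atLeast0LessThan intro!: sum.cong)
    also have "\<dots> = (\<Sum>j<?n. of_real (adjacency G u (?xs ! j)) * f (?xs ! j))"
      using i by (intro sum.cong) (auto simp: adj_mat_nth f)
    also have "\<dots> = (\<Sum>v\<in>verts G. of_real (adjacency G u v) * f v)"
      by (rule sum_nth_vertex_list[OF assms(1)])
    finally show ?thesis by simp
  qed
  ultimately show thesis using that by blast
qed

context regular_multigraph
begin

lemma adjacency_nonneg: "adjacency G u v \<ge> 0"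
  by (auto simp: adjacency_def intro!: sum_nonneg)

text \<open>The quadratic form of a real symmetric matrix takes real values, also on complex
  vectors.\<close>

lemma adj_spec_real:
  assumes "x \<in># adj_spec G"
  shows "x \<in> \<real>"
proof -
  obtain f where f: "\<exists>v\<in>V. f v \<noteq> 0" "\<And>u. u \<in> V \<Longrightarrow> (\<Sum>v\<in>V. of_real (adjacency G u v) * f v) = x * f u"
    using adj_spec_eigenvector[OF finite_V assms] by blast
  define Q where "Q = (\<Sum>u\<in>V. \<Sum>v\<in>V. cnj (f u) * of_real (adjacency G u v) * f v)"
  have "cnj Q = (\<Sum>u\<in>V. \<Sum>v\<in>V. cnj (f v) * of_real (adjacency G v u) * f u)"
    unfolding Q_def by (simp add: mult_ac adjacency_sym)
  also have "\<dots> = Q" unfolding Q_def by (rule sum.swap)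
  finally have Q: "cnj Q = Q" .
  have "Q = (\<Sum>u\<in>V. cnj (f u) * (\<Sum>v\<in>V. of_real (adjacency G u v) * f v))"
    by (simp add: Q_def sum_distrib_left mult.assoc)
  also have "\<dots> = (\<Sum>u\<in>V. cnj (f u) * (x * f u))" by (intro sum.cong refl) (simp add: f)
  also have "\<dots> = x * of_real (\<Sum>u\<in>V. (cmod (f u))\<^sup>2)"
    unfolding of_real_sum sum_distrib_left by (intro sum.cong refl) (simp only: complex_norm_square mult_ac)
  finally have Qx: "Q = x * of_real (\<Sum>u\<in>V. (cmod (f u))\<^sup>2)" .
  define s where "s = (\<Sum>u\<in>V. (cmod (f u))\<^sup>2)"
  from f(1) obtain v where v: "v \<in> V" "f v \<noteq> 0" by blast
  have "0 < s" unfolding s_def by (rule sum_pos2[OF finite_V v(1)]) (use v in auto)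
  moreover have "cnj x * of_real s = x * of_real s"
    using Q unfolding Qx s_def[symmetric] by simp
  ultimately have "cnj x = x" by simp
  then show ?thesis by (simp add: Reals_cnj_iff)
qed

text \<open>The eigenvalue equation is read off at a vertex where the eigenfunction is largest in
  modulus; rows sum to \<open>d\<close>.\<close>

lemma adj_spec_bound:
  assumes "x \<in># adj_spec G"
  shows "cmod x \<le> real d"
proof -
  obtain f where f: "\<exists>v\<in>V. f v \<noteq> 0" "\<And>u. u \<in> V \<Longrightarrow> (\<Sum>v\<in>V. of_real (adjacency G u v) * f v) = x * f u"
    using adj_spec_eigenvector[OF finite_V assms] by blast
  have "V \<noteq> {}" using f(1) by blast
  have "Max ((\<lambda>v. cmod (f v)) ` V) \<in> (\<lambda>v. cmod (f v)) ` V"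
    using \<open>V \<noteq> {}\<close> by (intro Max_in) auto
  then obtain u where u: "u \<in> V" "Max ((\<lambda>v. cmod (f v)) ` V) = cmod (f u)"
    by blast
  have umax: "cmod (f v) \<le> cmod (f u)" if "v \<in> V" for v
    unfolding u(2)[symmetric] using that by (intro Max_ge) auto
  have fu: "cmod (f u) > 0" using f(1) umax by (metis norm_le_zero_iff not_less order.trans)
  have rowsum: "(\<Sum>v\<in>V. adjacency G u v) = real d"
    using sum_V_adjacency[of u "\<lambda>_. 1"] out_count[OF u(1)] by simp
  have "cmod x * cmod (f u) = cmod (\<Sum>v\<in>V. of_real (adjacency G u v) * f v)"
    using f(2)[OF u(1)] by (simp add: norm_mult)
  also have "\<dots> \<le> (\<Sum>v\<in>V. adjacency G u v * cmod (f u))"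
    by (rule order_trans[OF norm_sum sum_mono])
       (auto simp: norm_mult adjacency_nonneg intro!: mult_left_mono umax)
  also have "\<dots> = real d * cmod (f u)" by (simp add: sum_distrib_right[symmetric] rowsum)
  finally show ?thesis using fu by simp
qed

definition rspec :: "real multiset" where "rspec = image_mset Re (adj_spec G)"

lemma adj_spec_rspec: "adj_spec G = image_mset of_real rspec"
proof -
  have "image_mset (\<lambda>x. of_real (Re x)) (adj_spec G) = image_mset (\<lambda>x. x) (adj_spec G)"
    by (intro image_mset_cong) (use adj_spec_real in \<open>auto simp: of_real_Re\<close>)
  then show ?thesis by (simp add: rspec_def multiset.map_comp o_def)
qed

lemma rspec_bound: "x \<in># rspec \<Longrightarrow> \<bar>x\<bar> \<le> real d"
  using adj_spec_bound abs_Re_le_cmod unfolding rspec_def by (fastforce intro: order_trans)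

lemma size_rspec: "size rspec = card V"
  by (simp add: rspec_def size_adj_spec)

lemma sum_rspec_power: "(\<Sum>x\<in>#rspec. x ^ k) = (\<Sum>v\<in>V. kpow V (adjacency G) k v v)"
proof -
  have "complex_of_real (\<Sum>x\<in>#M. x ^ k) = (\<Sum>x\<in>#image_mset of_real M. x ^ k)" for M
    by (induction M) auto
  from this[of rspec, folded adj_spec_rspec] show ?thesis using sum_adj_spec_power[OF finite_V, of k] by (metis of_real_eq_iff)
qed

lemma sum_rspec_poly: "(\<Sum>x\<in>#rspec. poly p x) = (\<Sum>v\<in>V. kpoly V (adjacency G) p v v)"
proof -
  have "(\<Sum>x\<in>#M. poly p x) = (\<Sum>i\<le>degree p. coeff p i * (\<Sum>x\<in>#M. x ^ i))" for M
    unfolding poly_altdef by (induction M) (auto simp: sum.distrib algebra_simps)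
  then have "(\<Sum>x\<in>#rspec. poly p x) = (\<Sum>i\<le>degree p. coeff p i * (\<Sum>x\<in>#rspec. x ^ i))" .
  also have "\<dots> = (\<Sum>v\<in>V. kpoly V (adjacency G) p v v)"
    unfolding sum_rspec_power kpoly_def sum_distrib_left by (rule sum.swap)
  finally show ?thesis .
qed

lemma sum_rspec_dickson:
  "k \<ge> 1 \<Longrightarrow> (\<Sum>x\<in>#rspec. poly (dickson q k) x) = closed_nb k - (if even k then (q - 1) * real (card V) else 0)"
  using closed_nb_eq_trace_dickson[of k] unfolding sum_rspec_poly by simp

text \<open>The trace of the square of a symmetric kernel is its squared Hilbert-Schmidt norm, which
  can be compared between a graph and its covering entry by entry.\<close>

lemma sum_rspec_square:
  "(\<Sum>x\<in>#rspec. (poly r x)\<^sup>2) = (\<Sum>u\<in>V. \<Sum>v\<in>V. (kpoly V (adjacency G) r u v)\<^sup>2)"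
proof -
  have "(\<Sum>x\<in>#rspec. (poly r x)\<^sup>2) = (\<Sum>u\<in>V. kpoly V (adjacency G) (r * r) u u)"
    using sum_rspec_poly[of "r * r"] by (simp add: power2_eq_square)
  also have "\<dots> = (\<Sum>u\<in>V. \<Sum>v\<in>V. (kpoly V (adjacency G) r u v)\<^sup>2)"
    by (intro sum.cong refl)
       (simp add: kpoly_mult power2_eq_square kpoly_sym[where a = "adjacency G", OF finite_V adjacency_sym])
  finally show ?thesis .
qed

end

text \<open>Multiplicities of eigenvalues are compared through traces of squares of interpolation
  polynomials, which avoids splitting the matrix of the covering into blocks.\<close>

lemma mset_subset_eq_poly_square:
  fixes A B :: "real multiset"
  assumes "\<And>r. (\<Sum>x\<in>#A. (poly r x)\<^sup>2) \<le> (\<Sum>x\<in>#B. (poly r x)\<^sup>2)"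
  shows "A \<subseteq># B"
proof (rule mset_subset_eqI)
  fix a
  define S where "S = set_mset A \<union> set_mset B - {a}"
  \<comment> \<open>The product vanishes at every other point of both multisets, so the two sums
    reduce to the multiplicities of \<open>a\<close>.\<close>
  define r where "r = (\<Prod>x\<in>S. [:- x, 1:])"
  have S: "finite S" "a \<notin> S" by (auto simp: S_def)
  have zero: "poly r x = 0" if "x \<in> S" for x
    using that S by (auto simp: r_def poly_prod)
  have pos: "(poly r a)\<^sup>2 > 0"
    using S by (auto simp: r_def poly_prod)
  have *: "(\<Sum>x\<in>#M. (poly r x)\<^sup>2) = real (count M a) * (poly r a)\<^sup>2"
    if "set_mset M \<subseteq> insert a S" for M
    using that
  proof (induction M)
    case (add x M)
    then show ?case by (cases "x = a") (auto simp: zero algebra_simps)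
  qed simp
  have "real (count A a) * (poly r a)\<^sup>2 \<le> real (count B a) * (poly r a)\<^sup>2"
    using assms[of r] * by (simp add: S_def Un_commute subset_insertI2 insert_Diff_if subset_iff)
  then show "count A a \<le> count B a" using pos by simp
qed

section \<open>Coverings and their new spectrum\<close>

locale covering_graph =
  base: regular_multigraph \<Omega> d q for \<Omega> :: "('v, 'e) pre_digraph" and d q +
  fixes n :: nat and \<sigma> :: "'e \<Rightarrow> nat \<Rightarrow> nat"
  assumes perm: "\<And>e. e \<in> arcs \<Omega> \<Longrightarrow> \<sigma> e permutes {1..n}"
begin

abbreviation "\<Gamma> \<equiv> covering \<Omega> n \<sigma>"

lemma cover_simps [simp]:
  "verts \<Gamma> = verts \<Omega> \<times> {1..n}" "arcs (darts \<Gamma>) = (arcs \<Omega> \<times> {1..n}) \<times> UNIV"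
  "tail (darts \<Gamma>) ((e, m), b) = (if b then (tail \<Omega> e, m) else (head \<Omega> e, \<sigma> e m))"
  "head (darts \<Gamma>) ((e, m), b) = (if b then (head \<Omega> e, \<sigma> e m) else (tail \<Omega> e, m))"
  by (auto simp: covering_def darts_def)

lemma base_simps:
  "arcs (darts \<Omega>) = arcs \<Omega> \<times> UNIV"
  "tail (darts \<Omega>) (e, b) = (if b then tail \<Omega> e else head \<Omega> e)"
  "head (darts \<Omega>) (e, b) = (if b then head \<Omega> e else tail \<Omega> e)"
  by (auto simp: darts_def)

text \<open>The unique lift of a dart that starts on sheet \<open>i\<close>. An arc of the covering
  carries the sheet of its tail, so for a dart against the orientation the inverse permutation is
  needed to find it.\<close>

definition lift_dart :: "nat \<Rightarrow> 'e \<times> bool \<Rightarrow> ('e \<times> nat) \<times> bool" where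
  "lift_dart i a = ((fst a, if snd a then i else inv_into UNIV (\<sigma> (fst a)) i), snd a)"

lemma bij_betw_lift_dart:
  assumes i: "i \<in> {1..n}"
  shows "bij_betw (lift_dart i) (out_arcs (darts \<Omega>) u) (out_arcs (darts \<Gamma>) (u, i))"
proof (rule bij_betwI[of _ _ _ "\<lambda>x. (fst (fst x), snd x)"])
  show "lift_dart i \<in> out_arcs (darts \<Omega>) u \<rightarrow> out_arcs (darts \<Gamma>) (u, i)"
  proof
    fix a assume "a \<in> out_arcs (darts \<Omega>) u"
    moreover obtain e b where a: "a = (e, b)" by fastforce
    ultimately have e: "e \<in> arcs \<Omega>" "(if b then tail \<Omega> e else head \<Omega> e) = u"
      by (auto simp: out_arcs_def base_simps)
    have "inv_into UNIV (\<sigma> e) i \<in> {1..n}"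
      using permutes_in_image[OF permutes_inv[OF perm[OF e(1)]]] i by blast
    then show "lift_dart i a \<in> out_arcs (darts \<Gamma>) (u, i)"
      using e i permutes_inverses(1)[OF perm[OF e(1)]] by (cases b) (auto simp: a lift_dart_def out_arcs_def)
  qed
  show "(\<lambda>x. (fst (fst x), snd x)) \<in> out_arcs (darts \<Gamma>) (u, i) \<rightarrow> out_arcs (darts \<Omega>) u"
    by (auto simp: out_arcs_def base_simps split: if_splits)
  show "(fst (fst (lift_dart i x)), snd (lift_dart i x)) = x" for x
    by (simp add: lift_dart_def)
  show "lift_dart i (fst (fst y), snd y) = y" if "y \<in> out_arcs (darts \<Gamma>) (u, i)" for y
  proof -
    obtain e m b where y: "y = ((e, m), b)" by (metis surj_pair)
    show ?thesis using that perm unfolding y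
      by (auto simp: lift_dart_def out_arcs_def permutes_inverses(2)[OF perm] split: if_splits)
  qed
qed

lemma fst_head_lift_dart: "fst (head (darts \<Gamma>) (lift_dart i a)) = head (darts \<Omega>) a"
  by (cases a) (simp add: lift_dart_def base_simps)

sublocale cover: regular_multigraph \<Gamma> d q
proof (rule regular_multigraph.intro)
  have \<sigma>: "\<sigma> e m \<in> {1..n}" if "e \<in> arcs \<Omega>" "m \<in> {1..n}" for e m
    using permutes_in_image[OF perm[OF that(1)]] that(2) by blast
  show "fin_digraph \<Gamma>"
    using base.fin \<sigma> unfolding fin_digraph_def wf_digraph_def fin_digraph_axioms_def
    by (auto simp: covering_def)
  show "regular_graph \<Gamma> d"
    unfolding regular_graph_def out_degree_def
    using base.reg bij_betw_same_card[OF bij_betw_lift_dart]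
    by (auto simp: regular_graph_def out_degree_def)
qed (rule base.q)

lemma sum_adjacency_cover:
  assumes "i \<in> {1..n}" "u \<in> verts \<Omega>"
  shows "(\<Sum>j\<in>{1..n}. adjacency \<Gamma> (u, i) (v, j)) = adjacency \<Omega> u v"
proof -
  have "(\<Sum>j\<in>{1..n}. adjacency \<Gamma> (u, i) (v, j))
    = (\<Sum>a\<in>out_arcs (darts \<Gamma>) (u, i). \<Sum>j\<in>{1..n}. of_bool (head (darts \<Gamma>) a = (v, j)))"
    unfolding adjacency_def by (rule sum.swap)
  also have "\<dots> = (\<Sum>a\<in>out_arcs (darts \<Gamma>) (u, i). of_bool (fst (head (darts \<Gamma>) a) = v))"
  proof (intro sum.cong refl)
    fix a assume "a \<in> out_arcs (darts \<Gamma>) (u, i)"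
    then have "head (darts \<Gamma>) a \<in> verts \<Omega> \<times> {1..n}"
      using cover.tgt_in_V[of a] by (simp add: out_arcs_def)
    then obtain w k where wk: "head (darts \<Gamma>) a = (w, k)" "k \<in> {1..n}" by auto
    have "(\<Sum>j\<in>{1..n}. of_bool (head (darts \<Gamma>) a = (v, j)) :: real) = (\<Sum>j\<in>{1..n}. of_bool (w = v) * of_bool (j = k) :: real)"
      by (intro sum.cong) (auto simp: wk)
    also have "\<dots> = (of_bool (w = v) :: real)"
      unfolding sum_distrib_left[symmetric] using wk by (simp add: sum_of_bool_single)
    finally show "(\<Sum>j\<in>{1..n}. of_bool (head (darts \<Gamma>) a = (v, j))) = (of_bool (fst (head (darts \<Gamma>) a) = v) :: real)"
      by (simp add: wk)
  qed
  also have "\<dots> = (\<Sum>a\<in>out_arcs (darts \<Omega>) u. of_bool (fst (head (darts \<Gamma>) (lift_dart i a)) = v))"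
    by (rule sum.reindex_bij_betw[OF bij_betw_lift_dart[OF assms(1)], symmetric])
  finally show ?thesis by (simp add: fst_head_lift_dart adjacency_def)
qed

lemma sum_kpow_cover:
  assumes "i \<in> {1..n}" "u \<in> verts \<Omega>" "v \<in> verts \<Omega>"
  shows "(\<Sum>j\<in>{1..n}. kpow (verts \<Gamma>) (adjacency \<Gamma>) k (u, i) (v, j)) = kpow (verts \<Omega>) (adjacency \<Omega>) k u v"
  using assms(1,2)
proof (induction k arbitrary: u i)
  case 0
  have "(\<Sum>j\<in>{1..n}. kpow (verts \<Gamma>) (adjacency \<Gamma>) 0 (u, i) (v, j)) = (\<Sum>j\<in>{1..n}. of_bool (u = v) * of_bool (j = i))"
    by (intro sum.cong) auto
  also have "\<dots> = of_bool (u = v)"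
    unfolding sum_distrib_left[symmetric] using 0 by (simp add: sum_of_bool_single)
  finally show ?case by simp
next
  case (Suc k)
  have "(\<Sum>j\<in>{1..n}. kpow (verts \<Gamma>) (adjacency \<Gamma>) (Suc k) (u, i) (v, j))
    = (\<Sum>z\<in>verts \<Omega> \<times> {1..n}. adjacency \<Gamma> (u, i) z * (\<Sum>j\<in>{1..n}. kpow (verts \<Gamma>) (adjacency \<Gamma>) k z (v, j)))"
    by (simp only: kpow.simps sum_distrib_left cover_simps) (rule sum.swap)
  also have "\<dots> = (\<Sum>z\<in>verts \<Omega> \<times> {1..n}. adjacency \<Gamma> (u, i) z * kpow (verts \<Omega>) (adjacency \<Omega>) k (fst z) v)"
    by (intro sum.cong refl) (use Suc.IH in auto)
  also have "\<dots> = (\<Sum>w\<in>verts \<Omega>. (\<Sum>l\<in>{1..n}. adjacency \<Gamma> (u, i) (w, l)) * kpow (verts \<Omega>) (adjacency \<Omega>) k w v)"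
    by (simp add: sum_distrib_right sum.cartesian_product case_prod_beta)
  also have "\<dots> = kpow (verts \<Omega>) (adjacency \<Omega>) (Suc k) u v"
    using sum_adjacency_cover[OF Suc.prems] by simp
  finally show ?case .
qed

lemma sum_kpoly_cover:
  assumes "i \<in> {1..n}" "u \<in> verts \<Omega>" "v \<in> verts \<Omega>"
  shows "(\<Sum>j\<in>{1..n}. kpoly (verts \<Gamma>) (adjacency \<Gamma>) p (u, i) (v, j)) = kpoly (verts \<Omega>) (adjacency \<Omega>) p u v"
  unfolding kpoly_def using sum_kpow_cover[OF assms]
  by (subst sum.swap) (simp add: sum_distrib_left[symmetric])

text \<open>Entries of the base kernel are sums over a fibre of entries upstairs. Cauchy-Schwarz
  over the \<open>n\<close> end sheets loses a factor \<open>n\<close>, which summing over the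
  \<open>n\<close> starting sheets regains, so the Hilbert-Schmidt norm cannot decrease in the
  covering.\<close>

lemma rspec_subset:
  assumes n: "n \<ge> 1"
  shows "base.rspec \<subseteq># cover.rspec"
proof (rule mset_subset_eq_poly_square)
  fix r :: "real poly"
  let ?k = "kpoly (verts \<Omega>) (adjacency \<Omega>) r" and ?K = "kpoly (verts \<Gamma>) (adjacency \<Gamma>) r"
  have "(\<Sum>u\<in>verts \<Omega>. \<Sum>v\<in>verts \<Omega>. (?k u v)\<^sup>2) \<le> (\<Sum>u\<in>verts \<Omega>. \<Sum>v\<in>verts \<Omega>. \<Sum>i\<in>{1..n}. \<Sum>j\<in>{1..n}. (?K (u, i) (v, j))\<^sup>2)"
  proof (intro sum_mono)
    fix u v assume uv: "u \<in> verts \<Omega>" "v \<in> verts \<Omega>"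
    have *: "(?k u v)\<^sup>2 \<le> real n * (\<Sum>j\<in>{1..n}. (?K (u, i) (v, j))\<^sup>2)" if "i \<in> {1..n}" for i
      using sum_kpoly_cover[OF that uv, of r, symmetric]
        Cauchy_Schwarz_ineq_sum[of "\<lambda>_. 1" "\<lambda>j. ?K (u, i) (v, j)" "{1..n}"] by simp
    have "real n * (?k u v)\<^sup>2 = (\<Sum>i\<in>{1..n}. (?k u v)\<^sup>2)" by simp
    also have "\<dots> \<le> (\<Sum>i\<in>{1..n}. real n * (\<Sum>j\<in>{1..n}. (?K (u, i) (v, j))\<^sup>2))"
      by (intro sum_mono *)
    also have "\<dots> = real n * (\<Sum>i\<in>{1..n}. \<Sum>j\<in>{1..n}. (?K (u, i) (v, j))\<^sup>2)"
      by (simp add: sum_distrib_left)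
    finally show "(?k u v)\<^sup>2 \<le> (\<Sum>i\<in>{1..n}. \<Sum>j\<in>{1..n}. (?K (u, i) (v, j))\<^sup>2)"
      using n by simp
  qed
  also have "\<dots> = (\<Sum>u\<in>verts \<Omega>. \<Sum>i\<in>{1..n}. \<Sum>v\<in>verts \<Omega>. \<Sum>j\<in>{1..n}. (?K (u, i) (v, j))\<^sup>2)"
    by (intro sum.cong refl sum.swap)
  also have "\<dots> = (\<Sum>x\<in>verts \<Gamma>. \<Sum>y\<in>verts \<Gamma>. (?K x y)\<^sup>2)"
  proof -
    have "(\<Sum>x\<in>verts \<Gamma>. f x) = (\<Sum>u\<in>verts \<Omega>. \<Sum>i\<in>{1..n}. f (u, i))" for f :: "'v \<times> nat \<Rightarrow> real"
      by (simp add: sum.cartesian_product)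
    then show ?thesis by simp
  qed
  finally show "(\<Sum>x\<in>#base.rspec. (poly r x)\<^sup>2) \<le> (\<Sum>x\<in>#cover.rspec. (poly r x)\<^sup>2)"
    by (simp only: base.sum_rspec_square cover.sum_rspec_square)
qed

definition new_spec :: "real multiset" where
  "new_spec = cover.rspec - base.rspec"

lemma adj_spec_diff: "adj_spec \<Gamma> - adj_spec \<Omega> = image_mset of_real new_spec" if "n \<ge> 1"
  unfolding new_spec_def base.adj_spec_rspec cover.adj_spec_rspec
  by (rule image_mset_Diff[OF rspec_subset[OF that], symmetric])

lemma size_new_spec: "size new_spec + card (verts \<Omega>) = n * card (verts \<Omega>)" if "n \<ge> 1"
  using size_Diff_submset[OF rspec_subset[OF that]] size_mset_mono[OF rspec_subset[OF that]]
  by (simp add: new_spec_def base.size_rspec cover.size_rspec card_cartesian_product mult.commute)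

lemma new_spec_bound: "x \<in># new_spec \<Longrightarrow> \<bar>x\<bar> \<le> real d"
  using cover.rspec_bound in_diffD unfolding new_spec_def by metis

lemma sum_new_spec: "(\<Sum>x\<in>#new_spec. f x) = (\<Sum>x\<in>#cover.rspec. f x) - (\<Sum>x\<in>#base.rspec. f x :: real)"
  if "n \<ge> 1"
proof -
  have "cover.rspec = new_spec + base.rspec"
    using rspec_subset[OF that] by (simp add: new_spec_def)
  then show ?thesis by simp
qed

lemma sum_new_spec_dickson:
  assumes "n \<ge> 1" "k \<ge> 1"
  shows "(\<Sum>x\<in>#new_spec. poly (dickson q k) x) = cover.closed_nb k - base.closed_nb k
    - (if even k then (real n - 1) * (q - 1) * real (card (verts \<Omega>)) else 0)"
  using assms
  by (simp add: sum_new_spec base.sum_rspec_dickson cover.sum_rspec_dickson card_cartesian_product algebra_simps)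

end

section \<open>Identifications along a closed non-backtracking walk\<close>

definition dart_origin :: "('e \<times> nat \<times> nat) \<times> bool \<Rightarrow> nat" where
  "dart_origin x = (if snd x then fst (snd (fst x)) else snd (snd (fst x)))"

text \<open>A closed walk of length \<open>k\<close> is unrolled to periodic sequences on all
  naturals, so that it can be shifted without modular arithmetic. Equal values of \<open>C\<close>
  mark visits that are identified; the quotient graph has \<open>labels\<close> as vertices and
  \<open>edges\<close> as edges.\<close>

locale labelled_cycle =
  fixes k :: nat and W :: "nat \<Rightarrow> 'e \<times> bool" and C :: "nat \<Rightarrow> nat"
  assumes k: "k \<ge> 1" and perW: "\<And>j. W (j + k) = W j" and perC: "\<And>j. C (j + k) = C j"
    and nb: "\<And>j. W (Suc j) \<noteq> rev_dart (W j)"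
begin

text \<open>The two labels are ordered along the orientation of the arc, so that passages in
  opposite directions can give the same edge.\<close>

definition edge :: "nat \<Rightarrow> 'e \<times> nat \<times> nat" where
  "edge j = (fst (W j), if snd (W j) then (C j, C (Suc j)) else (C (Suc j), C j))"

definition dart :: "nat \<Rightarrow> ('e \<times> nat \<times> nat) \<times> bool" where
  "dart j = (edge j, snd (W j))"

abbreviation "edges \<equiv> edge ` {..<k}"
abbreviation "labels \<equiv> C ` {..<k}"

definition darts_at :: "nat \<Rightarrow> (('e \<times> nat \<times> nat) \<times> bool) set" where
  "darts_at x = {a \<in> edges \<times> UNIV. dart_origin a = x}"

lemma per_edge: "edge (j + k) = edge j"
  using perC[of j] perC[of "Suc j"] perW[of j] by (simp add: edge_def)

lemma mod_per: "W (j mod k) = W j" "C (j mod k) = C j" "edge (j mod k) = edge j"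
proof -
  have "W (i + m * k) = W i \<and> C (i + m * k) = C i \<and> edge (i + m * k) = edge i" for i m
  proof (induction m)
    case (Suc m)
    have "i + Suc m * k = (i + m * k) + k" by simp
    then show ?case using Suc by (simp only: perW perC per_edge)
  qed simp
  from this[of "j mod k" "j div k"]
  show "W (j mod k) = W j" "C (j mod k) = C j" "edge (j mod k) = edge j" by auto
qed

lemma edge_in_edges: "edge j \<in> edges"
  using imageI[of "j mod k" "{..<k}" edge] k unfolding mod_per by simp

lemma C_in_labels: "C j \<in> labels"
  using imageI[of "j mod k" "{..<k}" C] k unfolding mod_per by simp

lemma dart_in: "dart j \<in> darts_at (C j)" "rev_dart (dart j) \<in> darts_at (C (Suc j))"
  using edge_in_edges[of j] by (auto simp: darts_at_def dart_def dart_origin_def edge_def)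

lemma dart_tag: "(fst (fst (dart j)), snd (dart j)) = W j"
  by (simp add: dart_def edge_def)

lemma nb_dart: "dart (Suc j) \<noteq> rev_dart (dart j)"
proof
  assume "dart (Suc j) = rev_dart (dart j)"
  then have "W (Suc j) = rev_dart (W j)"
    using dart_tag[of j] dart_tag[of "Suc j"] by (cases "dart j"; cases "W j") auto
  then show False using nb by blast
qed

lemma finite_darts_at [simp]: "finite (darts_at x)"
  unfolding darts_at_def by (rule finite_subset[of _ "edges \<times> UNIV"]) auto

lemma two_le_card_darts_at: "x \<in> labels \<Longrightarrow> 2 \<le> card (darts_at x)"
proof -
  assume "x \<in> labels"
  then obtain j where "x = C j" by blast
  \<comment> \<open>Going once around supplies a predecessor also for \<open>j = 0\<close>.\<close>
  then have x: "x = C (Suc (j + k - 1))" using k perC[of j] by simp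
  let ?j = "j + k - 1"
  have "{dart (Suc ?j), rev_dart (dart ?j)} \<subseteq> darts_at x"
    using dart_in(1)[of "Suc ?j"] dart_in(2)[of ?j] unfolding x by blast
  from card_mono[OF finite_darts_at this] show ?thesis using nb_dart[of ?j] by simp
qed

lemma sum_card_darts_at: "(\<Sum>x\<in>labels. card (darts_at x)) = 2 * card edges"
proof -
  have "dart_origin a \<in> labels" if "a \<in> edges \<times> UNIV" for a
  proof -
    from that obtain j b where "a = (edge j, b)" by auto
    then show ?thesis using C_in_labels[of j] C_in_labels[of "Suc j"]
      by (auto simp: dart_origin_def edge_def)
  qed
  then have "edges \<times> UNIV = (\<Union>x\<in>labels. darts_at x)"
    unfolding darts_at_def by blast
  moreover have "card (\<Union>x\<in>labels. darts_at x) = (\<Sum>x\<in>labels. card (darts_at x))"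
    by (rule card_UN_disjoint) (auto simp: darts_at_def)
  ultimately have "(\<Sum>x\<in>labels. card (darts_at x)) = card (edges \<times> (UNIV :: bool set))" by simp
  then show ?thesis by (simp add: card_cartesian_product)
qed

text \<open>Every label carries at least two darts, the outgoing one and the reverse of the incoming one,
  because the walk is cyclically reduced.\<close>

lemma card_labels_le: "card labels \<le> card edges"
proof -
  have "(\<Sum>x\<in>labels. 2) \<le> (\<Sum>x\<in>labels. card (darts_at x))"
    by (rule sum_mono) (rule two_le_card_darts_at)
  then show ?thesis unfolding sum_card_darts_at by simp
qed

context
  assumes eq: "card edges = card labels"
begin

text \<open>Euler characteristic 0 forces equality in the count behind
  \<open>card_labels_le\<close>, so that the quotient graph is 2-regular.\<close>

lemma card_darts_at: "x \<in> labels \<Longrightarrow> card (darts_at x) = 2"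
proof (rule ccontr)
  assume x: "x \<in> labels" and "card (darts_at x) \<noteq> 2"
  then have "2 < card (darts_at x)" using two_le_card_darts_at[OF x] by linarith
  then have "(\<Sum>x\<in>labels. 2) < (\<Sum>x\<in>labels. card (darts_at x))"
    using x two_le_card_darts_at by (intro sum_strict_mono_ex1) auto
  then show False unfolding sum_card_darts_at using eq by simp
qed

lemma darts_at_eq: "darts_at (C (Suc j)) = {dart (Suc j), rev_dart (dart j)}"
proof (rule sym, rule card_subset_eq[OF finite_darts_at])
  show "{dart (Suc j), rev_dart (dart j)} \<subseteq> darts_at (C (Suc j))"
    using dart_in(1)[of "Suc j"] dart_in(2)[of j] by blast
  show "card {dart (Suc j), rev_dart (dart j)} = card (darts_at (C (Suc j)))"
    using card_darts_at[OF C_in_labels[of "Suc j"]] nb_dart[of j] by simp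
qed

text \<open>A walk that met itself in the opposite direction would have to turn around midway.\<close>

lemma not_opposite: "j \<le> m \<Longrightarrow> dart j \<noteq> rev_dart (dart m)"
proof (induction "m - j" arbitrary: j m rule: less_induct)
  case less
  show ?case
  proof
    assume opp: "dart j = rev_dart (dart m)"
    then have opp': "rev_dart (dart j) = dart m" by simp
    consider "m = j" | "m = Suc j" | m' where "m = Suc m'" "Suc j \<le> m'"
      using less.prems by (cases m) (auto simp: le_Suc_eq, metis Suc_leI le_neq_implies_less)
    then show False
    proof cases
      case 1
      then show ?thesis using opp by (metis rev_dart_neq(2))
    next
      case 2
      then show ?thesis using opp' nb_dart[of j] by simp
    next
      case 3
      have "C (Suc j) = C m"
        using dart_in(2)[of j] dart_in(1)[of m] opp' by (auto simp: darts_at_def)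
      \<comment> \<open>The label shared by both times carries just two darts, one of which is
        common to both descriptions. The other two must then agree, and the opposite pair has moved
        one step inwards.\<close>
      then have "{dart (Suc j), rev_dart (dart j)} = {dart m, rev_dart (dart m')}"
        using darts_at_eq[of j] darts_at_eq[of m'] 3 by simp
      then have "dart (Suc j) = rev_dart (dart m')"
        using opp' nb_dart[of j] by (metis doubleton_eq_iff)
      then show False using less.hyps[of m' "Suc j"] 3 by simp
    qed
  qed
qed

text \<open>Two visits to a vertex of degree 2 leave it by the same dart, since
  \<open>not_opposite\<close> excludes that one leaves where the other arrives.\<close>

lemma same_label_step:
  assumes "i < j" "C i = C j"
  shows "W i = W j \<and> C (Suc i) = C (Suc j)"
proof -
  define i' j' where "i' = i + k - 1" and "j' = j + k - 1"
  have ij: "Suc i' = i + k" "Suc j' = j + k" using k by (auto simp: i'_def j'_def)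
  have "C (Suc i') = C (Suc j')" unfolding ij using assms perC by simp
  then have "{dart (Suc i'), rev_dart (dart i')} = {dart (Suc j'), rev_dart (dart j')}"
    using darts_at_eq by metis
  moreover have "dart (Suc i') \<noteq> rev_dart (dart j')"
    using assms ij by (intro not_opposite) auto
  ultimately have eq': "dart (Suc i') = dart (Suc j')" by (metis doubleton_eq_iff)
  then have "W (Suc i') = W (Suc j')" using dart_tag by metis
  moreover have "C (Suc (Suc i')) = C (Suc (Suc j'))"
    using eq' calculation by (auto simp: dart_def edge_def split: if_splits)
  moreover have "Suc (Suc i') = Suc i + k" "Suc (Suc j') = Suc j + k" using ij by auto
  ultimately show ?thesis unfolding ij(1) ij(2) by (metis perW perC)
qed

lemma same_label_shift:
  assumes "i < j" "C i = C j"
  shows "W (s + (j - i)) = W s \<and> C (s + (j - i)) = C s"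
proof -
  have *: "C (i + t) = C (j + t) \<and> W (i + t) = W (j + t)" for t
  proof (induction t)
    case 0
    then show ?case using same_label_step assms by simp
  next
    case (Suc t)
    have "C (Suc (i + t)) = C (Suc (j + t))" using same_label_step[of "i + t" "j + t"] Suc assms by simp
    then show ?case using same_label_step[of "Suc (i + t)" "Suc (j + t)"] assms by simp
  qed
  \<comment> \<open>Coincidences have only been propagated forwards, so a time \<open>s\<close>
    before \<open>i\<close> is reached \<open>i\<close> rounds later.\<close>
  have "i \<le> s + i * k" using k by (simp add: trans_le_add2)
  define t where "t = s + i * k - i"
  have t: "i + t = s + i * k" "j + t = s + (j - i) + i * k"
    using \<open>i \<le> s + i * k\<close> assms unfolding t_def by linarith+
  have "C (x + i * k) = C x" "W (x + i * k) = W x" for x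
    using mod_per(1,2)[of "x + i * k"] mod_per(1,2)[of x] by simp_all
  then show ?thesis using *[of t] unfolding t by simp
qed

text \<open>The least period \<open>l\<close> is below \<open>k\<close>, and then
  \<open>k - l\<close> is a period as well, so \<open>l \<le> k - l\<close>. A label repeated within
  one period would give a shorter one.\<close>

lemma period_exists:
  assumes "\<not> inj_on C {..<k}"
  obtains l where "0 < l" "2 * l \<le> k" "\<And>j. W (j + l) = W j" "\<And>j. C (j + l) = C j" "inj_on C {..<l}"
proof -
  define P where "P l \<longleftrightarrow> 0 < l \<and> (\<forall>j. W (j + l) = W j \<and> C (j + l) = C j)" for l
  have diff: "P (j - i)" if "i < j" "C i = C j" for i j
    using same_label_shift[OF that] that by (auto simp: P_def)
  obtain i j where ij: "i < j" "j < k" "C i = C j"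
    using assms unfolding inj_on_def by (metis lessThan_iff linorder_neqE_nat)
  define l where "l = (LEAST l. P l)"
  have Pl: "P l" unfolding l_def by (rule LeastI[of P]) (rule diff[OF ij(1,3)])
  have least: "P m \<Longrightarrow> l \<le> m" for m unfolding l_def by (rule Least_le)
  have "l < k" using least[OF diff[OF ij(1,3)]] ij by linarith
  have "P (k - l)"
  proof -
    have "W (j + (k - l)) = W (j + (k - l) + l)" "C (j + (k - l)) = C (j + (k - l) + l)" for j
      using Pl unfolding P_def by metis+
    then show ?thesis using \<open>l < k\<close> perW perC unfolding P_def by simp
  qed
  then have "2 * l \<le> k" using least \<open>l < k\<close> by fastforce
  moreover have "inj_on C {..<l}"
  proof (rule linorder_inj_onI)
    fix x y assume "x < y" "x \<in> {..<l}" "y \<in> {..<l}"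
    then show "C x \<noteq> C y" using diff[of x y] least[of "y - x"] by auto
  qed auto
  ultimately show thesis using that Pl unfolding P_def by blast
qed

end

end

section \<open>Cyclically reduced walks and their patterns of coincidences\<close>

lemma kpow_conv_card:
  assumes "finite D" "a \<in> D"
  shows "kpow D (\<lambda>x y. of_bool (R x y)) k a b
    = real (card {ws. length ws = k \<and> set ws \<subseteq> D \<and> successively R (a # ws) \<and> last (a # ws) = b})"
  using assms(2)
proof (induction k arbitrary: a)
  case 0
  have "{ws :: 'a list. length ws = 0 \<and> set ws \<subseteq> D \<and> successively R (a # ws) \<and> last (a # ws) = b}
    = (if a = b then {[]} else {})" by auto
  then show ?case by simp
next
  case (Suc k)
  let ?L = "\<lambda>k a. {ws. length ws = k \<and> set ws \<subseteq> D \<and> successively R (a # ws) \<and> last (a # ws) = b}"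
  have fin: "finite (?L k z)" for z
    by (rule finite_subset[OF _ finite_lists_length_eq[OF assms(1), of k]]) auto
  have "?L (Suc k) a = (\<Union>z\<in>{z \<in> D. R a z}. (#) z ` ?L k z)"
  proof (intro equalityI subsetI)
    fix ws assume "ws \<in> ?L (Suc k) a"
    then show "ws \<in> (\<Union>z\<in>{z \<in> D. R a z}. (#) z ` ?L k z)"
      by (cases ws) auto
  qed auto
  moreover have "card (\<Union>z\<in>{z \<in> D. R a z}. (#) z ` ?L k z) = (\<Sum>z\<in>{z \<in> D. R a z}. card ((#) z ` ?L k z))"
    using assms(1) fin by (intro card_UN_disjoint) auto
  moreover have "\<dots> = (\<Sum>z\<in>{z \<in> D. R a z}. card (?L k z))"
    by (simp add: card_image)
  moreover have "real (\<Sum>z\<in>{z \<in> D. R a z}. card (?L k z)) = (\<Sum>z\<in>D. of_bool (R a z) * real (card (?L k z)))"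
    unfolding of_nat_sum sum_of_bool_mult_eq[OF assms(1)] by (intro sum.cong) auto
  ultimately show ?case using Suc.IH by simp
qed

definition cyc_walks :: "('v, 'e) pre_digraph \<Rightarrow> nat \<Rightarrow> ('e \<times> bool) list set" where
  "cyc_walks G k = {w. length w = k \<and> set w \<subseteq> arcs (darts G) \<and>
     (\<forall>j<k. nb_step G (w ! j) (w ! (Suc j mod k)))}"

text \<open>Putting the last element in front turns the cyclic condition into one along a list, the
  form that \<open>kpow_conv_card\<close> counts.\<close>

lemma successively_last_Cons_iff:
  assumes "length ws = k" "k \<ge> 1"
  shows "successively R (last ws # ws) \<longleftrightarrow> (\<forall>j<k. R (ws ! j) (ws ! (Suc j mod k)))"
proof
  assume *: "successively R (last ws # ws)"
  have step: "R ((last ws # ws) ! i) (ws ! i)" if "i < k" for i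
    using * that assms unfolding successively_conv_nth by simp
  show "\<forall>j<k. R (ws ! j) (ws ! (Suc j mod k))"
  proof (intro allI impI)
    fix j assume j: "j < k"
    show "R (ws ! j) (ws ! (Suc j mod k))"
    proof (cases "Suc j = k")
      case True
      then have "last ws = ws ! j" using assms by (subst last_conv_nth) auto
      then show ?thesis using step[of 0] True assms by simp
    next
      case False
      then show ?thesis using step[of "Suc j"] j by simp
    qed
  qed
next
  assume *: "\<forall>j<k. R (ws ! j) (ws ! (Suc j mod k))"
  show "successively R (last ws # ws)"
    unfolding successively_conv_nth
  proof (intro allI impI)
    fix i assume i: "Suc i < length (last ws # ws)"
    show "R ((last ws # ws) ! i) ((last ws # ws) ! Suc i)"
    proof (cases i)
      case 0
      have "last ws = ws ! (k - 1)" using assms by (subst last_conv_nth) auto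
      then show ?thesis using *[rule_format, of "k - 1"] assms 0 by simp
    next
      case (Suc m)
      then show ?thesis using *[rule_format, of m] assms i by simp
    qed
  qed
qed

text \<open>If the walk \<open>w\<close> is lifted with label \<open>c j\<close> at time \<open>j\<close>, then the permutation of its \<open>j\<close>-th edge has
  to send the first component of \<open>elab w c j\<close> to the second one.\<close>

definition elab :: "('e \<times> bool) list \<Rightarrow> (nat \<Rightarrow> nat) \<Rightarrow> nat \<Rightarrow> nat \<times> nat" where
  "elab w c j = (if snd (w ! j) then (c j, c (Suc j mod length w)) else (c (Suc j mod length w), c j))"

definition pedges :: "('e \<times> bool) list \<Rightarrow> (nat \<Rightarrow> nat) \<Rightarrow> 'e \<Rightarrow> (nat \<times> nat) set" where
  "pedges w c e = elab w c ` {j. j < length w \<and> fst (w ! j) = e}"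

lemma finite_pedges [simp]: "finite (pedges w c e)"
  by (simp add: pedges_def)

lemma card_pedges_le: "card (pedges w c e) \<le> length w"
proof -
  have "card (pedges w c e) \<le> card {j. j < length w \<and> fst (w ! j) = e}"
    unfolding pedges_def by (rule card_image_le) auto
  also have "\<dots> \<le> card {..<length w}" by (rule card_mono) auto
  finally show ?thesis by simp
qed

text \<open>The condition under which the prescriptions \<open>p x = y\<close>, for (x, y) in the
  set, can be met by a permutation.\<close>

definition partial_inj :: "('a \<times> 'b) set \<Rightarrow> bool" where
  "partial_inj S \<longleftrightarrow> inj_on fst S \<and> inj_on snd S"

text \<open>Partitions of the times \<open>{..<k}\<close>, with every time mapped to the first one in its block.\<close>

definition canonical :: "nat \<Rightarrow> (nat \<Rightarrow> nat) set" where
  "canonical k = {c \<in> {..<k} \<rightarrow>\<^sub>E {..<k}. \<forall>j<k. c j \<le> j \<and> c (c j) = c j}"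

lemma finite_canonical [simp]: "finite (canonical k)"
  by (rule finite_subset[OF _ finite_PiE[of "{..<k}" "\<lambda>_. {..<k}"]]) (auto simp: canonical_def)

lemma canonical_inj_imp_id:
  assumes "c \<in> canonical k" "inj_on c {..<l}" "l \<le> k" "j < l"
  shows "c j = j"
proof -
  have "c j \<le> j" "c (c j) = c j" using assms by (auto simp: canonical_def)
  then show ?thesis using assms(2,4) by (auto simp: inj_on_def)
qed

lemma identity_canonical: "restrict id {..<k} \<in> canonical k"
  by (auto simp: canonical_def)

context regular_multigraph
begin

lemma closed_nb_conv_card:
  assumes "k \<ge> 1"
  shows "closed_nb k = real (card (cyc_walks G k))"
proof -
  let ?L = "\<lambda>a. {ws. length ws = k \<and> set ws \<subseteq> D \<and> successively (nb_step G) (a # ws) \<and> last (a # ws) = a}"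
  have "cyc_walks G k = (\<Union>a\<in>D. ?L a)"
  proof (intro equalityI subsetI)
    fix ws assume "ws \<in> cyc_walks G k"
    then have ws: "length ws = k" "set ws \<subseteq> D" "successively (nb_step G) (last ws # ws)"
      using successively_last_Cons_iff[of ws k] assms by (auto simp: cyc_walks_def)
    moreover from ws have "ws \<noteq> []" using assms by auto
    then have "last ws \<in> D" "last (last ws # ws) = last ws" using ws by auto
    ultimately show "ws \<in> (\<Union>a\<in>D. ?L a)" by blast
  next
    fix ws assume "ws \<in> (\<Union>a\<in>D. ?L a)"
    then obtain a where ws: "length ws = k" "set ws \<subseteq> D" "successively (nb_step G) (a # ws)" "last (a # ws) = a"
      by blast
    then have "a = last ws" using assms by (auto split: if_splits)
    then show "ws \<in> cyc_walks G k"
      using ws successively_last_Cons_iff[of ws k] assms by (auto simp: cyc_walks_def)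
  qed
  moreover have "card (\<Union>a\<in>D. ?L a) = (\<Sum>a\<in>D. card (?L a))"
  proof (intro card_UN_disjoint ballI impI)
    show "finite (?L a)" for a
      by (rule finite_subset[OF _ finite_lists_length_eq[OF finite_D, of k]]) auto
    show "?L a \<inter> ?L b = {}" if "a \<noteq> b" for a b
      using that assms by (auto split: if_splits)
  qed simp
  ultimately show ?thesis
    unfolding closed_nb_def by (simp add: kpow_conv_card)
qed

lemma finite_cyc_walks [simp]: "finite (cyc_walks G k)"
  by (rule finite_subset[OF _ finite_lists_length_eq[OF finite_D, of k]]) (auto simp: cyc_walks_def)

lemma sum_B: "a \<in> D \<Longrightarrow> (\<Sum>z\<in>D. B a z) = q"
proof -
  assume a: "a \<in> D"
  have "(\<Sum>z\<in>D. B a z) = (\<Sum>z\<in>D. of_bool (src z = tgt a)) - (\<Sum>z\<in>D. of_bool (z = rev_dart a))"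
    unfolding B_split sum_subtractf eq_commute[of "tgt a"] ..
  then show ?thesis using a q by (simp add: out_count sum_of_bool_single)
qed

lemma sum_kpow_B: "a \<in> D \<Longrightarrow> (\<Sum>b\<in>D. kpow D B k a b) = q ^ k"
proof (induction k arbitrary: a)
  case (Suc k)
  have "(\<Sum>b\<in>D. kpow D B (Suc k) a b) = (\<Sum>z\<in>D. B a z * (\<Sum>b\<in>D. kpow D B k z b))"
    by (simp add: sum_distrib_left) (rule sum.swap)
  also have "\<dots> = (\<Sum>z\<in>D. B a z * q ^ k)" using Suc.IH by (intro sum.cong) auto
  also have "\<dots> = q ^ Suc k" by (simp add: sum_distrib_right[symmetric] sum_B[OF Suc.prems])
  finally show ?case .
qed (simp add: of_bool_def)

lemma finite_nb_lists: "finite {u. length u = l \<and> set u \<subseteq> D \<and> successively (nb_step G) u}"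
  by (rule finite_subset[OF _ finite_lists_length_eq[OF finite_D, of l]]) auto

lemma card_nb_lists:
  assumes "l \<ge> 1"
  shows "real (card {u. length u = l \<and> set u \<subseteq> D \<and> successively (nb_step G) u}) = real (card D) * q ^ (l - 1)"
proof -
  obtain m where m: "l = Suc m" using assms by (cases l) auto
  let ?L = "\<lambda>a b. {ws. length ws = m \<and> set ws \<subseteq> D \<and> successively (nb_step G) (a # ws) \<and> last (a # ws) = b}"
  have "{u. length u = l \<and> set u \<subseteq> D \<and> successively (nb_step G) u}
     = (\<Union>p\<in>D \<times> D. (#) (fst p) ` ?L (fst p) (snd p))"
  proof (intro equalityI subsetI)
    fix u assume u: "u \<in> {u. length u = l \<and> set u \<subseteq> D \<and> successively (nb_step G) u}"
    then obtain a ws where "u = a # ws" using m by (cases u) auto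
    with u have "a \<in> D" "last (a # ws) \<in> D" "ws \<in> ?L a (last (a # ws))" using m by auto
    then have "(a, last (a # ws)) \<in> D \<times> D" "u \<in> (#) (fst (a, last (a # ws))) ` ?L (fst (a, last (a # ws))) (snd (a, last (a # ws)))"
      using \<open>u = a # ws\<close> by auto
    then show "u \<in> (\<Union>p\<in>D \<times> D. (#) (fst p) ` ?L (fst p) (snd p))" by (rule UN_I)
  qed (auto simp: m)
  moreover have "card (\<Union>p\<in>D \<times> D. (#) (fst p) ` ?L (fst p) (snd p)) = (\<Sum>p\<in>D \<times> D. card ((#) (fst p) ` ?L (fst p) (snd p)))"
  proof (intro card_UN_disjoint ballI impI)
    show "finite ((#) (fst p) ` ?L (fst p) (snd p))" for p
      by (intro finite_imageI finite_subset[OF _ finite_lists_length_eq[OF finite_D, of m]]) auto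
  qed auto
  moreover have "(\<Sum>p\<in>D \<times> D. card ((#) (fst p) ` ?L (fst p) (snd p))) = (\<Sum>p\<in>D \<times> D. card (?L (fst p) (snd p)))"
    by (intro sum.cong refl card_image) auto
  ultimately have "real (card {u. length u = l \<and> set u \<subseteq> D \<and> successively (nb_step G) u})
     = (\<Sum>p\<in>D \<times> D. real (card (?L (fst p) (snd p))))" by simp
  also have "\<dots> = (\<Sum>p\<in>D \<times> D. kpow D B m (fst p) (snd p))"
    by (intro sum.cong refl, subst kpow_conv_card) auto
  also have "\<dots> = (\<Sum>a\<in>D. \<Sum>b\<in>D. kpow D B m a b)"
    by (simp add: sum.cartesian_product case_prod_beta)
  also have "\<dots> = real (card D) * q ^ m" by (simp add: sum_kpow_B)
  finally show ?thesis using m by simp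
qed

lemma labelled_cycle_cyc_walk:
  assumes "w \<in> cyc_walks G k" "k \<ge> 1"
  shows "labelled_cycle k (\<lambda>j. w ! (j mod k)) (\<lambda>j. c (j mod k))"
proof
  show "w ! (Suc j mod k) \<noteq> rev_dart (w ! (j mod k))" for j
  proof -
    have "nb_step G (w ! (j mod k)) (w ! (Suc (j mod k) mod k))"
      using assms by (auto simp: cyc_walks_def)
    then show ?thesis by (simp add: nb_step_def mod_Suc_eq)
  qed
qed (use assms in auto)

lemma card_edges_conv_pedges:
  assumes w: "w \<in> cyc_walks G k" "k \<ge> 1"
  shows "card (labelled_cycle.edge (\<lambda>j. w ! (j mod k)) (\<lambda>j. c (j mod k)) ` {..<k})
    = (\<Sum>e\<in>arcs G. card (pedges w c e))"
    "labelled_cycle.edge (\<lambda>j. w ! (j mod k)) (\<lambda>j. c (j mod k)) ` {..<k} = Sigma (arcs G) (pedges w c)"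
proof -
  interpret labelled_cycle k "\<lambda>j. w ! (j mod k)" "\<lambda>j. c (j mod k)"
    by (rule labelled_cycle_cyc_walk[OF w])
  have len: "length w = k" using w by (simp add: cyc_walks_def)
  have arc: "fst (w ! j) \<in> arcs G" if "j < k" for j
  proof -
    have "w ! j \<in> D" using w that by (auto simp: cyc_walks_def)
    then show ?thesis by (cases "w ! j") (auto simp: darts_def)
  qed
  have edge: "edge j = (fst (w ! j), elab w c j)" if "j < k" for j
    using that by (simp add: edge_def elab_def len)
  show *: "edges = Sigma (arcs G) (pedges w c)"
  proof (intro equalityI subsetI)
    fix x assume "x \<in> edges"
    then show "x \<in> Sigma (arcs G) (pedges w c)" using arc by (auto simp: edge pedges_def len)
  next
    fix x assume "x \<in> Sigma (arcs G) (pedges w c)"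
    then obtain j where "j < k" "x = (fst (w ! j), elab w c j)" by (auto simp: pedges_def len)
    then show "x \<in> edges" using edge by (metis image_eqI lessThan_iff)
  qed
  have "finite (arcs G)" using fin by (simp add: fin_digraph_def fin_digraph_axioms_def)
  then show "card edges = (\<Sum>e\<in>arcs G. card (pedges w c e))"
    unfolding * by (subst card_SigmaI) auto
qed

text \<open>The Euler characteristic of the quotient graph is never positive. It is the exponent of
  n in the expected number of lifts with that pattern, so no pattern grows with n.\<close>

lemma card_labels_le_pedges:
  assumes w: "w \<in> cyc_walks G k" "k \<ge> 1"
  shows "card (c ` {..<k}) \<le> (\<Sum>e\<in>arcs G. card (pedges w c e))"
    and "(\<Sum>e\<in>arcs G. card (pedges w c e)) \<le> k"
proof -
  interpret labelled_cycle k "\<lambda>j. w ! (j mod k)" "\<lambda>j. c (j mod k)"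
    by (rule labelled_cycle_cyc_walk[OF w])
  have "labels = c ` {..<k}" by (intro image_cong) auto
  then show "card (c ` {..<k}) \<le> (\<Sum>e\<in>arcs G. card (pedges w c e))"
    using card_labels_le card_edges_conv_pedges[OF w, of c] by simp
  show "(\<Sum>e\<in>arcs G. card (pedges w c e)) \<le> k"
    using card_image_le[of "{..<k}" edge] card_edges_conv_pedges[OF w, of c] by simp
qed

definition patterns :: "nat \<Rightarrow> (('e \<times> bool) list \<times> (nat \<Rightarrow> nat)) set" where
  "patterns k = {(w, c). w \<in> cyc_walks G k \<and> c \<in> canonical k \<and> (\<forall>e\<in>arcs G. partial_inj (pedges w c e))}"

text \<open>Euler characteristic 0: the patterns that survive in the limit of large n.\<close>

definition tight_patterns :: "nat \<Rightarrow> (('e \<times> bool) list \<times> (nat \<Rightarrow> nat)) set" where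
  "tight_patterns k = {(w, c) \<in> patterns k. (\<Sum>e\<in>arcs G. card (pedges w c e)) = card (c ` {..<k})}"

lemma finite_patterns [simp]: "finite (patterns k)"
  by (rule finite_subset[of _ "cyc_walks G k \<times> canonical k"]) (auto simp: patterns_def)

lemma finite_tight_patterns [simp]: "finite (tight_patterns k)"
  by (rule finite_subset[OF _ finite_patterns[of k]]) (auto simp: tight_patterns_def)

text \<open>With all times distinct, two prescriptions for an arc can clash only if the arc is run
  through in both directions at consecutive times, which a non-backtracking walk never does. There
  are \<open>k\<close> labels and at most \<open>k\<close> edges, so
  \<open>card_labels_le_pedges\<close> leaves only equality.\<close>

lemma identity_pattern_tight:
  assumes w: "w \<in> cyc_walks G k" and k: "k \<ge> 1"
  shows "(w, restrict id {..<k}) \<in> tight_patterns k"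
proof -
  let ?c = "restrict id {..<k}"
  have len: "length w = k" using w by (simp add: cyc_walks_def)
  have nbw: "w ! (Suc j mod k) \<noteq> rev_dart (w ! j)" if "j < k" for j
    using w that by (auto simp: cyc_walks_def nb_step_def)
  have el: "elab w ?c j = (if snd (w ! j) then (j, Suc j mod k) else (Suc j mod k, j))" if "j < k" for j
    using that by (simp add: elab_def len)
  have suc_inj: "i = j" if "Suc i mod k = Suc j mod k" "i < k" "j < k" for i j
    using that by (auto simp: mod_Suc split: if_splits)
  have opp: False if "i < k" "j < k" "fst (w ! i) = fst (w ! j)" "snd (w ! i)" "\<not> snd (w ! j)"
    "i = Suc j mod k \<or> j = Suc i mod k" for i j
  proof -
    have "w ! i = rev_dart (w ! j)" "w ! j = rev_dart (w ! i)"
      using that by (cases "w ! i"; cases "w ! j"; auto)+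
    then show False using nbw[OF that(1)] nbw[OF that(2)] that(6) by metis
  qed
  have "partial_inj (pedges w ?c e)" for e
    unfolding partial_inj_def
  proof (intro conjI inj_onI)
    fix x y assume "x \<in> pedges w ?c e" "y \<in> pedges w ?c e"
    then obtain i j where ij: "i < k" "j < k" "fst (w ! i) = e" "fst (w ! j) = e"
      and x: "x = elab w ?c i" and y: "y = elab w ?c j"
      by (auto simp: pedges_def len)
    note el' = el[OF ij(1)] el[OF ij(2)]
    show "x = y" if "fst x = fst y"
    proof (cases "snd (w ! i) = snd (w ! j)")
      case True
      then show ?thesis using that suc_inj[OF _ ij(1,2)] unfolding x y el' by (auto split: if_splits)
    next
      case False
      then show ?thesis using that opp[of i j] opp[of j i] ij unfolding x y el' by (auto split: if_splits)
    qed
    show "x = y" if "snd x = snd y"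
    proof (cases "snd (w ! i) = snd (w ! j)")
      case True
      then show ?thesis using that suc_inj[OF _ ij(1,2)] unfolding x y el' by (auto split: if_splits)
    next
      case False
      then show ?thesis using that opp[of i j] opp[of j i] ij unfolding x y el' by (auto split: if_splits)
    qed
  qed
  moreover have "card (?c ` {..<k}) = k" by (subst card_image) (auto simp: inj_on_def)
  ultimately show ?thesis
    using w identity_canonical card_labels_le_pedges[OF w k, of ?c]
    unfolding tight_patterns_def patterns_def by auto
qed

text \<open>A tight pattern that identifies two times winds around a cycle of length
  \<open>l\<close> at least twice.\<close>

lemma tight_pattern_periodic:
  assumes "(w, c) \<in> tight_patterns k" "c \<noteq> restrict id {..<k}" and k: "k \<ge> 1"
  obtains l where "l \<in> {1..k div 2}" "\<And>j. j < k \<Longrightarrow> w ! j = w ! (j mod l)" "\<And>j. j < k \<Longrightarrow> c j = j mod l"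
proof -
  from assms have w: "w \<in> cyc_walks G k" and c: "c \<in> canonical k"
    and eq: "(\<Sum>e\<in>arcs G. card (pedges w c e)) = card (c ` {..<k})"
    by (auto simp: tight_patterns_def patterns_def)
  interpret labelled_cycle k "\<lambda>j. w ! (j mod k)" "\<lambda>j. c (j mod k)"
    by (rule labelled_cycle_cyc_walk[OF w k])
  have labels: "labels = c ` {..<k}" by (intro image_cong) auto
  have tight: "card edges = card labels"
    using eq card_edges_conv_pedges[OF w k, of c] labels by simp
  have ninj: "\<not> inj_on (\<lambda>j. c (j mod k)) {..<k}"
  proof
    assume "inj_on (\<lambda>j. c (j mod k)) {..<k}"
    then have "inj_on c {..<k}" by (subst inj_on_cong[of _ _ "\<lambda>j. c (j mod k)"]) auto
    then have "c j = j" if "j < k" for j using canonical_inj_imp_id[OF c] that by blast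
    then have "c = restrict id {..<k}" using c by (auto simp: canonical_def PiE_def extensional_def)
    then show False using assms(2) by simp
  qed
  from period_exists[OF tight ninj] obtain l where l: "0 < l" "2 * l \<le> k"
    "\<And>j. w ! ((j + l) mod k) = w ! (j mod k)" "\<And>j. c ((j + l) mod k) = c (j mod k)"
    "inj_on (\<lambda>j. c (j mod k)) {..<l}" by metis
  have per: "w ! ((j + m * l) mod k) = w ! (j mod k) \<and> c ((j + m * l) mod k) = c (j mod k)" for j m
  proof (induction m)
    case (Suc m)
    have "j + Suc m * l = (j + m * l) + l" by simp
    then show ?case using Suc l(3,4) by metis
  qed simp
  have red: "w ! j = w ! (j mod l) \<and> c j = c (j mod l)" if "j < k" for j
  proof -
    have "j mod l < l" using l(1) by simp
    then have "j mod l < k" using l(2) by linarith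
    then show ?thesis using per[of "j mod l" "j div l"] that by simp
  qed
  have "inj_on c {..<l}" using l(2,5) by (subst inj_on_cong[of _ _ "\<lambda>j. c (j mod k)"]) auto
  then have "c j = j" if "j < l" for j using canonical_inj_imp_id[OF c _ _ that] l(2) by simp
  then have "c j = j mod l" if "j < k" for j using red[OF that] l(1) by simp
  then show thesis using red l(1,2) by (intro that[of l]) auto
qed

text \<open>Tight patterns with distinct times match the walks of the base graph one for one, which
  gives the exact cancellation later. Any other is determined by a period of at most k/2 and the
  darts of one period; halving the length turns powers of q into powers of its square root.\<close>

lemma card_tight_patterns:
  assumes k: "k \<ge> 1" and q1: "q \<ge> 1"
  shows "card (cyc_walks G k) \<le> card (tight_patterns k)"
    and "real (card (tight_patterns k)) \<le> real (card (cyc_walks G k)) + real k * real (card D) * sqrt q ^ k"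
proof -
  let ?id = "restrict id {..<k} :: nat \<Rightarrow> nat"
  define I where "I = (\<lambda>w. (w, ?id)) ` cyc_walks G k"
  have I: "I \<subseteq> tight_patterns k" using identity_pattern_tight[OF _ k] by (auto simp: I_def)
  have cI: "card I = card (cyc_walks G k)" unfolding I_def by (intro card_image) (auto simp: inj_on_def)
  show "card (cyc_walks G k) \<le> card (tight_patterns k)"
    using card_mono[OF finite_tight_patterns I] cI by simp
  define T where "T = Sigma {1..k div 2} (\<lambda>l. {u. length u = l \<and> set u \<subseteq> D \<and> successively (nb_step G) u})"
  have finT: "finite T" unfolding T_def using finite_nb_lists by auto
  have "\<exists>t\<in>T. \<forall>j<k. w ! j = snd t ! (j mod fst t) \<and> c j = j mod fst t"
    if wc: "(w, c) \<in> tight_patterns k - I" for w c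
  proof -
    from wc have w: "w \<in> cyc_walks G k" by (auto simp: tight_patterns_def patterns_def)
    have "c \<noteq> ?id" using wc w by (auto simp: I_def)
    from tight_pattern_periodic[OF _ this k] wc obtain l where l: "l \<in> {1..k div 2}"
      "\<And>j. j < k \<Longrightarrow> w ! j = w ! (j mod l)" "\<And>j. j < k \<Longrightarrow> c j = j mod l" by blast
    have len: "length w = k" "l < k" using w l(1) by (auto simp: cyc_walks_def)
    have "set (take l w) \<subseteq> D" using w set_take_subset[of l w] by (auto simp: cyc_walks_def)
    moreover have "successively (nb_step G) (take l w)"
      unfolding successively_conv_nth
    proof (intro allI impI)
      fix i assume "Suc i < length (take l w)"
      then have i: "Suc i < l" "Suc i < k" using len by auto
      have "\<forall>j<k. nb_step G (w ! j) (w ! (Suc j mod k))" using w by (simp add: cyc_walks_def)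
      then have "nb_step G (w ! i) (w ! (Suc i mod k))" using i(2) Suc_lessD by blast
      then have "nb_step G (w ! i) (w ! Suc i)" unfolding mod_less[OF i(2)] .
      then show "nb_step G (take l w ! i) (take l w ! Suc i)" using i by simp
    qed
    ultimately have "(l, take l w) \<in> T" using l(1) len by (auto simp: T_def)
    moreover have "\<forall>j<k. w ! j = take l w ! (j mod l) \<and> c j = j mod l"
      using l by simp
    ultimately show ?thesis by (intro bexI[of _ "(l, take l w)"]) auto
  qed
  note ex = this
  \<comment> \<open>It does not matter which of several periods is chosen: the pattern can be read
    back from any of them, and this makes \<open>f\<close> injective.\<close>
  define f where "f = (\<lambda>(w, c). SOME t. t \<in> T \<and> (\<forall>j<k. w ! j = snd t ! (j mod fst t) \<and> c j = j mod fst t))"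
  have f: "f (w, c) \<in> T \<and> (\<forall>j<k. w ! j = snd (f (w, c)) ! (j mod fst (f (w, c))) \<and> c j = j mod fst (f (w, c)))"
    if "(w, c) \<in> tight_patterns k - I" for w c
    unfolding f_def split by (rule someI_ex) (use ex[OF that] in blast)
  have "inj_on f (tight_patterns k - I)"
  proof (rule inj_onI)
    fix x y assume x: "x \<in> tight_patterns k - I" and y: "y \<in> tight_patterns k - I" and eq: "f x = f y"
    obtain w c w' c' where xy: "x = (w, c)" "y = (w', c')" by fastforce
    have len: "length w = k" "length w' = k" "c \<in> canonical k" "c' \<in> canonical k"
      using x y by (auto simp: xy tight_patterns_def patterns_def cyc_walks_def)
    have *: "w ! j = w' ! j" "c j = c' j" if "j < k" for j
      using f[of w c] f[of w' c'] x y eq that unfolding xy by auto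
    have "w = w'" using len * by (intro nth_equalityI) auto
    moreover have "c = c'" using len * by (intro PiE_ext[of c "{..<k}" "\<lambda>_. {..<k}" c']) (auto simp: canonical_def)
    ultimately show "x = y" by (simp add: xy)
  qed
  then have "card (tight_patterns k - I) \<le> card T"
    using f finT by (intro card_inj_on_le[of f]) auto
  then have "real (card (tight_patterns k)) \<le> real (card (cyc_walks G k)) + real (card T)"
    using card_Diff_subset[OF _ I] cI finite_subset[OF I] card_mono[OF finite_tight_patterns I] by simp
  also have "real (card T) = (\<Sum>l\<in>{1..k div 2}. real (card D) * q ^ (l - 1))"
    unfolding T_def using finite_nb_lists by (subst card_SigmaI) (auto simp: card_nb_lists intro!: sum.cong)
  also have "\<dots> \<le> (\<Sum>l\<in>{1..k div 2}. real (card D) * sqrt q ^ k)"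
  proof (intro sum_mono mult_left_mono)
    fix l assume "l \<in> {1..k div 2}"
    then have "2 * (l - 1) \<le> k" by auto
    then have "sqrt q ^ (2 * (l - 1)) \<le> sqrt q ^ k" using q1 by (intro power_increasing) auto
    then show "q ^ (l - 1) \<le> sqrt q ^ k" using q1 by (simp add: power_mult)
  qed auto
  also have "\<dots> = real (k div 2) * (real (card D) * sqrt q ^ k)" by simp
  also have "\<dots> \<le> real k * (real (card D) * sqrt q ^ k)"
    using q1 by (intro mult_right_mono) auto
  finally show "real (card (tight_patterns k)) \<le> real (card (cyc_walks G k)) + real k * real (card D) * sqrt q ^ k"
    by (simp add: mult.assoc)
qed

end

section \<open>Closed walks in a random covering\<close>

text \<open>One extension \<open>p0\<close> of the partial injection is glued from a bijection
  between the complements. All others arise from it by composition with a permutation that fixes the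
  domain of \<open>S\<close> pointwise.\<close>

lemma card_permutes_extending:
  assumes A: "finite A" and S: "S \<subseteq> A \<times> A" and inj: "partial_inj S"
  shows "card {p. p permutes A \<and> (\<forall>(x, y)\<in>S. p x = y)} = fact (card A - card S)"
proof -
  have finS: "finite S" using finite_subset[OF S] A by simp
  have i1: "inj_on fst S" and i2: "inj_on snd S" using inj by (auto simp: partial_inj_def)
  define f where "f = snd \<circ> inv_into S fst"
  have f: "f x = y" if "(x, y) \<in> S" for x y
    using inv_into_f_f[OF i1 that] by (simp add: f_def)
  have dom: "fst ` S \<subseteq> A" and ran: "snd ` S \<subseteq> A" using S by auto
  have "card (A - fst ` S) = card (A - snd ` S)"
    using dom ran A finS by (simp add: card_Diff_subset card_image i1 i2)
  then obtain g where g: "bij_betw g (A - fst ` S) (A - snd ` S)"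
    using A by (metis finite_Diff finite_same_card_bij)
  define p0 where "p0 x = (if x \<in> fst ` S then f x else if x \<in> A then g x else x)" for x
  have "bij_betw f (fst ` S) (snd ` S)"
    unfolding f_def
    by (rule bij_betw_trans[OF bij_betw_inv_into[OF inj_on_imp_bij_betw[OF i1]] inj_on_imp_bij_betw[OF i2]])
  then have "bij_betw p0 (fst ` S) (snd ` S)"
    by (rule bij_betw_cong[THEN iffD1, rotated]) (simp add: p0_def)
  moreover have "bij_betw p0 (A - fst ` S) (A - snd ` S)"
    by (rule bij_betw_cong[THEN iffD1, OF _ g]) (simp add: p0_def)
  ultimately have "bij_betw p0 (fst ` S \<union> (A - fst ` S)) (snd ` S \<union> (A - snd ` S))"
    by (rule bij_betw_combine) auto
  moreover have "fst ` S \<union> (A - fst ` S) = A" "snd ` S \<union> (A - snd ` S) = A" using dom ran by auto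
  ultimately have p0: "p0 permutes A"
    using dom by (intro bij_imp_permutes) (auto simp: p0_def)
  have p0S: "p0 x = y" if "(x, y) \<in> S" for x y
    using f[OF that] that by (force simp: p0_def)
  have "bij_betw (\<lambda>r. p0 \<circ> r) {r. r permutes (A - fst ` S)} {p. p permutes A \<and> (\<forall>(x, y)\<in>S. p x = y)}"
  proof (rule bij_betwI[of _ _ _ "\<lambda>p. inv_into UNIV p0 \<circ> p"])
    show "(\<lambda>r. p0 \<circ> r) \<in> {r. r permutes (A - fst ` S)} \<rightarrow> {p. p permutes A \<and> (\<forall>(x, y)\<in>S. p x = y)}"
    proof
      fix r assume "r \<in> {r. r permutes (A - fst ` S)}"
      then have r: "r permutes (A - fst ` S)" by simp
      then have "r permutes A" by (rule permutes_subset) auto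
      moreover have "r x = x" if "(x, y) \<in> S" for x y
        using that r by (force simp: permutes_def)
      ultimately show "p0 \<circ> r \<in> {p. p permutes A \<and> (\<forall>(x, y)\<in>S. p x = y)}"
        using p0 p0S permutes_compose[of r A p0] by auto
    qed
    show "(\<lambda>p. inv_into UNIV p0 \<circ> p) \<in> {p. p permutes A \<and> (\<forall>(x, y)\<in>S. p x = y)} \<rightarrow> {r. r permutes (A - fst ` S)}"
    proof
      fix p assume "p \<in> {p. p permutes A \<and> (\<forall>(x, y)\<in>S. p x = y)}"
      then have p: "p permutes A" "\<And>x y. (x, y) \<in> S \<Longrightarrow> p x = y" by auto
      have "inv_into UNIV p0 \<circ> p permutes A"
        by (rule permutes_compose[OF p(1) permutes_inv[OF p0]])
      moreover have "(inv_into UNIV p0 \<circ> p) x = x" if "x \<in> A - (A - fst ` S)" for x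
      proof -
        from that obtain y where "(x, y) \<in> S" by auto
        then have "p x = p0 x" using p(2) p0S by simp
        then show ?thesis using permutes_inverses(2)[OF p0] by simp
      qed
      ultimately have "inv_into UNIV p0 \<circ> p permutes (A - fst ` S)"
        by (rule permutes_superset)
      then show "inv_into UNIV p0 \<circ> p \<in> {r. r permutes (A - fst ` S)}" by simp
    qed
  qed (auto simp: fun_eq_iff permutes_inverses[OF p0])
  then have "card {p. p permutes A \<and> (\<forall>(x, y)\<in>S. p x = y)} = card {r. r permutes (A - fst ` S)}"
    by (rule bij_betw_same_card[symmetric])
  also have "\<dots> = fact (card (A - fst ` S))" using A by (intro card_permutations) auto
  also have "card (A - fst ` S) = card A - card S"
    using dom A finS by (simp add: card_Diff_subset card_image i1)
  finally show ?thesis .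
qed

lemma finite_perms: "finite {p. p permutes {1..n :: nat}}" "{p. p permutes {1..n :: nat}} \<noteq> {}"
  using permutes_id[of "{1..n}"] by (blast intro: finite_permutations)+

lemma set_pmf_perms: "set_pmf (pmf_of_set {p. p permutes {1..n :: nat}}) = {p. p permutes {1..n}}"
  by (rule set_pmf_of_set[OF finite_perms(2,1)])

lemma prob_permutation_extending:
  assumes S: "S \<subseteq> {1..n} \<times> {1..n}"
  shows "measure_pmf.prob (pmf_of_set {p. p permutes {1..n}}) {p. \<forall>(x, y)\<in>S. p x = y}
    = (if partial_inj S then fact (n - card S) / fact n else 0)"
proof -
  let ?P = "{p. p permutes {1..n}}"
  note fin = finite_perms[of n]
  have card: "card ?P = fact n" by (subst card_permutations[of _ n]) auto
  have prob: "measure_pmf.prob (pmf_of_set ?P) {p. \<forall>(x, y)\<in>S. p x = y}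
     = real (card {p. p permutes {1..n} \<and> (\<forall>(x, y)\<in>S. p x = y)}) / fact n"
    using fin card by (simp add: measure_pmf_of_set Int_def)
  show ?thesis
  proof (cases "partial_inj S")
    case True
    then show ?thesis using card_permutes_extending[OF _ S True] unfolding prob by simp
  next
    case False
    have "{p. p permutes {1..n} \<and> (\<forall>(x, y)\<in>S. p x = y)} = {}"
    proof (rule ccontr)
      assume "{p. p permutes {1..n} \<and> (\<forall>(x, y)\<in>S. p x = y)} \<noteq> {}"
      then obtain p where "p \<in> {p. p permutes {1..n} \<and> (\<forall>(x, y)\<in>S. p x = y)}" by blast
      then have p: "inj p" "\<And>x y. (x, y) \<in> S \<Longrightarrow> p x = y"
        by (auto intro: permutes_inj)
      have "partial_inj S"
      proof -
        have snd: "snd x = p (fst x)" if "x \<in> S" for x using p(2)[of "fst x" "snd x"] that by simp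
        have "inj_on fst S"
        proof (rule inj_onI)
          fix x y assume "x \<in> S" "y \<in> S" "fst x = fst y"
          then show "x = y" using snd[of x] snd[of y] by (intro prod_eqI) simp_all
        qed
        moreover have "inj_on snd S"
        proof (rule inj_onI)
          fix x y assume xy: "x \<in> S" "y \<in> S" "snd x = snd y"
          then have "p (fst x) = p (fst y)" using snd[of x] snd[of y] by simp
          then have "fst x = fst y" by (rule injD[OF p(1)])
          then show "x = y" using xy(3) by (intro prod_eqI)
        qed
        ultimately show ?thesis by (simp add: partial_inj_def)
      qed
      then show False using False by simp
    qed
    then have "card {p. p permutes {1..n} \<and> (\<forall>(x, y)\<in>S. p x = y)} = 0" by (simp only: card.empty)
    then show ?thesis unfolding prob using False by simp
  qed
qed

definition perm_family :: "'e set \<Rightarrow> nat \<Rightarrow> ('e \<Rightarrow> nat \<Rightarrow> nat) pmf" where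
  "perm_family E n = Pi_pmf E id (\<lambda>_. pmf_of_set {p. p permutes {1..n}})"

lemma set_pmf_perm_family:
  assumes "finite E" "\<sigma> \<in> set_pmf (perm_family E n)" "e \<in> E"
  shows "\<sigma> e permutes {1..n}"
  using assms(2,3) unfolding perm_family_def set_Pi_pmf[OF assms(1)] o_def set_pmf_perms
  by (auto simp: PiE_dflt_def)

lemma finite_set_pmf_perm_family: "finite E \<Longrightarrow> finite (set_pmf (perm_family E n))"
  unfolding perm_family_def by (simp only: set_Pi_pmf o_def set_pmf_perms) (intro finite_PiE_dflt finite_perms)

lemma prob_perm_family_extending:
  assumes E: "finite E" and S: "\<And>e. e \<in> E \<Longrightarrow> S e \<subseteq> {1..n} \<times> {1..n}"
  shows "measure_pmf.prob (perm_family E n) {\<sigma>. \<forall>e\<in>E. \<forall>(x, y)\<in>S e. \<sigma> e x = y}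
    = (\<Prod>e\<in>E. if partial_inj (S e) then fact (n - card (S e)) / fact n else 0)"
proof -
  have "{\<sigma>. \<forall>e\<in>E. \<forall>(x, y)\<in>S e. \<sigma> e x = y} = Pi E (\<lambda>e. {p. \<forall>(x, y)\<in>S e. p x = y})" by auto
  then have "measure_pmf.prob (perm_family E n) {\<sigma>. \<forall>e\<in>E. \<forall>(x, y)\<in>S e. \<sigma> e x = y}
    = (\<Prod>e\<in>E. measure_pmf.prob (pmf_of_set {p. p permutes {1..n}}) {p. \<forall>(x, y)\<in>S e. p x = y})"
    unfolding perm_family_def by (simp only: measure_Pi_pmf_Pi[OF E])
  also have "\<dots> = (\<Prod>e\<in>E. if partial_inj (S e) then fact (n - card (S e)) / fact n else 0)"
    by (intro prod.cong refl prob_permutation_extending S)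
  finally show ?thesis .
qed

section \<open>Lifting closed walks to the covering\<close>

definition compatible_labels :: "'e set \<Rightarrow> ('e \<Rightarrow> nat \<Rightarrow> nat) \<Rightarrow> ('e \<times> bool) list \<Rightarrow> (nat \<Rightarrow> nat) \<Rightarrow> bool" where
  "compatible_labels E \<sigma> w i \<longleftrightarrow> (\<forall>e\<in>E. \<forall>(x, y)\<in>pedges w i e. \<sigma> e x = y)"

lemma compatible_labels_iff:
  assumes "\<And>j. j < length w \<Longrightarrow> fst (w ! j) \<in> E"
  shows "compatible_labels E \<sigma> w i \<longleftrightarrow> (\<forall>j<length w. \<sigma> (fst (w ! j)) (fst (elab w i j)) = snd (elab w i j))"
proof
  assume *: "compatible_labels E \<sigma> w i"
  show "\<forall>j<length w. \<sigma> (fst (w ! j)) (fst (elab w i j)) = snd (elab w i j)"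
  proof (intro allI impI)
    fix j assume j: "j < length w"
    then have "elab w i j \<in> pedges w i (fst (w ! j))" by (auto simp: pedges_def)
    then show "\<sigma> (fst (w ! j)) (fst (elab w i j)) = snd (elab w i j)"
      using * assms[OF j] unfolding compatible_labels_def case_prod_beta by blast
  qed
next
  assume *: "\<forall>j<length w. \<sigma> (fst (w ! j)) (fst (elab w i j)) = snd (elab w i j)"
  show "compatible_labels E \<sigma> w i"
    unfolding compatible_labels_def
  proof (intro ballI)
    fix e x assume "x \<in> pedges w i e"
    then obtain j where "j < length w" "fst (w ! j) = e" "x = elab w i j" by (auto simp: pedges_def)
    then show "case x of (x, y) \<Rightarrow> \<sigma> e x = y" using * by (auto simp: case_prod_beta)
  qed
qed

context covering_graph
begin

lemma lift_cyc_walk_elab: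
  assumes ws: "ws \<in> cyc_walks \<Gamma> k" and j: "j < k"
  defines "w \<equiv> map (\<lambda>x. (fst (fst x), snd x)) ws"
    and "i \<equiv> restrict (\<lambda>j. snd (tail (darts \<Gamma>) (ws ! j))) {..<k}"
  shows "elab w i j = (snd (fst (ws ! j)), \<sigma> (fst (fst (ws ! j))) (snd (fst (ws ! j))))"
proof -
  have len: "length ws = k" using ws by (simp add: cyc_walks_def)
  have j': "Suc j mod k < k" using j by simp
  have "head (darts \<Gamma>) (ws ! j) = tail (darts \<Gamma>) (ws ! (Suc j mod k))"
    using ws j by (auto simp: cyc_walks_def nb_step_def)
  then have "i (Suc j mod k) = snd (head (darts \<Gamma>) (ws ! j))"
    using j' by (simp add: i_def)
  moreover have "i j = snd (tail (darts \<Gamma>) (ws ! j))" using j by (simp add: i_def)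
  moreover obtain e m b where "ws ! j = ((e, m), b)" by (metis surj_pair)
  ultimately show ?thesis using j len by (auto simp: elab_def w_def)
qed

text \<open>A closed walk upstairs is a closed walk downstairs together with the sheet visited at
  each time. The inverse map \<open>H\<close> recovers its arcs, because an arc carries the sheet of
  its tail, which is the first component of \<open>elab\<close>.\<close>

lemma card_cyc_walks_cover:
  "card (cyc_walks \<Gamma> k) = (\<Sum>w\<in>cyc_walks \<Omega> k. card {i \<in> {..<k} \<rightarrow>\<^sub>E {1..n}. compatible_labels (arcs \<Omega>) \<sigma> w i})"
proof -
  define F where "F ws = (map (\<lambda>x :: ('e \<times> nat) \<times> bool. (fst (fst x), snd x)) ws,
      restrict (\<lambda>j. snd (tail (darts \<Gamma>) (ws ! j))) {..<k})" for ws
  define H where "H wi = map (\<lambda>j. ((fst (fst wi ! j), fst (elab (fst wi) (snd wi) j)), snd (fst wi ! j))) [0..<k]"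
    for wi :: "('e \<times> bool) list \<times> (nat \<Rightarrow> nat)"
  have "bij_betw F (cyc_walks \<Gamma> k)
      (Sigma (cyc_walks \<Omega> k) (\<lambda>w. {i \<in> {..<k} \<rightarrow>\<^sub>E {1..n}. compatible_labels (arcs \<Omega>) \<sigma> w i}))"
  proof (rule bij_betwI[of _ _ _ H])
    show "F \<in> cyc_walks \<Gamma> k \<rightarrow> Sigma (cyc_walks \<Omega> k) (\<lambda>w. {i \<in> {..<k} \<rightarrow>\<^sub>E {1..n}. compatible_labels (arcs \<Omega>) \<sigma> w i})"
    proof
      fix ws assume ws: "ws \<in> cyc_walks \<Gamma> k"
      define w where "w = fst (F ws)"
      define i where "i = snd (F ws)"
      have len: "length ws = k" "length w = k" using ws by (auto simp: cyc_walks_def w_def F_def)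
      have wj: "w ! j = (fst (fst (ws ! j)), snd (ws ! j))" if "j < k" for j
        using that len by (simp add: w_def F_def)
      have el: "elab w i j = (snd (fst (ws ! j)), \<sigma> (fst (fst (ws ! j))) (snd (fst (ws ! j))))" if "j < k" for j
        using lift_cyc_walk_elab[OF ws that] by (simp add: w_def i_def F_def)
      have D: "ws ! j \<in> arcs (darts \<Gamma>)" if "j < k" for j
        using ws that unfolding cyc_walks_def by auto
      have arc: "fst (w ! j) \<in> arcs \<Omega>" if "j < k" for j
        using D[OF that] wj[OF that] by auto
      have "w \<in> cyc_walks \<Omega> k"
        unfolding cyc_walks_def
      proof (intro CollectI conjI allI impI)
        show "set w \<subseteq> arcs (darts \<Omega>)"
        proof
          fix a assume "a \<in> set w"
          then obtain j where "j < k" "a = w ! j" using len by (metis in_set_conv_nth)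
          then show "a \<in> arcs (darts \<Omega>)" using arc[of j] by (simp add: base_simps mem_Times_iff)
        qed
        fix j assume j: "j < k"
        then have j': "Suc j mod k < k" by simp
        have st: "nb_step \<Gamma> (ws ! j) (ws ! (Suc j mod k))" using ws j by (simp add: cyc_walks_def)
        obtain e m b where x: "ws ! j = ((e, m), b)" by (metis surj_pair)
        obtain e' m' b' where y: "ws ! (Suc j mod k) = ((e', m'), b')" by (metis surj_pair)
        have e: "e \<in> arcs \<Omega>" using D[OF j] x by auto
        have "w ! (Suc j mod k) \<noteq> rev_dart (w ! j)"
        proof
          assume "w ! (Suc j mod k) = rev_dart (w ! j)"
          then have e'b': "e' = e" "b' = (\<not> b)" using wj[OF j] wj[OF j'] x y by auto
          \<comment> \<open>If the projection backtracks, so does the lift: the two arcs above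
            \<open>e\<close> share an end, and permutations are injective.\<close>
          have "m' = m"
            using st e'b' permutes_inj[OF perm[OF e]] unfolding nb_step_def x y
            by (cases b) (auto dest: injD)
          then show False using st e'b' unfolding nb_step_def x y by simp
        qed
        moreover have "head (darts \<Omega>) (w ! j) = tail (darts \<Omega>) (w ! (Suc j mod k))"
          using st unfolding nb_step_def wj[OF j] wj[OF j'] x y by (auto simp: base_simps split: if_splits)
        ultimately show "nb_step \<Omega> (w ! j) (w ! (Suc j mod k))" by (simp add: nb_step_def)
      qed (rule len)
      moreover have "i \<in> {..<k} \<rightarrow>\<^sub>E {1..n}"
      proof -
        have "snd (tail (darts \<Gamma>) (ws ! j)) \<in> {1..n}" if "j < k" for j
          using cover.src_in_V[OF D[OF that]] by auto
        then show ?thesis by (auto simp: i_def F_def)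
      qed
      moreover have "compatible_labels (arcs \<Omega>) \<sigma> w i"
        using arc len by (subst compatible_labels_iff) (auto simp: el wj)
      moreover have "F ws = (w, i)" by (simp add: w_def i_def)
      ultimately show "F ws \<in> Sigma (cyc_walks \<Omega> k) (\<lambda>w. {i \<in> {..<k} \<rightarrow>\<^sub>E {1..n}. compatible_labels (arcs \<Omega>) \<sigma> w i})"
        by auto
    qed
    show "H (F ws) = ws" if ws: "ws \<in> cyc_walks \<Gamma> k" for ws
    proof (rule nth_equalityI)
      have len: "length ws = k" using ws by (simp add: cyc_walks_def)
      then show "length (H (F ws)) = length ws" by (simp add: H_def)
      fix j assume "j < length (H (F ws))"
      then have j: "j < k" by (simp add: H_def)
      show "H (F ws) ! j = ws ! j"
        using j len lift_cyc_walk_elab[OF ws j] by (simp add: H_def F_def)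
    qed
    have H: "H (w, i) \<in> cyc_walks \<Gamma> k \<and> F (H (w, i)) = (w, i)"
      if w: "w \<in> cyc_walks \<Omega> k" and i: "i \<in> {..<k} \<rightarrow>\<^sub>E {1..n}" and comp: "compatible_labels (arcs \<Omega>) \<sigma> w i" for w i
    proof -
      have len: "length w = k" using w by (simp add: cyc_walks_def)
      have arc: "fst (w ! j) \<in> arcs \<Omega>" if "j < k" for j
      proof -
        have "w ! j \<in> arcs (darts \<Omega>)" using w that unfolding cyc_walks_def by auto
        then show ?thesis by (cases "w ! j") (auto simp: base_simps)
      qed
      have c: "\<sigma> (fst (w ! j)) (fst (elab w i j)) = snd (elab w i j)" if "j < k" for j
        using comp compatible_labels_iff[of w "arcs \<Omega>" \<sigma> i] arc len that by auto
      have ij: "i j \<in> {1..n}" if "j < k" for j using i that by (auto simp: PiE_def Pi_def)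
      let ?x = "\<lambda>j. ((fst (w ! j), fst (elab w i j)), snd (w ! j))"
      have x: "H (w, i) ! j = ?x j" if "j < k" for j using that by (simp add: H_def)
      have tl: "tail (darts \<Gamma>) (?x j) = (tail (darts \<Omega>) (w ! j), i j)" if "j < k" for j
        using c[OF that] by (cases "w ! j") (auto simp: base_simps elab_def)
      have hd: "head (darts \<Gamma>) (?x j) = (head (darts \<Omega>) (w ! j), i (Suc j mod k))" if "j < k" for j
        using c[OF that] len by (cases "w ! j") (auto simp: base_simps elab_def)
      have "H (w, i) \<in> cyc_walks \<Gamma> k"
        unfolding cyc_walks_def
      proof (intro CollectI conjI allI impI)
        show "length (H (w, i)) = k" by (simp add: H_def)
        show "set (H (w, i)) \<subseteq> arcs (darts \<Gamma>)"
        proof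
          fix a assume "a \<in> set (H (w, i))"
          then obtain j where j: "j < k" "a = ?x j" by (auto simp: H_def)
          then have "Suc j mod k < k" by simp
          then have "fst (elab w i j) \<in> {1..n}" using ij j(1) len by (auto simp: elab_def)
          then show "a \<in> arcs (darts \<Gamma>)" using j arc by auto
        qed
        fix j assume j: "j < k"
        then have j': "Suc j mod k < k" by simp
        have st: "nb_step \<Omega> (w ! j) (w ! (Suc j mod k))" using w j by (simp add: cyc_walks_def)
        have "?x (Suc j mod k) \<noteq> rev_dart (?x j)"
        proof
          assume "?x (Suc j mod k) = rev_dart (?x j)"
          then have "w ! (Suc j mod k) = rev_dart (w ! j)"
            by (cases "w ! (Suc j mod k)"; cases "w ! j") auto
          then show False using st by (simp add: nb_step_def)
        qed
        moreover have "head (darts \<Gamma>) (?x j) = tail (darts \<Gamma>) (?x (Suc j mod k))"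
          unfolding tl[OF j'] hd[OF j] using st by (simp add: nb_step_def)
        ultimately show "nb_step \<Gamma> (H (w, i) ! j) (H (w, i) ! (Suc j mod k))"
          unfolding x[OF j] x[OF j'] nb_step_def by blast
      qed
      moreover have "fst (F (H (w, i))) = w"
        using len by (intro nth_equalityI) (auto simp: F_def H_def)
      moreover have "snd (F (H (w, i))) j = i j" for j
        using i x tl by (cases "j < k") (auto simp: F_def PiE_def extensional_def)
      then have "snd (F (H (w, i))) = i" by blast
      ultimately show ?thesis by (metis prod.collapse)
    qed
    show "H \<in> Sigma (cyc_walks \<Omega> k) (\<lambda>w. {i \<in> {..<k} \<rightarrow>\<^sub>E {1..n}. compatible_labels (arcs \<Omega>) \<sigma> w i}) \<rightarrow> cyc_walks \<Gamma> k"
      using H by auto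
    show "F (H y) = y" if "y \<in> Sigma (cyc_walks \<Omega> k) (\<lambda>w. {i \<in> {..<k} \<rightarrow>\<^sub>E {1..n}. compatible_labels (arcs \<Omega>) \<sigma> w i})" for y
      using H that by auto
  qed
  then have "card (cyc_walks \<Gamma> k)
     = card (Sigma (cyc_walks \<Omega> k) (\<lambda>w. {i \<in> {..<k} \<rightarrow>\<^sub>E {1..n}. compatible_labels (arcs \<Omega>) \<sigma> w i}))"
    by (rule bij_betw_same_card)
  also have "\<dots> = (\<Sum>w\<in>cyc_walks \<Omega> k. card {i \<in> {..<k} \<rightarrow>\<^sub>E {1..n}. compatible_labels (arcs \<Omega>) \<sigma> w i})"
    by (intro card_SigmaI) (auto intro!: finite_PiE)
  finally show ?thesis .
qed

end

section \<open>Sorting sheet assignments by their coincidences\<close>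

definition canon :: "nat \<Rightarrow> (nat \<Rightarrow> nat) \<Rightarrow> nat \<Rightarrow> nat" where
  "canon k i = restrict (\<lambda>j. LEAST m. i m = i j) {..<k}"

lemma canon_le: "j < k \<Longrightarrow> canon k i j \<le> j"
  by (simp add: canon_def Least_le)

lemma canon_eq: "j < k \<Longrightarrow> i (canon k i j) = i j"
  unfolding canon_def by (simp, rule LeastI[of _ j]) simp

lemma canon_cong: "j < k \<Longrightarrow> m < k \<Longrightarrow> i j = i m \<Longrightarrow> canon k i j = canon k i m"
  by (simp add: canon_def)

lemma canon_canonical: "canon k i \<in> canonical k"
proof -
  have "canon k i j \<le> j \<and> canon k i (canon k i j) = canon k i j" if "j < k" for j
    using canon_le[OF that, of i] canon_cong[of "canon k i j" k j i] canon_eq[OF that, of i] that by auto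
  moreover have "canon k i \<in> {..<k} \<rightarrow>\<^sub>E {..<k}"
    using canon_le[of _ k i] by (auto simp: PiE_def extensional_def canon_def Pi_def dest: le_less_trans)
  ultimately show ?thesis by (simp add: canonical_def)
qed

lemma inj_on_canon_labels: "inj_on i (canon k i ` {..<k})"
proof (rule inj_onI)
  fix x y assume "x \<in> canon k i ` {..<k}" "y \<in> canon k i ` {..<k}" "i x = i y"
  then obtain a b where "a < k" "b < k" "x = canon k i a" "y = canon k i b" by auto
  with \<open>i x = i y\<close> show "x = y" using canon_eq[of a k i] canon_eq[of b k i] canon_cong by metis
qed

lemma pedges_canon:
  assumes "length w = k"
  shows "pedges w i e = map_prod i i ` pedges w (canon k i) e"
proof -
  have "elab w i j = map_prod i i (elab w (canon k i) j)" if "j < k" for j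
  proof -
    have "Suc j mod k < k" using that by simp
    then show ?thesis using that assms by (simp add: elab_def canon_eq)
  qed
  then show ?thesis unfolding pedges_def image_image by (intro image_cong) (auto simp: assms)
qed

lemma pedges_subset: "pedges w c e \<subseteq> (c ` {..<length w}) \<times> (c ` {..<length w})"
proof
  fix x assume "x \<in> pedges w c e"
  then obtain j where j: "j < length w" "x = elab w c j" by (auto simp: pedges_def)
  from j(1) have "Suc j mod length w < length w" by (intro mod_less_divisor) linarith
  then show "x \<in> (c ` {..<length w}) \<times> (c ` {..<length w})" using j by (simp add: elab_def)
qed

lemma map_prod_partial_inj:
  assumes f: "inj_on f A" and S: "S \<subseteq> A \<times> A"
  shows "partial_inj (map_prod f f ` S) \<longleftrightarrow> partial_inj S" "card (map_prod f f ` S) = card S"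
proof -
  have inj: "inj_on (map_prod f f) S"
    using map_prod_inj_on[OF f f] S by (rule inj_on_subset)
  then show "card (map_prod f f ` S) = card S" by (rule card_image)
  have "fst ` S \<subseteq> A" "snd ` S \<subseteq> A" using S by auto
  then have f1: "inj_on f (fst ` S)" "inj_on f (snd ` S)" using inj_on_subset[OF f] by blast+
  have "inj_on fst (map_prod f f ` S) \<longleftrightarrow> inj_on (f \<circ> fst) S"
    using comp_inj_on_iff[OF inj, of fst] by (simp add: fst_comp_map_prod)
  moreover have "inj_on (f \<circ> fst) S \<longleftrightarrow> inj_on fst S"
    using f1(1) by (metis comp_inj_on inj_on_imageI2)
  moreover have "inj_on snd (map_prod f f ` S) \<longleftrightarrow> inj_on (f \<circ> snd) S"
    using comp_inj_on_iff[OF inj, of snd] by (simp add: snd_comp_map_prod)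
  moreover have "inj_on (f \<circ> snd) S \<longleftrightarrow> inj_on snd S"
    using f1(2) by (metis comp_inj_on inj_on_imageI2)
  ultimately show "partial_inj (map_prod f f ` S) \<longleftrightarrow> partial_inj S" by (simp add: partial_inj_def)
qed

text \<open>A sheet assignment with coincidences exactly \<open>c\<close> is an injective assignment
  of sheets to the blocks, each represented by its first time.\<close>

lemma card_canon_fiber:
  assumes c: "c \<in> canonical k"
  shows "card {i \<in> {..<k} \<rightarrow>\<^sub>E {1..n}. canon k i = c} = (\<Prod>l\<in>{0..<card (c ` {..<k})}. n - l)"
proof -
  let ?L = "c ` {..<k}"
  have cj: "c j \<le> j" "c (c j) = c j" "c j < k" if "j < k" for j
    using c that by (auto simp: canonical_def)
  have "bij_betw (\<lambda>i. restrict i ?L) {i \<in> {..<k} \<rightarrow>\<^sub>E {1..n}. canon k i = c} {f \<in> ?L \<rightarrow>\<^sub>E {1..n}. inj_on f ?L}"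
  proof (rule bij_betwI[of _ _ _ "\<lambda>f. restrict (\<lambda>j. f (c j)) {..<k}"])
    show "(\<lambda>i. restrict i ?L) \<in> {i \<in> {..<k} \<rightarrow>\<^sub>E {1..n}. canon k i = c} \<rightarrow> {f \<in> ?L \<rightarrow>\<^sub>E {1..n}. inj_on f ?L}"
    proof
      fix i assume i: "i \<in> {i \<in> {..<k} \<rightarrow>\<^sub>E {1..n}. canon k i = c}"
      have "inj_on i ?L" using i inj_on_canon_labels[of i k] by auto
      then have "inj_on (restrict i ?L) ?L" by (simp add: inj_on_def)
      moreover have "restrict i ?L \<in> ?L \<rightarrow>\<^sub>E {1..n}" using i cj(3) by (auto simp: PiE_def Pi_def)
      ultimately show "restrict i ?L \<in> {f \<in> ?L \<rightarrow>\<^sub>E {1..n}. inj_on f ?L}" by simp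
    qed
    show "restrict (\<lambda>j. restrict i ?L (c j)) {..<k} = i" if i: "i \<in> {i \<in> {..<k} \<rightarrow>\<^sub>E {1..n}. canon k i = c}" for i
    proof
      fix j show "restrict (\<lambda>j. restrict i ?L (c j)) {..<k} j = i j"
      proof (cases "j < k")
        case True
        then show ?thesis using i canon_eq[OF True, of i] by simp
      next
        case False
        then show ?thesis using i by (auto simp: PiE_def extensional_def)
      qed
    qed
    have can: "canon k (restrict (\<lambda>j. f (c j)) {..<k}) = c" if inj: "inj_on f ?L" for f
    proof
      fix j
      let ?i = "restrict (\<lambda>j. f (c j)) {..<k}"
      show "canon k ?i j = c j"
      proof (cases "j < k")
        case True
        have "(LEAST m. ?i m = ?i j) = c j"
        proof (rule Least_equality)
          show "?i (c j) = ?i j" using cj[OF True] True by simp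
          fix m assume m: "?i m = ?i j"
          show "c j \<le> m"
          proof (cases "m < k")
            case mk: True
            then have "c m = c j" using m inj True by (auto dest: inj_onD)
            then show ?thesis using cj(1)[OF mk] by simp
          next
            case False
            then show ?thesis using cj(3)[OF True] by simp
          qed
        qed
        then show ?thesis using True by (simp add: canon_def)
      next
        case False
        then show ?thesis using c by (simp add: canon_def canonical_def PiE_def extensional_def)
      qed
    qed
    show "(\<lambda>f. restrict (\<lambda>j. f (c j)) {..<k}) \<in> {f \<in> ?L \<rightarrow>\<^sub>E {1..n}. inj_on f ?L} \<rightarrow> {i \<in> {..<k} \<rightarrow>\<^sub>E {1..n}. canon k i = c}"
      using can by (auto simp: PiE_def Pi_def)
    show "restrict (restrict (\<lambda>j. f (c j)) {..<k}) ?L = f" if f: "f \<in> {f \<in> ?L \<rightarrow>\<^sub>E {1..n}. inj_on f ?L}" for f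
    proof
      fix x show "restrict (restrict (\<lambda>j. f (c j)) {..<k}) ?L x = f x"
        using f cj by (cases "x \<in> ?L") (auto simp: PiE_def extensional_def)
    qed
  qed
  then have "card {i \<in> {..<k} \<rightarrow>\<^sub>E {1..n}. canon k i = c} = card {f \<in> ?L \<rightarrow>\<^sub>E {1..n}. inj_on f ?L}"
    by (rule bij_betw_same_card)
  also have "\<dots> = (\<Prod>l\<in>{0..<card ?L}. n - l)"
    using card_inj_on_subset_funcset[of ?L "{1..n}" ?L] by simp
  finally show ?thesis .
qed

definition edge_weight :: "nat \<Rightarrow> (nat \<times> nat) set \<Rightarrow> real" where
  "edge_weight n S = (if partial_inj S then fact (n - card S) / fact n else 0)"

text \<open>The weight depends on the sheets only through their coincidences, since partial
  injectivity and cardinality survive an injective relabelling.\<close>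

lemma sum_labels_canonical:
  assumes "length w = k"
  shows "(\<Sum>i\<in>{..<k} \<rightarrow>\<^sub>E {1..n}. \<Prod>e\<in>E. edge_weight n (pedges w i e))
    = (\<Sum>c\<in>canonical k. real (\<Prod>l\<in>{0..<card (c ` {..<k})}. n - l) * (\<Prod>e\<in>E. edge_weight n (pedges w c e)))"
proof -
  have "(\<Sum>i\<in>{..<k} \<rightarrow>\<^sub>E {1..n}. \<Prod>e\<in>E. edge_weight n (pedges w i e))
     = (\<Sum>c\<in>canonical k. \<Sum>i\<in>{i \<in> {..<k} \<rightarrow>\<^sub>E {1..n}. canon k i = c}. \<Prod>e\<in>E. edge_weight n (pedges w i e))"
    by (rule sum.group[symmetric]) (auto intro!: finite_PiE canon_canonical)
  also have "\<dots> = (\<Sum>c\<in>canonical k. \<Sum>i\<in>{i \<in> {..<k} \<rightarrow>\<^sub>E {1..n}. canon k i = c}. \<Prod>e\<in>E. edge_weight n (pedges w c e))"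
  proof (intro sum.cong prod.cong refl)
    fix c i e assume "i \<in> {i \<in> {..<k} \<rightarrow>\<^sub>E {1..n}. canon k i = c}"
    then have c: "canon k i = c" by simp
    have *: "pedges w c e \<subseteq> (canon k i ` {..<k}) \<times> (canon k i ` {..<k})"
      using pedges_subset[of w c e] by (simp add: assms c)
    show "edge_weight n (pedges w i e) = edge_weight n (pedges w c e)"
      unfolding edge_weight_def pedges_canon[OF assms, of i e] c
      using map_prod_partial_inj[OF inj_on_canon_labels *] by simp
  qed
  also have "\<dots> = (\<Sum>c\<in>canonical k. real (\<Prod>l\<in>{0..<card (c ` {..<k})}. n - l) * (\<Prod>e\<in>E. edge_weight n (pedges w c e)))"
    by (intro sum.cong refl) (simp only: sum_constant card_canon_fiber)
  finally show ?thesis .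
qed

text \<open>For \<open>a = 0\<close> and at 1/n this is the falling factorial of \<open>n\<close> of
  length \<open>b\<close>, divided by \<open>n ^ b\<close>. A positive \<open>a\<close> describes
  what remains after cancelling a shorter falling factorial.\<close>

definition falling_poly :: "nat \<Rightarrow> nat \<Rightarrow> real poly" where
  "falling_poly a b = (\<Prod>l\<in>{a..<b}. [:1, - real l:])"

lemma poly_falling_poly: "poly (falling_poly a b) x = (\<Prod>l\<in>{a..<b}. 1 - real l * x)"
  by (simp add: falling_poly_def poly_prod mult.commute)

lemma falling_poly_concat: "a \<le> b \<Longrightarrow> falling_poly 0 a * falling_poly a b = falling_poly 0 b"
  unfolding falling_poly_def by (rule prod.atLeastLessThan_concat) auto

lemma poly_falling_poly_0 [simp]: "poly (falling_poly a b) 0 = 1"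
  by (simp add: poly_falling_poly)

lemma degree_falling_poly: "degree (falling_poly a b) \<le> b - a"
proof -
  have "degree (falling_poly a b) \<le> (\<Sum>l\<in>{a..<b}. degree [:1, - real l:])"
    unfolding falling_poly_def using degree_prod_sum_le[of "{a..<b}" "\<lambda>l. [:1, - real l:]"] by (simp add: o_def)
  also have "\<dots> \<le> (\<Sum>l\<in>{a..<b}. 1)" by (intro sum_mono) auto
  finally show ?thesis by simp
qed

lemma poly_falling_poly_pos:
  assumes "b \<le> n" "n \<ge> 1"
  shows "poly (falling_poly a b) (1 / real n) > 0" "poly (falling_poly a b) (1 / real n) \<le> 1"
proof -
  show "poly (falling_poly a b) (1 / real n) > 0"
    unfolding poly_falling_poly using assms by (intro prod_pos) auto
  show "poly (falling_poly a b) (1 / real n) \<le> 1"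
    unfolding poly_falling_poly using assms by (intro prod_le_1) auto
qed

lemma falling_prod_conv_poly:
  assumes "a \<le> n" "n \<ge> 1"
  shows "real (\<Prod>l\<in>{0..<a}. n - l) = real n ^ a * poly (falling_poly 0 a) (1 / real n)"
proof -
  have "real (\<Prod>l\<in>{0..<a}. n - l) = (\<Prod>l\<in>{0..<a}. real n * (1 - real l * (1 / real n)))"
    unfolding of_nat_prod using assms by (intro prod.cong) (auto simp: of_nat_diff field_simps)
  also have "\<dots> = real n ^ a * poly (falling_poly 0 a) (1 / real n)"
    by (simp add: prod.distrib poly_falling_poly)
  finally show ?thesis .
qed

lemma fact_ratio_conv_poly:
  assumes "b \<le> n" "n \<ge> 1"
  shows "fact (n - b) / fact n = (1 / real n) ^ b / poly (falling_poly 0 b) (1 / real n)"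
proof -
  have "fact (n - b) * (\<Prod>l\<in>{0..<b}. n - l) = (fact n :: nat)"
    using assms(1)
  proof (induction b)
    case (Suc b)
    have "fact (n - b) = (n - b) * (fact (n - Suc b) :: nat)"
      using Suc.prems by (simp add: fact_reduce)
    then show ?case using Suc by (simp add: mult_ac)
  qed simp
  then have "fact (n - b) * real (\<Prod>l\<in>{0..<b}. n - l) = fact n"
    by (metis of_nat_fact of_nat_mult)
  then have "fact (n - b) * (real n ^ b * poly (falling_poly 0 b) (1 / real n)) = fact n"
    unfolding falling_prod_conv_poly[OF assms] .
  moreover have "real n ^ b * poly (falling_poly 0 b) (1 / real n) \<noteq> 0"
    using poly_falling_poly_pos[OF assms, of 0] assms by simp
  moreover have "fact (n - b) / (fact (n - b) * X) = 1 / X" for X :: real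
    by simp
  ultimately have "fact (n - b) / fact n = 1 / (real n ^ b * poly (falling_poly 0 b) (1 / real n))"
    by metis
  then show ?thesis by (simp add: power_one_over field_simps)
qed

section \<open>The expected number of closed walks as a rational function of 1/n\<close>

context regular_multigraph
begin

lemma finite_arcs [simp]: "finite (arcs G)"
  using fin by (simp add: fin_digraph_def fin_digraph_axioms_def)

lemma covering_graph_perm_family:
  assumes "\<sigma> \<in> set_pmf (perm_family (arcs G) n)"
  shows "covering_graph G d q n \<sigma>"
  by unfold_locales (use set_pmf_perm_family[OF finite_arcs assms] in auto)

definition expected_cyc_walks :: "nat \<Rightarrow> nat \<Rightarrow> real" where
  "expected_cyc_walks n k =
     measure_pmf.expectation (perm_family (arcs G) n) (\<lambda>\<sigma>. real (card (cyc_walks (covering G n \<sigma>) k)))"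

lemma expected_cyc_walks_eq:
  "expected_cyc_walks n k
    = (\<Sum>w\<in>cyc_walks G k. \<Sum>i\<in>{..<k} \<rightarrow>\<^sub>E {1..n}. \<Prod>e\<in>arcs G. edge_weight n (pedges w i e))"
proof -
  let ?M = "perm_family (arcs G) n"
  have int: "integrable (measure_pmf ?M) (f :: _ \<Rightarrow> real)" for f
    by (rule integrable_measure_pmf_finite[OF finite_set_pmf_perm_family[OF finite_arcs]])
  have "expected_cyc_walks n k = measure_pmf.expectation ?M
     (\<lambda>\<sigma>. \<Sum>w\<in>cyc_walks G k. \<Sum>i\<in>{..<k} \<rightarrow>\<^sub>E {1..n}. indicator {\<sigma>. compatible_labels (arcs G) \<sigma> w i} \<sigma>)"
    unfolding expected_cyc_walks_def
  proof (rule integral_cong_AE)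
    show "AE \<sigma> in measure_pmf ?M. real (card (cyc_walks (covering G n \<sigma>) k)) =
       (\<Sum>w\<in>cyc_walks G k. \<Sum>i\<in>{..<k} \<rightarrow>\<^sub>E {1..n}. indicator {\<sigma>. compatible_labels (arcs G) \<sigma> w i} \<sigma>)"
    proof (rule AE_pmfI)
      fix \<sigma> assume "\<sigma> \<in> set_pmf ?M"
      then interpret covering_graph G d q n \<sigma> by (rule covering_graph_perm_family)
      have fin: "finite ({..<k} \<rightarrow>\<^sub>E {1..n})" by (intro finite_PiE) auto
      show "real (card (cyc_walks (covering G n \<sigma>) k)) =
         (\<Sum>w\<in>cyc_walks G k. \<Sum>i\<in>{..<k} \<rightarrow>\<^sub>E {1..n}. indicator {\<sigma>. compatible_labels (arcs G) \<sigma> w i} \<sigma>)"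
        unfolding card_cyc_walks_cover of_nat_sum
        using fin by (intro sum.cong refl) (simp add: indicator_def sum_of_bool_eq Int_def)
    qed
  qed auto
  also have "\<dots> = (\<Sum>w\<in>cyc_walks G k. \<Sum>i\<in>{..<k} \<rightarrow>\<^sub>E {1..n}.
      measure_pmf.prob ?M {\<sigma>. compatible_labels (arcs G) \<sigma> w i})"
    by (simp add: Bochner_Integration.integral_sum int)
  also have "\<dots> = (\<Sum>w\<in>cyc_walks G k. \<Sum>i\<in>{..<k} \<rightarrow>\<^sub>E {1..n}. \<Prod>e\<in>arcs G. edge_weight n (pedges w i e))"
  proof (intro sum.cong refl)
    fix w i assume w: "w \<in> cyc_walks G k" and i: "i \<in> {..<k} \<rightarrow>\<^sub>E {1..n}"
    have "i ` {..<length w} \<subseteq> {1..n}" using w i by (auto simp: cyc_walks_def)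
    then have "pedges w i e \<subseteq> {1..n} \<times> {1..n}" for e
      using pedges_subset[of w i e] by blast
    then show "measure_pmf.prob ?M {\<sigma>. compatible_labels (arcs G) \<sigma> w i} = (\<Prod>e\<in>arcs G. edge_weight n (pedges w i e))"
      unfolding compatible_labels_def edge_weight_def by (intro prob_perm_family_extending) auto
  qed
  finally show ?thesis .
qed

lemma expected_cyc_walks_patterns:
  "expected_cyc_walks n k = (\<Sum>(w, c)\<in>patterns k. real (\<Prod>l\<in>{0..<card (c ` {..<k})}. n - l)
     * (\<Prod>e\<in>arcs G. fact (n - card (pedges w c e)) / fact n))"
proof -
  let ?f = "\<lambda>(w, c). real (\<Prod>l\<in>{0..<card (c ` {..<k})}. n - l) * (\<Prod>e\<in>arcs G. edge_weight n (pedges w c e))"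
  have "expected_cyc_walks n k = (\<Sum>w\<in>cyc_walks G k. \<Sum>c\<in>canonical k. ?f (w, c))"
    unfolding expected_cyc_walks_eq split
    by (intro sum.cong refl sum_labels_canonical) (simp add: cyc_walks_def)
  also have "\<dots> = (\<Sum>x\<in>cyc_walks G k \<times> canonical k. ?f x)"
    by (simp add: sum.cartesian_product)
  also have "\<dots> = (\<Sum>x\<in>patterns k. ?f x)"
  proof (rule sum.mono_neutral_right)
    show "\<forall>x\<in>cyc_walks G k \<times> canonical k - patterns k. ?f x = 0"
    proof
      fix x assume "x \<in> cyc_walks G k \<times> canonical k - patterns k"
      then obtain w c e where x: "x = (w, c)" "e \<in> arcs G" "\<not> partial_inj (pedges w c e)"
        by (auto simp: patterns_def)
      then have "(\<Prod>e\<in>arcs G. edge_weight n (pedges w c e)) = 0"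
        by (intro prod_zero bexI[of _ e]) (auto simp: edge_weight_def)
      then show "?f x = 0" by (simp add: x(1))
    qed
  qed (auto simp: patterns_def)
  also have "\<dots> = (\<Sum>(w, c)\<in>patterns k. real (\<Prod>l\<in>{0..<card (c ` {..<k})}. n - l)
     * (\<Prod>e\<in>arcs G. fact (n - card (pedges w c e)) / fact n))"
    by (intro sum.cong refl) (auto simp: patterns_def edge_weight_def intro!: prod.cong)
  finally show ?thesis .
qed

text \<open>The expected count times the common denominator
  \<open>falling_poly 0 K ^ card (arcs G)\<close>, as a polynomial in 1/n. Each edge cancels as many
  factors of the denominator as it has prescribed values, and the exponent of the monomial is minus
  the Euler characteristic. \<open>K\<close> bounds all lengths in use, so one denominator serves
  the whole expansion.\<close>

definition pattern_poly :: "nat \<Rightarrow> nat \<Rightarrow> real poly" where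
  "pattern_poly K k = (\<Sum>(w, c)\<in>patterns k.
     Polynomial.monom 1 ((\<Sum>e\<in>arcs G. card (pedges w c e)) - card (c ` {..<k}))
      * falling_poly 0 (card (c ` {..<k})) * (\<Prod>e\<in>arcs G. falling_poly (card (pedges w c e)) K))"

lemma pattern_facts:
  assumes "(w, c) \<in> patterns k" "1 \<le> k"
  shows "card (c ` {..<k}) \<le> (\<Sum>e\<in>arcs G. card (pedges w c e))" "card (pedges w c e) \<le> k" "card (c ` {..<k}) \<le> k"
  using assms card_labels_le_pedges(1)[of w k c] card_pedges_le[of w c e] card_image_le[of "{..<k}" c]
  by (auto simp: patterns_def cyc_walks_def)

lemma poly_pattern_poly:
  assumes k: "1 \<le> k" "k \<le> K" and n: "K \<le> n"
  shows "poly (pattern_poly K k) (1 / real n)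
    = poly (falling_poly 0 K) (1 / real n) ^ card (arcs G) * expected_cyc_walks n k"
proof -
  define x where "x = 1 / real n"
  have n1: "n \<ge> 1" using assms by simp
  then have nx: "real n * x = 1" by (simp add: x_def)
  have summand: "x ^ ((\<Sum>e\<in>arcs G. card (pedges w c e)) - card (c ` {..<k})) * poly (falling_poly 0 (card (c ` {..<k}))) x
      * (\<Prod>e\<in>arcs G. poly (falling_poly (card (pedges w c e)) K) x)
     = poly (falling_poly 0 K) x ^ card (arcs G) * (real (\<Prod>l\<in>{0..<card (c ` {..<k})}. n - l)
     * (\<Prod>e\<in>arcs G. fact (n - card (pedges w c e)) / fact n))" if wc: "(w, c) \<in> patterns k" for w c
  proof -
    define a where "a = card (c ` {..<k})"
    define b where "b e = card (pedges w c e)" for e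
    note facts = pattern_facts[OF wc k(1), folded a_def b_def]
    have bK: "b e \<le> K" "b e \<le> n" for e using facts(2)[of e] k n by auto
    have "poly (falling_poly 0 K) x ^ card (arcs G) * (real (\<Prod>l\<in>{0..<a}. n - l) * (\<Prod>e\<in>arcs G. fact (n - b e) / fact n))
      = real n ^ a * poly (falling_poly 0 a) x * (\<Prod>e\<in>arcs G. poly (falling_poly 0 K) x * (fact (n - b e) / fact n))"
    proof -
      have "a \<le> n" using facts(3) k n by simp
      then show ?thesis
        unfolding x_def falling_prod_conv_poly[OF \<open>a \<le> n\<close> n1] prod.distrib prod_constant by (simp only: mult_ac)
    qed
    also have "(\<Prod>e\<in>arcs G. poly (falling_poly 0 K) x * (fact (n - b e) / fact n))
      = (\<Prod>e\<in>arcs G. x ^ b e * poly (falling_poly (b e) K) x)"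
    proof (intro prod.cong refl)
      fix e
      have "poly (falling_poly 0 K) x = poly (falling_poly 0 (b e)) x * poly (falling_poly (b e) K) x"
        using falling_poly_concat[OF bK(1)[of e]] by (metis poly_mult)
      then show "poly (falling_poly 0 K) x * (fact (n - b e) / fact n) = x ^ b e * poly (falling_poly (b e) K) x"
        unfolding fact_ratio_conv_poly[OF bK(2)[of e] n1] x_def
        using poly_falling_poly_pos[OF bK(2)[of e] n1, of 0] by simp
    qed
    also have "\<dots> = x ^ (\<Sum>e\<in>arcs G. b e) * (\<Prod>e\<in>arcs G. poly (falling_poly (b e) K) x)"
      by (simp add: prod.distrib power_sum)
    also have "x ^ (\<Sum>e\<in>arcs G. b e) = x ^ a * x ^ ((\<Sum>e\<in>arcs G. b e) - a)"
      using facts(1) by (simp flip: power_add)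
    also have "real n ^ a * poly (falling_poly 0 a) x * (x ^ a * x ^ ((\<Sum>e\<in>arcs G. b e) - a) * (\<Prod>e\<in>arcs G. poly (falling_poly (b e) K) x))
      = (real n * x) ^ a * (x ^ ((\<Sum>e\<in>arcs G. b e) - a) * poly (falling_poly 0 a) x * (\<Prod>e\<in>arcs G. poly (falling_poly (b e) K) x))"
      by (simp add: power_mult_distrib mult_ac)
    finally show ?thesis unfolding nx a_def b_def by simp
  qed
  have "poly (pattern_poly K k) x = (\<Sum>(w, c)\<in>patterns k.
      x ^ ((\<Sum>e\<in>arcs G. card (pedges w c e)) - card (c ` {..<k})) * poly (falling_poly 0 (card (c ` {..<k}))) x
      * (\<Prod>e\<in>arcs G. poly (falling_poly (card (pedges w c e)) K) x))"
    unfolding pattern_poly_def poly_sum by (intro sum.cong refl) (auto simp: poly_monom poly_prod)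
  also have "\<dots> = (\<Sum>(w, c)\<in>patterns k. poly (falling_poly 0 K) x ^ card (arcs G) * (real (\<Prod>l\<in>{0..<card (c ` {..<k})}. n - l)
     * (\<Prod>e\<in>arcs G. fact (n - card (pedges w c e)) / fact n)))"
    using summand by (intro sum.cong refl) auto
  also have "\<dots> = poly (falling_poly 0 K) x ^ card (arcs G) * expected_cyc_walks n k"
    unfolding expected_cyc_walks_patterns sum_distrib_left by (simp add: case_prod_beta)
  finally show ?thesis by (simp add: x_def)
qed

text \<open>The monomial and the numerator together have at most the degree that the denominator
  loses by cancellation, namely the number of edges of the quotient graph.\<close>

lemma degree_pattern_poly:
  assumes "1 \<le> k" "k \<le> K"
  shows "degree (pattern_poly K k) \<le> card (arcs G) * K"
  unfolding pattern_poly_def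
proof (rule degree_sum_le)
  fix x assume x: "x \<in> patterns k"
  obtain w c where wc: "x = (w, c)" by fastforce
  define a where "a = card (c ` {..<k})"
  define b where "b e = card (pedges w c e)" for e
  note facts = pattern_facts[OF x[unfolded wc] assms(1), folded a_def b_def]
  have "degree (Polynomial.monom (1 :: real) ((\<Sum>e\<in>arcs G. b e) - a) * falling_poly 0 a * (\<Prod>e\<in>arcs G. falling_poly (b e) K))
     \<le> ((\<Sum>e\<in>arcs G. b e) - a) + a + (\<Sum>e\<in>arcs G. K - b e)"
  proof (intro order_trans[OF degree_mult_le] add_mono degree_monom_le)
    show "degree (falling_poly 0 a) \<le> a" using degree_falling_poly[of 0 a] by simp
    have "degree (\<Prod>e\<in>arcs G. falling_poly (b e) K) \<le> (\<Sum>e\<in>arcs G. degree (falling_poly (b e) K))"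
      using degree_prod_sum_le[of "arcs G" "\<lambda>e. falling_poly (b e) K"] by (simp add: o_def)
    also have "\<dots> \<le> (\<Sum>e\<in>arcs G. K - b e)" by (intro sum_mono degree_falling_poly)
    finally show "degree (\<Prod>e\<in>arcs G. falling_poly (b e) K) \<le> (\<Sum>e\<in>arcs G. K - b e)" .
  qed
  also have "\<dots> = (\<Sum>e\<in>arcs G. b e + (K - b e))" using facts(1) by (simp add: sum.distrib)
  also have "\<dots> = (\<Sum>e\<in>arcs G. K)" using facts(2) assms by (intro sum.cong refl) (meson le_add_diff_inverse le_trans)
  finally show "degree (case x of (w, c) \<Rightarrow> Polynomial.monom (1 :: real) ((\<Sum>e\<in>arcs G. card (pedges w c e)) - card (c ` {..<k}))
      * falling_poly 0 (card (c ` {..<k})) * (\<Prod>e\<in>arcs G. falling_poly (card (pedges w c e)) K)) \<le> card (arcs G) * K"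
    by (simp add: wc a_def b_def)
qed simp

text \<open>At 0 all falling polynomials are 1, and the monomial vanishes unless its exponent
  does.\<close>

lemma pattern_poly_0:
  assumes "1 \<le> k"
  shows "poly (pattern_poly K k) 0 = real (card (tight_patterns k))"
proof -
  have "poly (pattern_poly K k) 0 = (\<Sum>x\<in>patterns k. if x \<in> tight_patterns k then 1 else 0)"
    unfolding pattern_poly_def poly_sum
  proof (intro sum.cong refl)
    fix x assume x: "x \<in> patterns k"
    obtain w c where wc: "x = (w, c)" by fastforce
    show "poly (case x of (w, c) \<Rightarrow> Polynomial.monom (1 :: real) ((\<Sum>e\<in>arcs G. card (pedges w c e)) - card (c ` {..<k}))
      * falling_poly 0 (card (c ` {..<k})) * (\<Prod>e\<in>arcs G. falling_poly (card (pedges w c e)) K)) 0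
      = (if x \<in> tight_patterns k then 1 else 0)"
      using pattern_facts(1)[OF x[unfolded wc] assms] x
      by (auto simp: wc tight_patterns_def poly_monom poly_prod power_0_left)
  qed
  also have "\<dots> = real (card (tight_patterns k))"
    by (simp add: sum.If_cases tight_patterns_def Int_def case_prod_beta)
       (intro arg_cong[where f = card] Collect_cong, auto)
  finally show ?thesis .
qed

end

section \<open>The spectral radius of the regular tree\<close>

text \<open>Square summability with an explicit norm bound, tested on finite sets, so that Schur's
  test and the limit of the Neumann series only involve finite sums.\<close>

definition ell2_bounded :: "'a set \<Rightarrow> ('a \<Rightarrow> complex) \<Rightarrow> real \<Rightarrow> bool" where
  "ell2_bounded V f C \<longleftrightarrow> (\<forall>x. x \<notin> V \<longrightarrow> f x = 0) \<and>
     (\<forall>F. finite F \<and> F \<subseteq> V \<longrightarrow> L2_set (\<lambda>x. cmod (f x)) F \<le> C)"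

lemma ell2_boundedD:
  "ell2_bounded V f C \<Longrightarrow> x \<notin> V \<Longrightarrow> f x = 0"
  "ell2_bounded V f C \<Longrightarrow> finite F \<Longrightarrow> F \<subseteq> V \<Longrightarrow> L2_set (\<lambda>x. cmod (f x)) F \<le> C"
  by (auto simp: ell2_bounded_def)

lemma ell2_bounded_nonneg: "ell2_bounded V f C \<Longrightarrow> C \<ge> 0"
  using ell2_boundedD(2)[of V f C "{}"] by simp

lemma ell2_bounded_imp:
  assumes "ell2_bounded V f C"
  shows "f \<in> ell2 V" "ell2_norm V f \<le> C"
proof -
  have C: "C \<ge> 0" by (rule ell2_bounded_nonneg[OF assms])
  have le: "(\<Sum>x\<in>F. (cmod (f x))\<^sup>2) \<le> C\<^sup>2" if "finite F" "F \<subseteq> V" for F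
    using ell2_boundedD(2)[OF assms that] C unfolding L2_set_def by (metis real_sqrt_le_iff real_sqrt_abs abs_of_nonneg)
  have sum: "(\<lambda>x. (cmod (f x))\<^sup>2) summable_on V"
    by (rule nonneg_bdd_above_summable_on) (auto intro!: bdd_aboveI2 le)
  then show "f \<in> ell2 V" using assms by (auto simp: ell2_def ell2_bounded_def)
  have "(\<Sum>\<^sub>\<infinity>x\<in>V. (cmod (f x))\<^sup>2) \<le> C\<^sup>2"
    by (rule infsum_le_finite_sums[OF sum]) (use le in auto)
  then show "ell2_norm V f \<le> C"
    unfolding ell2_norm_def using C by (metis real_sqrt_le_iff real_sqrt_abs abs_of_nonneg)
qed

lemma ell2_bounded_ell2_norm:
  assumes "f \<in> ell2 V"
  shows "ell2_bounded V f (ell2_norm V f)"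
proof -
  have "L2_set (\<lambda>x. cmod (f x)) F \<le> ell2_norm V f" if "finite F" "F \<subseteq> V" for F
    unfolding L2_set_def ell2_norm_def
    using assms that by (intro real_sqrt_le_mono finite_sum_le_infsum) (auto simp: ell2_def)
  then show ?thesis using assms by (auto simp: ell2_bounded_def ell2_def)
qed

lemma ell2_bounded_pointwise:
  assumes "ell2_bounded V f C"
  shows "cmod (f x) \<le> C"
proof (cases "x \<in> V")
  case True
  then show ?thesis using ell2_boundedD(2)[OF assms, of "{x}"] by simp
next
  case False
  then show ?thesis using ell2_boundedD(1)[OF assms] ell2_bounded_nonneg[OF assms] by simp
qed

text \<open>The weight is a positive supersolution for the adjacency operator. It bounds the
  operator norm by \<open>lam\<close> even when it is not square summable, as will be the case on
  the tree.\<close>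

locale weighted_graph =
  fixes V :: "'a set" and N :: "'a \<Rightarrow> 'a set" and w :: "'a \<Rightarrow> real" and lam :: real
  assumes finite_N: "\<And>x. x \<in> V \<Longrightarrow> finite (N x)" and N_subset: "\<And>x. x \<in> V \<Longrightarrow> N x \<subseteq> V"
    and N_sym: "\<And>x y. x \<in> V \<Longrightarrow> y \<in> V \<Longrightarrow> y \<in> N x \<Longrightarrow> x \<in> N y"
    and w_pos: "\<And>x. x \<in> V \<Longrightarrow> w x > 0" and w_sum: "\<And>x. x \<in> V \<Longrightarrow> (\<Sum>y\<in>N x. w y) \<le> lam * w x"
    and lam_nonneg: "lam \<ge> 0"
begin

definition A :: "('a \<Rightarrow> complex) \<Rightarrow> 'a \<Rightarrow> complex" where
  "A f x = (if x \<in> V then \<Sum>y\<in>N x. f y else 0)"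

lemma A_diff_scale: "A (\<lambda>x. f x - z * g x) = (\<lambda>x. A f x - z * A g x)"
  by (auto simp: A_def sum_subtractf sum_distrib_left)

lemma A_add: "A (\<lambda>x. f x + g x) = (\<lambda>x. A f x + A g x)"
  by (auto simp: A_def sum.distrib)

lemma A_scale: "A (\<lambda>x. c * f x) = (\<lambda>x. c * A f x)"
  by (auto simp: A_def sum_distrib_left)

text \<open>Schur's test with the weight \<open>w\<close>.\<close>

lemma A_bounded:
  assumes "ell2_bounded V f C"
  shows "ell2_bounded V (A f) (lam * C)"
proof -
  have C: "C \<ge> 0" by (rule ell2_bounded_nonneg[OF assms])
  have "L2_set (\<lambda>x. cmod (A f x)) F \<le> lam * C" if F: "finite F" "F \<subseteq> V" for F
  proof -
    define F' where "F' = (\<Union>x\<in>F. N x)"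
    have F': "finite F'" "F' \<subseteq> V" using F finite_N N_subset by (auto simp: F'_def)
    have pt: "(cmod (A f x))\<^sup>2 \<le> lam * (\<Sum>y\<in>N x. w x * ((cmod (f y))\<^sup>2 / w y))" if x: "x \<in> F" for x
    proof -
      have xV: "x \<in> V" using x F by auto
      have pos: "w y > 0" if "y \<in> N x" for y using N_subset[OF xV] that w_pos by auto
      have "cmod (A f x) \<le> (\<Sum>y\<in>N x. cmod (f y))"
        using xV by (simp add: A_def norm_sum)
      also have "\<dots> = (\<Sum>y\<in>N x. sqrt (w y) * (cmod (f y) / sqrt (w y)))"
        using less_imp_neq[OF pos] by (intro sum.cong) auto
      finally have "(cmod (A f x))\<^sup>2 \<le> (\<Sum>y\<in>N x. sqrt (w y) * (cmod (f y) / sqrt (w y)))\<^sup>2"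
        by (rule power_mono) simp
      also have "\<dots> \<le> (\<Sum>y\<in>N x. (sqrt (w y))\<^sup>2) * (\<Sum>y\<in>N x. (cmod (f y) / sqrt (w y))\<^sup>2)"
        by (rule Cauchy_Schwarz_ineq_sum)
      also have "\<dots> = (\<Sum>y\<in>N x. w y) * (\<Sum>y\<in>N x. (cmod (f y))\<^sup>2 / w y)"
        using pos by (intro arg_cong2[where f = "(*)"] sum.cong refl) (auto simp: power_divide less_imp_le)
      also have "\<dots> \<le> (lam * w x) * (\<Sum>y\<in>N x. (cmod (f y))\<^sup>2 / w y)"
        using pos by (intro mult_right_mono w_sum xV sum_nonneg) (auto intro!: divide_nonneg_pos)
      finally show ?thesis by (simp add: sum_distrib_left mult.assoc)
    qed
    have "(\<Sum>x\<in>F. (cmod (A f x))\<^sup>2) \<le> (\<Sum>x\<in>F. lam * (\<Sum>y\<in>N x. w x * ((cmod (f y))\<^sup>2 / w y)))"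
      by (rule sum_mono) (rule pt)
    also have "\<dots> = lam * (\<Sum>x\<in>F. \<Sum>y\<in>F'. if y \<in> N x then w x * ((cmod (f y))\<^sup>2 / w y) else 0)"
    proof -
      have "(\<Sum>y\<in>N x. w x * ((cmod (f y))\<^sup>2 / w y)) = (\<Sum>y\<in>F'. if y \<in> N x then w x * ((cmod (f y))\<^sup>2 / w y) else 0)"
        if "x \<in> F" for x
        using F' that by (intro sum.mono_neutral_cong_left) (auto simp: F'_def)
      then show ?thesis by (simp add: sum_distrib_left)
    qed
    also have "\<dots> = lam * (\<Sum>y\<in>F'. \<Sum>x\<in>F. if y \<in> N x then w x * ((cmod (f y))\<^sup>2 / w y) else 0)"
      by (subst sum.swap) (rule refl)
    also have "\<dots> \<le> lam * (\<Sum>y\<in>F'. lam * (cmod (f y))\<^sup>2)"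
    proof (intro mult_left_mono sum_mono lam_nonneg)
      fix y assume "y \<in> F'"
      then have yV: "y \<in> V" using F' by auto
      have "(\<Sum>x\<in>F. if y \<in> N x then w x * c else 0) = (\<Sum>x\<in>{x \<in> F. y \<in> N x}. w x) * c" for c
        using F by (simp add: sum.If_cases Int_def sum_distrib_right)
      then have "(\<Sum>x\<in>F. if y \<in> N x then w x * ((cmod (f y))\<^sup>2 / w y) else 0)
          = (\<Sum>x\<in>{x \<in> F. y \<in> N x}. w x) * ((cmod (f y))\<^sup>2 / w y)" .
      also have "\<dots> \<le> (\<Sum>x\<in>N y. w x) * ((cmod (f y))\<^sup>2 / w y)"
      proof (intro mult_right_mono sum_mono2)
        show "{x \<in> F. y \<in> N x} \<subseteq> N y" using N_sym F yV by auto
        show "0 \<le> w x" if "x \<in> N y - {x \<in> F. y \<in> N x}" for x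
          using that N_subset[OF yV] w_pos by (auto intro: less_imp_le)
      qed (use finite_N[OF yV] w_pos[OF yV] in auto)
      also have "\<dots> \<le> (lam * w y) * ((cmod (f y))\<^sup>2 / w y)"
        using w_sum[OF yV] w_pos[OF yV] by (intro mult_right_mono) auto
      also have "\<dots> = lam * (cmod (f y))\<^sup>2" using w_pos[OF yV] by simp
      finally show "(\<Sum>x\<in>F. if y \<in> N x then w x * ((cmod (f y))\<^sup>2 / w y) else 0) \<le> lam * (cmod (f y))\<^sup>2" .
    qed
    also have "\<dots> = lam\<^sup>2 * (\<Sum>y\<in>F'. (cmod (f y))\<^sup>2)"
      by (simp add: sum_distrib_left power2_eq_square mult.assoc)
    finally have "L2_set (\<lambda>x. cmod (A f x)) F \<le> sqrt (lam\<^sup>2 * (\<Sum>y\<in>F'. (cmod (f y))\<^sup>2))"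
      unfolding L2_set_def by simp
    also have "\<dots> = lam * L2_set (\<lambda>x. cmod (f x)) F'"
      using lam_nonneg by (simp add: real_sqrt_mult L2_set_def)
    also have "\<dots> \<le> lam * C"
      by (intro mult_left_mono ell2_boundedD(2)[OF assms] F' lam_nonneg)
    finally show ?thesis .
  qed
  then show ?thesis by (auto simp: ell2_bounded_def A_def)
qed

lemma funpow_A_bounded: "ell2_bounded V f C \<Longrightarrow> ell2_bounded V ((A ^^ k) f) (lam ^ k * C)"
proof (induction k)
  case (Suc k)
  then show ?case using A_bounded[of "(A ^^ k) f"] by (simp add: mult.assoc)
qed simp

lemma funpow_A_linear:
  "(A ^^ k) (\<lambda>x. f x + g x) = (\<lambda>x. (A ^^ k) f x + (A ^^ k) g x)"
  "(A ^^ k) (\<lambda>x. c * f x) = (\<lambda>x. c * (A ^^ k) f x)"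
  "(A ^^ k) (\<lambda>x. f x - z * g x) = (\<lambda>x. (A ^^ k) f x - z * (A ^^ k) g x)"
  by (induction k) (simp_all add: A_add A_scale A_diff_scale)

context
  fixes z :: complex
  assumes z: "cmod z > lam"
begin

lemma z0: "z \<noteq> 0" using z lam_nonneg by auto

lemma neumann_term_bound:
  assumes "ell2_bounded V f C"
  shows "cmod ((1 / z) ^ Suc k * (A ^^ k) f x) \<le> (1 / cmod z) * (lam / cmod z) ^ k * C"
proof -
  have "cmod ((1 / z) ^ Suc k * (A ^^ k) f x) \<le> (1 / cmod z) ^ Suc k * (lam ^ k * C)"
    unfolding norm_mult norm_power norm_divide norm_one
    by (intro mult_left_mono ell2_bounded_pointwise[OF funpow_A_bounded[OF assms]]) simp
  then show ?thesis by (simp add: power_divide mult_ac)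
qed

lemma ratio: "0 \<le> lam / cmod z" "lam / cmod z < 1"
  using z lam_nonneg by (auto simp: divide_less_eq)

lemma neumann_summable:
  assumes "ell2_bounded V f C"
  shows "summable (\<lambda>k. (1 / z) ^ Suc k * (A ^^ k) f x)"
proof (rule summable_comparison_test')
  show "summable (\<lambda>k. (1 / cmod z) * (lam / cmod z) ^ k * C)"
    using ratio by (intro summable_mult2 summable_mult summable_geometric) auto
qed (rule neumann_term_bound[OF assms])

text \<open>The Neumann series for the inverse of \<open>A - z\<close>; the sign comes from the
  order of subtraction in \<open>op_spectrum\<close>.\<close>

definition resolvent :: "('a \<Rightarrow> complex) \<Rightarrow> 'a \<Rightarrow> complex" where
  "resolvent f x = - (\<Sum>k. (1 / z) ^ Suc k * (A ^^ k) f x)"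

lemma resolvent_bounded:
  assumes f: "ell2_bounded V f C"
  shows "ell2_bounded V (resolvent f) (1 / (cmod z - lam) * C)"
proof -
  have C: "C \<ge> 0" by (rule ell2_bounded_nonneg[OF f])
  have zero: "(A ^^ k) f x = 0" if "x \<notin> V" for k x
    using ell2_boundedD(1)[OF funpow_A_bounded[OF f] that] .
  have part: "L2_set (\<lambda>x. cmod (\<Sum>k<m. (1 / z) ^ Suc k * (A ^^ k) f x)) F \<le> (\<Sum>k<m. (1 / cmod z) * (lam / cmod z) ^ k * C)"
    if F: "finite F" "F \<subseteq> V" for F m
  proof (induction m)
    case (Suc m)
    have "L2_set (\<lambda>x. cmod (\<Sum>k<Suc m. (1 / z) ^ Suc k * (A ^^ k) f x)) F
      \<le> L2_set (\<lambda>x. cmod (\<Sum>k<m. (1 / z) ^ Suc k * (A ^^ k) f x) + cmod ((1 / z) ^ Suc m * (A ^^ m) f x)) F"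
      by (intro L2_set_mono) (auto intro: norm_triangle_ineq)
    also have "\<dots> \<le> L2_set (\<lambda>x. cmod (\<Sum>k<m. (1 / z) ^ Suc k * (A ^^ k) f x)) F + L2_set (\<lambda>x. cmod ((1 / z) ^ Suc m * (A ^^ m) f x)) F"
      by (rule L2_set_triangle_ineq)
    also have "L2_set (\<lambda>x. cmod ((1 / z) ^ Suc m * (A ^^ m) f x)) F = (1 / cmod z) ^ Suc m * L2_set (\<lambda>x. cmod ((A ^^ m) f x)) F"
      unfolding norm_mult norm_power norm_divide norm_one by (rule L2_set_right_distrib[symmetric]) simp
    also have "\<dots> \<le> (1 / cmod z) ^ Suc m * (lam ^ m * C)"
      by (intro mult_left_mono ell2_boundedD(2)[OF funpow_A_bounded[OF f]] F) auto
    also have "\<dots> = (1 / cmod z) * (lam / cmod z) ^ m * C" by (simp add: power_divide mult_ac)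
    finally show ?case using Suc by simp
  qed (simp add: L2_set_def)
  have geo: "(\<Sum>k<m. (1 / cmod z) * (lam / cmod z) ^ k * C) \<le> 1 / (cmod z - lam) * C" for m
  proof -
    have "(\<Sum>k<m. (1 / cmod z) * (lam / cmod z) ^ k * C) = (1 / cmod z) * C * (\<Sum>k<m. (lam / cmod z) ^ k)"
      by (simp add: sum_distrib_left mult_ac)
    also have "\<dots> \<le> (1 / cmod z) * C * (1 / (1 - lam / cmod z))"
    proof (intro mult_left_mono)
      have "(\<Sum>k<m. (lam / cmod z) ^ k) \<le> (\<Sum>k. (lam / cmod z) ^ k)"
        using ratio by (intro sum_le_suminf summable_geometric) auto
      then show "(\<Sum>k<m. (lam / cmod z) ^ k) \<le> 1 / (1 - lam / cmod z)"
        using ratio by (simp add: suminf_geometric)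
    qed (use C in auto)
    also have "\<dots> = 1 / (cmod z - lam) * C"
    proof -
      have "cmod z > 0" using z lam_nonneg by linarith
      then show ?thesis using z by (simp add: field_simps)
    qed
    finally show ?thesis .
  qed
  have "L2_set (\<lambda>x. cmod (resolvent f x)) F \<le> 1 / (cmod z - lam) * C" if F: "finite F" "F \<subseteq> V" for F
  \<comment> \<open>On a finite set pointwise convergence suffices for the norm bound of the partial
    sums to pass to the limit.\<close>
  proof (rule LIMSEQ_le_const2)
    have lim: "(\<lambda>m. \<Sum>k<m. (1 / z) ^ Suc k * (A ^^ k) f x) \<longlonglongrightarrow> (\<Sum>k. (1 / z) ^ Suc k * (A ^^ k) f x)" for x
      by (rule summable_LIMSEQ[OF neumann_summable[OF f]])
    have "(\<lambda>m. L2_set (\<lambda>x. cmod (\<Sum>k<m. (1 / z) ^ Suc k * (A ^^ k) f x)) F)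
       \<longlonglongrightarrow> L2_set (\<lambda>x. cmod (\<Sum>k. (1 / z) ^ Suc k * (A ^^ k) f x)) F"
      unfolding L2_set_def by (intro tendsto_intros lim)
    then show "(\<lambda>m. L2_set (\<lambda>x. cmod (\<Sum>k<m. (1 / z) ^ Suc k * (A ^^ k) f x)) F) \<longlonglongrightarrow> L2_set (\<lambda>x. cmod (resolvent f x)) F"
      by (simp add: resolvent_def)
    show "\<exists>N. \<forall>m\<ge>N. L2_set (\<lambda>x. cmod (\<Sum>k<m. (1 / z) ^ Suc k * (A ^^ k) f x)) F \<le> 1 / (cmod z - lam) * C"
      using part[OF F] geo by (intro exI[of _ 0] allI impI) (rule order_trans)
  qed
  then show ?thesis by (auto simp: ell2_bounded_def resolvent_def zero)
qed

text \<open>Under \<open>A - z\<close> the Neumann series telescopes, and its boundary terms tend to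
  0 because the series itself converges.\<close>

lemma telescope:
  assumes f: "ell2_bounded V f C"
  shows "(\<Sum>k. (1 / z) ^ Suc k * ((A ^^ Suc k) f x - z * (A ^^ k) f x)) = - f x"
proof -
  define a where "a k = (1 / z) ^ k * (A ^^ k) f x" for k
  have "summable (\<lambda>k. z * ((1 / z) ^ Suc k * (A ^^ k) f x))"
    by (intro summable_mult neumann_summable[OF f])
  moreover have "(\<lambda>k. z * ((1 / z) ^ Suc k * (A ^^ k) f x)) = a"
    using z0 by (auto simp: a_def fun_eq_iff)
  ultimately have "a \<longlonglongrightarrow> 0" by (intro summable_LIMSEQ_zero) simp
  from telescope_sums[OF this] have "(\<lambda>k. a (Suc k) - a k) sums (0 - a 0)" .
  moreover have "a (Suc k) - a k = (1 / z) ^ Suc k * ((A ^^ Suc k) f x - z * (A ^^ k) f x)" for k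
    using z0 by (simp add: a_def field_simps)
  ultimately show ?thesis by (simp add: sums_iff a_def)
qed

lemma resolvent_left:
  assumes f: "ell2_bounded V f C"
  shows "resolvent (\<lambda>x. A f x - z * f x) = f"
proof
  fix x
  have "(A ^^ k) (\<lambda>x. A f x - z * f x) x = (A ^^ Suc k) f x - z * (A ^^ k) f x" for k
    unfolding funpow_A_linear(3) by (simp add: funpow_swap1)
  then show "resolvent (\<lambda>x. A f x - z * f x) x = f x"
    unfolding resolvent_def by (simp only: telescope[OF f] minus_minus)
qed

lemma resolvent_right:
  assumes f: "ell2_bounded V f C"
  shows "(\<lambda>x. A (resolvent f) x - z * resolvent f x) = f"
proof
  fix x
  show "A (resolvent f) x - z * resolvent f x = f x"
  proof (cases "x \<in> V")
    case True
    have s1: "summable (\<lambda>k. (1 / z) ^ Suc k * (A ^^ Suc k) f x)"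
    proof -
      have "summable (\<lambda>k. z * ((1 / z) ^ Suc (Suc k) * (A ^^ Suc k) f x))"
        using neumann_summable[OF f, of x] by (intro summable_mult) (subst summable_Suc_iff)
      then show ?thesis using z0 by (simp add: field_simps)
    qed
    have s2: "summable (\<lambda>k. z * ((1 / z) ^ Suc k * (A ^^ k) f x))"
      by (intro summable_mult neumann_summable[OF f])
    have "A (resolvent f) x = - (\<Sum>y\<in>N x. \<Sum>k. (1 / z) ^ Suc k * (A ^^ k) f y)"
      using True by (simp add: A_def resolvent_def sum_negf)
    also have "(\<Sum>y\<in>N x. \<Sum>k. (1 / z) ^ Suc k * (A ^^ k) f y) = (\<Sum>k. \<Sum>y\<in>N x. (1 / z) ^ Suc k * (A ^^ k) f y)"
      by (rule suminf_sum[symmetric]) (rule neumann_summable[OF f])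
    also have "(\<lambda>k. \<Sum>y\<in>N x. (1 / z) ^ Suc k * (A ^^ k) f y) = (\<lambda>k. (1 / z) ^ Suc k * (A ^^ Suc k) f x)"
      by (simp only: funpow.simps o_apply A_def if_True sum_distrib_left True)
    finally have 1: "A (resolvent f) x = - (\<Sum>k. (1 / z) ^ Suc k * (A ^^ Suc k) f x)" .
    have 2: "z * resolvent f x = - (\<Sum>k. z * ((1 / z) ^ Suc k * (A ^^ k) f x))"
      unfolding resolvent_def by (simp only: mult_minus_right suminf_mult[OF neumann_summable[OF f]])
    have "- a - - b = - (a - b)" for a b :: complex by simp
    then have "A (resolvent f) x - z * resolvent f x
      = - ((\<Sum>k. (1 / z) ^ Suc k * (A ^^ Suc k) f x) - (\<Sum>k. z * ((1 / z) ^ Suc k * (A ^^ k) f x)))"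
      unfolding 1 2 .
    also have "\<dots> = - (\<Sum>k. (1 / z) ^ Suc k * ((A ^^ Suc k) f x - z * (A ^^ k) f x))"
      by (subst suminf_diff[OF s1 s2]) (simp add: algebra_simps)
    finally show ?thesis by (simp only: telescope[OF f] minus_minus)
  next
    case False
    then show ?thesis
      using ell2_boundedD(1)[OF f False] ell2_boundedD(1)[OF resolvent_bounded[OF f] False]
      by (simp add: A_def)
  qed
qed

lemma not_in_op_spectrum: "z \<notin> op_spectrum V A"
proof -
  note b = ell2_bounded_ell2_norm
  have "bounded_op V resolvent"
    unfolding bounded_op_def
  proof (intro conjI ballI allI exI)
    fix f assume f: "f \<in> ell2 V"
    show "resolvent f \<in> ell2 V" "ell2_norm V (resolvent f) \<le> 1 / (cmod z - lam) * ell2_norm V f"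
      using ell2_bounded_imp[OF resolvent_bounded[OF b[OF f]]] by auto
    show "resolvent (\<lambda>x. c * f x) = (\<lambda>x. c * resolvent f x)" for c
    proof
      fix x
      show "resolvent (\<lambda>x. c * f x) x = c * resolvent f x"
        unfolding resolvent_def funpow_A_linear(2)
        using suminf_mult[OF neumann_summable[OF b[OF f], of x], of c] by (simp add: mult_ac)
    qed
    fix g assume g: "g \<in> ell2 V"
    show "resolvent (\<lambda>x. f x + g x) = (\<lambda>x. resolvent f x + resolvent g x)"
    proof
      fix x
      show "resolvent (\<lambda>x. f x + g x) x = resolvent f x + resolvent g x"
        unfolding resolvent_def funpow_A_linear(1)
        by (simp only: distrib_left minus_add_distrib[symmetric]
            suminf_add[OF neumann_summable[OF b[OF f], of x] neumann_summable[OF b[OF g], of x]])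
    qed
  qed
  then show ?thesis
    unfolding op_spectrum_def using resolvent_left resolvent_right b by blast
qed

end

text \<open>A Weyl criterion: a bounded inverse cannot send functions of bounded norm to functions
  of unbounded norm. Here the defect stays fixed while the norm grows, so no normalisation is
  required.\<close>

lemma in_op_spectrum_approx:
  assumes f: "\<And>M. f M \<in> ell2 V" and large: "\<And>M :: nat. real M \<le> (ell2_norm V (f M))\<^sup>2"
    and small: "\<And>M. ell2_bounded V (\<lambda>x. A (f M) x - z * f M x) C"
  shows "z \<in> op_spectrum V A"
proof (rule ccontr)
  assume "z \<notin> op_spectrum V A"
  then obtain R where R: "bounded_op V R" "\<forall>f\<in>ell2 V. R (\<lambda>x. A f x - z * f x) = f"
    unfolding op_spectrum_def by blast
  from R(1) obtain K where K: "\<And>g. g \<in> ell2 V \<Longrightarrow> ell2_norm V (R g) \<le> K * ell2_norm V g"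
    unfolding bounded_op_def by blast
  have "real M \<le> (\<bar>K\<bar> * C)\<^sup>2" for M
  proof -
    let ?g = "\<lambda>x. A (f M) x - z * f M x"
    have nn: "0 \<le> ell2_norm V h" for h :: "'a \<Rightarrow> complex" by (simp add: ell2_norm_def infsum_nonneg)
    have "ell2_norm V (f M) \<le> K * ell2_norm V ?g"
      using K[OF ell2_bounded_imp(1)[OF small]] R(2) f by metis
    also have "\<dots> \<le> \<bar>K\<bar> * C"
      using ell2_bounded_imp(2)[OF small, of M] nn by (intro mult_mono) auto
    finally have "(ell2_norm V (f M))\<^sup>2 \<le> (\<bar>K\<bar> * C)\<^sup>2" using nn by (intro power_mono) auto
    then show ?thesis using large[of M] by linarith
  qed
  then show False by (metis reals_Archimedean2 not_less)
qed

lemma op_spectral_radius_eq: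
  assumes "of_real lam \<in> op_spectrum V A"
  shows "op_spectral_radius V A = lam"
  unfolding op_spectral_radius_def
proof (rule cSup_eq_maximum)
  show "lam \<in> cmod ` op_spectrum V A"
    using assms lam_nonneg by (intro image_eqI[of _ _ "of_real lam"]) auto
  show "x \<le> lam" if "x \<in> cmod ` op_spectrum V A" for x
    using that not_in_op_spectrum by (auto simp: not_less[symmetric])
qed

end

section \<open>The universal covering as a rooted tree\<close>

lemma cas_snoc: "pre_digraph.cas H u (p @ [a]) v \<longleftrightarrow> pre_digraph.cas H u p (tail H a) \<and> head H a = v"
  by (induction p arbitrary: u) (auto simp: pre_digraph.cas.simps)

locale rooted_regular_multigraph = regular_multigraph G d q for G :: "('v, 'e) pre_digraph" and d q +
  fixes r :: 'v
  assumes root: "r \<in> verts G" and q1: "q \<ge> 1"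
begin

abbreviation "walks \<equiv> nb_walks G r"
abbreviation "T \<equiv> universal_cover G r"

definition endpoint :: "('e \<times> bool) list \<Rightarrow> 'v" where
  "endpoint p = (if p = [] then r else tgt (last p))"

definition extensions :: "('e \<times> bool) list \<Rightarrow> ('e \<times> bool) set" where
  "extensions p = {a \<in> D. src a = endpoint p \<and> (p \<noteq> [] \<longrightarrow> a \<noteq> rev_dart (last p))}"

lemma cas_endpoint: "pre_digraph.cas (darts G) r p v \<Longrightarrow> v = endpoint p"
  unfolding endpoint_def by (cases p rule: rev_cases) (auto simp: cas_snoc pre_digraph.cas.simps)

lemma walks_iff:
  "p \<in> walks \<longleftrightarrow> set p \<subseteq> D \<and> pre_digraph.cas (darts G) r p (endpoint p) \<and> successively (\<lambda>a b. b \<noteq> rev_dart a) p"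
  using cas_endpoint root by (auto simp: nb_walks_def pre_digraph.awalk_def darts_def)

lemma Nil_walks [simp]: "[] \<in> walks"
  by (simp add: walks_iff endpoint_def pre_digraph.cas.simps)

lemma snoc_walks_iff: "p @ [a] \<in> walks \<longleftrightarrow> p \<in> walks \<and> a \<in> extensions p"
proof
  assume *: "p @ [a] \<in> walks"
  then have "pre_digraph.cas (darts G) r p (src a)" by (simp add: walks_iff cas_snoc)
  with * cas_endpoint[OF this] show "p \<in> walks \<and> a \<in> extensions p"
    by (auto simp: walks_iff cas_snoc extensions_def successively_append_iff)
next
  assume "p \<in> walks \<and> a \<in> extensions p"
  then show "p @ [a] \<in> walks"
    by (auto simp: walks_iff cas_snoc extensions_def successively_append_iff endpoint_def[of "p @ [a]"])
qed

lemma finite_extensions [simp]: "finite (extensions p)"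
  by (simp add: extensions_def)

lemma endpoint_in_V: "p \<in> walks \<Longrightarrow> endpoint p \<in> V"
proof (cases "p = []")
  case False
  assume "p \<in> walks"
  then have "last p \<in> D" using last_in_set[OF False] by (auto simp: walks_iff)
  then show ?thesis using False tgt_in_V[of "last p"] by (simp add: endpoint_def)
qed (simp add: endpoint_def root)

lemma card_out: "u \<in> V \<Longrightarrow> card {a \<in> D. src a = u} = d"
  using reg by (simp add: regular_graph_def out_degree_def out_arcs_def)

lemma card_extensions:
  assumes "p \<in> walks"
  shows "real (card (extensions p)) = (if p = [] then q + 1 else q)"
proof (cases "p = []")
  case True
  then show ?thesis using card_out[OF root] q by (simp add: extensions_def endpoint_def)
next
  case False
  have "extensions p = {a \<in> D. src a = endpoint p} - {rev_dart (last p)}"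
    using False by (auto simp: extensions_def)
  moreover have mem: "rev_dart (last p) \<in> {a \<in> D. src a = endpoint p}"
    using assms False last_in_set[OF False] by (auto simp: walks_iff endpoint_def)
  moreover have fin: "finite {a \<in> D. src a = endpoint p}" by simp
  ultimately have "card (extensions p) = card {a \<in> D. src a = endpoint p} - 1"
    by (simp only: card_Diff_singleton)
  moreover have "card {a \<in> D. src a = endpoint p} > 0"
    using mem fin card_gt_0_iff by blast
  ultimately have "card (extensions p) = d - 1" "d \<ge> 1"
    unfolding card_out[OF endpoint_in_V[OF assms]] by simp_all
  then show ?thesis using False q by (simp add: of_nat_diff)
qed

definition children :: "('e \<times> bool) list \<Rightarrow> ('e \<times> bool) list set" where
  "children p = (\<lambda>a. p @ [a]) ` extensions p"

definition nbrs :: "('e \<times> bool) list \<Rightarrow> ('e \<times> bool) list set" where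
  "nbrs p = children p \<union> (if p = [] then {} else {butlast p})"

lemma butlast_walks: "p \<in> walks \<Longrightarrow> butlast p \<in> walks"
  by (cases p rule: rev_cases) (auto simp: snoc_walks_iff)

lemma children_iff: "p \<in> walks \<Longrightarrow> c \<in> children p \<longleftrightarrow> c \<in> walks \<and> c \<noteq> [] \<and> butlast c = p"
  by (cases c rule: rev_cases) (auto simp: children_def snoc_walks_iff)

lemma card_children: "card (children p) = card (extensions p)"
  unfolding children_def by (intro card_image) (auto simp: inj_on_def)

lemma finite_children [simp]: "finite (children p)"
  by (simp add: children_def)

lemma butlast_notin_children: "butlast p \<notin> children p"
  by (auto simp: children_def dest: arg_cong[where f = length])

lemma sum_nbrs: "(\<Sum>y\<in>nbrs p. f y) = (\<Sum>y\<in>children p. f y) + (if p = [] then 0 else f (butlast p))"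
  using butlast_notin_children[of p] by (simp add: nbrs_def add.commute)

lemma length_children: "y \<in> children p \<Longrightarrow> length y = Suc (length p)"
  by (auto simp: children_def)

lemma adj_op_universal_cover:
  "adj_op T f p = (if p \<in> walks then \<Sum>y\<in>nbrs p. f y else 0)"
proof (cases "p \<in> walks")
  case True
  \<comment> \<open>An edge of the tree is named after its end farther from the root:
    \<open>(c, True)\<close> leads to the child \<open>c\<close>, and \<open>(p, False)\<close>
    leads from \<open>p\<close> back to its parent.\<close>
  have out: "out_arcs (darts T) p = (\<lambda>c. (c, True)) ` children p \<union> (if p = [] then {} else {(p, False)})"
  proof (rule Set.set_eqI)
    fix x :: "('e \<times> bool) list \<times> bool"
    obtain c b where x: "x = (c, b)" by fastforce
    have "x \<in> out_arcs (darts T) p \<longleftrightarrow> c \<in> walks \<and> c \<noteq> [] \<and> (if b then butlast c else c) = p"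
      by (simp add: x out_arcs_def darts_def universal_cover_def conj_assoc)
    also have "\<dots> \<longleftrightarrow> x \<in> (\<lambda>c. (c, True)) ` children p \<union> (if p = [] then {} else {(p, False)})"
      using True children_iff[OF True, of c] by (cases b) (auto simp: x)
    finally show "x \<in> out_arcs (darts T) p \<longleftrightarrow> x \<in> (\<lambda>c. (c, True)) ` children p \<union> (if p = [] then {} else {(p, False)})" .
  qed
  have "adj_op T f p = (\<Sum>x\<in>(\<lambda>c. (c, True)) ` children p. f (head (darts T) x))
      + (\<Sum>x\<in>(if p = [] then {} else {(p, False)}). f (head (darts T) x))"
    unfolding adj_op_def out by (rule sum.union_disjoint) auto
  also have "(\<Sum>x\<in>(\<lambda>c. (c, True)) ` children p. f (head (darts T) x)) = (\<Sum>y\<in>children p. f y)"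
    by (subst sum.reindex) (auto simp: inj_on_def darts_def universal_cover_def)
  also have "(\<Sum>x\<in>(if p = [] then {} else {(p, False)}). f (head (darts T) x)) = (if p = [] then 0 else f (butlast p))"
    by (simp add: darts_def universal_cover_def)
  finally show ?thesis using True by (simp add: sum_nbrs)
next
  case False
  have "out_arcs (darts T) p = {}"
    using False butlast_walks by (auto simp: out_arcs_def darts_def universal_cover_def split: if_splits)
  then show ?thesis using False by (simp add: adj_op_def)
qed

section \<open>The radial weight and its truncations\<close>

definition u :: real where "u = 1 / sqrt q"

lemma u_pos: "u > 0" and q_u: "q * (u * u) = 1" and sqrt_q_u: "sqrt q * u = 1"
  using q1 by (auto simp: u_def)

text \<open>Away from the root, \<open>q\<close> children and one parent give exactly 2 sqrt q times
  the weight. At the root the \<open>q + 1\<close> children give (q + 1) u, which is at most 2 q u =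
  2 sqrt q.\<close>

sublocale tree: weighted_graph walks nbrs "\<lambda>p. u ^ length p" "2 * sqrt q"
proof
  fix x assume x: "x \<in> walks"
  show "finite (nbrs x)" by (simp add: nbrs_def)
  show "nbrs x \<subseteq> walks" using children_iff[OF x] butlast_walks[OF x] by (auto simp: nbrs_def)
  show "0 < u ^ length x" using u_pos by simp
  have "(\<Sum>y\<in>nbrs x. u ^ length y) = real (card (extensions x)) * u ^ Suc (length x) + (if x = [] then 0 else u ^ (length x - 1))"
    by (simp add: sum_nbrs length_children card_children)
  also have "\<dots> \<le> 2 * sqrt q * u ^ length x"
  proof (cases "x = []")
    case True
    have "(q + 1) * u \<le> (q + q) * u" using q1 u_pos by (intro mult_right_mono) auto
    also have "\<dots> = 2 * (sqrt q * sqrt q) * u" using q1 by simp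
    also have "\<dots> = 2 * sqrt q * (sqrt q * u)" by simp
    finally show ?thesis using True card_extensions[OF x] by (simp add: sqrt_q_u)
  next
    case False
    then obtain j where j: "length x = Suc j" by (cases x) auto
    have e1: "q * u ^ Suc (Suc j) = u ^ j" using q_u by (metis mult.assoc mult.left_commute mult_1 power_Suc)
    have e2: "2 * sqrt q * u ^ Suc j = 2 * u ^ j" using sqrt_q_u by (simp add: mult.assoc[symmetric])
    have "real (card (extensions x)) * u ^ Suc (length x) + (if x = [] then 0 else u ^ (length x - 1)) = q * u ^ Suc (Suc j) + u ^ j"
      using False card_extensions[OF x] j by simp
    also have "\<dots> = 2 * sqrt q * u ^ length x" unfolding j e1 e2 by simp
    finally show ?thesis by simp
  qed
  finally show "(\<Sum>y\<in>nbrs x. u ^ length y) \<le> 2 * sqrt q * u ^ length x" .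
next
  fix x y assume x: "x \<in> walks" and y: "y \<in> walks" and xy: "y \<in> nbrs x"
  show "x \<in> nbrs y"
  proof (cases "y \<in> children x")
    case True
    then show ?thesis using children_iff[OF x] by (auto simp: nbrs_def)
  next
    case False
    then have "x \<noteq> []" "y = butlast x" using xy by (auto simp: nbrs_def split: if_splits)
    then show ?thesis using children_iff[OF y, of x] x by (simp add: nbrs_def)
  qed
qed (use q1 in auto)

lemma adj_op_eq_A: "adj_op T = tree.A"
  by (intro ext) (simp add: adj_op_universal_cover tree.A_def)

definition sphere :: "nat \<Rightarrow> ('e \<times> bool) list set" where
  "sphere k = {p \<in> walks. length p = k}"

lemma sphere_Suc: "sphere (Suc k) = (\<Union>p\<in>sphere k. children p)"
proof (intro equalityI subsetI)
  fix c assume c: "c \<in> sphere (Suc k)"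
  then have "butlast c \<in> walks" "length (butlast c) = k" "c \<noteq> []" "c \<in> walks"
    using butlast_walks by (auto simp: sphere_def)
  then show "c \<in> (\<Union>p\<in>sphere k. children p)" using children_iff[of "butlast c" c] by (auto simp: sphere_def)
next
  fix c assume "c \<in> (\<Union>p\<in>sphere k. children p)"
  then obtain p where "p \<in> walks" "length p = k" "c \<in> children p" by (auto simp: sphere_def)
  then show "c \<in> sphere (Suc k)" using children_iff[of p c] length_children by (auto simp: sphere_def)
qed

lemma finite_sphere [simp]: "finite (sphere k)"
  by (induction k) (auto simp: sphere_Suc, simp add: sphere_def)

lemma card_sphere: "real (card (sphere (Suc k))) = (q + 1) * q ^ k"
proof -
  have rec: "card (sphere (Suc k)) = (\<Sum>p\<in>sphere k. card (extensions p))" for k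
    unfolding sphere_Suc card_children[symmetric]
  proof (rule card_UN_disjoint)
    show "\<forall>i\<in>sphere k. \<forall>j\<in>sphere k. i \<noteq> j \<longrightarrow> children i \<inter> children j = {}"
      by (auto simp: children_def)
  qed auto
  have rec': "real (card (sphere (Suc (Suc k)))) = q * real (card (sphere (Suc k)))" for k
  proof -
    have "real (card (sphere (Suc (Suc k)))) = (\<Sum>p\<in>sphere (Suc k). real (card (extensions p)))"
      by (simp add: rec[of "Suc k"])
    also have "\<dots> = (\<Sum>p\<in>sphere (Suc k). q)"
      by (intro sum.cong) (auto simp: sphere_def card_extensions)
    finally show ?thesis by (simp add: mult.commute)
  qed
  have "sphere 0 = {[]}" by (auto simp: sphere_def)
  then have "real (card (sphere (Suc 0))) = q + 1" by (simp add: rec card_extensions)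
  then show ?thesis by (induction k) (simp_all add: rec')
qed

text \<open>The weight cut off at radius \<open>M\<close>. A sphere of radius k has at least q^k
  vertices of squared weight q^(-k), so each sphere adds at least 1 to the squared norm.\<close>

definition test_fun :: "nat \<Rightarrow> ('e \<times> bool) list \<Rightarrow> complex" where
  "test_fun M p = (if p \<in> walks \<and> length p \<le> M then of_real (u ^ length p) else 0)"

lemma test_fun_norm:
  shows "test_fun M \<in> ell2 walks" "real M \<le> (ell2_norm walks (test_fun M))\<^sup>2"
proof -
  define Ball where "Ball = (\<Union>k\<in>{..M}. sphere k)"
  have Ball: "finite Ball" "Ball \<subseteq> walks" by (auto simp: Ball_def sphere_def[abs_def])
     (auto simp flip: sphere_def)
  have zero: "(cmod (test_fun M p))\<^sup>2 = 0" if "p \<in> walks - Ball" for p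
    using that by (auto simp: test_fun_def Ball_def sphere_def)
  have "(\<lambda>p. (cmod (test_fun M p))\<^sup>2) summable_on walks \<longleftrightarrow> (\<lambda>p. (cmod (test_fun M p))\<^sup>2) summable_on Ball"
    by (rule summable_on_cong_neutral) (use zero Ball in auto)
  then show "test_fun M \<in> ell2 walks"
    using Ball by (auto simp: ell2_def test_fun_def)
  have "(\<Sum>\<^sub>\<infinity>p\<in>walks. (cmod (test_fun M p))\<^sup>2) = (\<Sum>\<^sub>\<infinity>p\<in>Ball. (cmod (test_fun M p))\<^sup>2)"
    by (rule infsum_cong_neutral) (use zero Ball in auto)
  also have "\<dots> = (\<Sum>p\<in>Ball. (cmod (test_fun M p))\<^sup>2)" using Ball by simp
  also have "\<dots> = (\<Sum>k\<le>M. \<Sum>p\<in>sphere k. (cmod (test_fun M p))\<^sup>2)"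
    unfolding Ball_def by (rule sum.UNION_disjoint) (auto, auto simp: sphere_def)
  also have "\<dots> \<ge> (\<Sum>k\<le>M. 1)"
  proof (rule sum_mono)
    fix k assume k: "k \<in> {..M}"
    have "(\<Sum>p\<in>sphere k. (cmod (test_fun M p))\<^sup>2) = (\<Sum>p\<in>sphere k. (u ^ k)\<^sup>2)"
      using k u_pos by (intro sum.cong) (auto simp: sphere_def test_fun_def norm_power)
    also have "\<dots> = real (card (sphere k)) * (u * u) ^ k"
      by (simp add: power2_eq_square power_mult_distrib)
    also have "\<dots> \<ge> 1"
    proof (cases k)
      case 0
      have "sphere 0 = {[]}" by (auto simp: sphere_def)
      then show ?thesis using 0 by simp
    next
      case (Suc j)
      have "1 \<le> (q + 1) * (u * u)" using q_u u_pos by (simp add: distrib_right)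
      also have "\<dots> = (q + 1) * (u * u) * (q * (u * u)) ^ j" by (simp only: q_u power_one mult_1_right)
      also have "\<dots> = real (card (sphere k)) * (u * u) ^ k"
        unfolding Suc card_sphere by (simp add: power_mult_distrib mult_ac)
      finally show ?thesis .
    qed
    finally show "1 \<le> (\<Sum>p\<in>sphere k. (cmod (test_fun M p))\<^sup>2)" .
  qed
  finally have "real M + 1 \<le> (\<Sum>\<^sub>\<infinity>p\<in>walks. (cmod (test_fun M p))\<^sup>2)" by simp
  then show "real M \<le> (ell2_norm walks (test_fun M))\<^sup>2"
    unfolding ell2_norm_def by (subst real_sqrt_pow2) auto
qed

abbreviation "defect M \<equiv> (\<lambda>p. tree.A (test_fun M) p - of_real (2 * sqrt q) * test_fun M p)"

text \<open>Away from the root and below the cutoff the weight solves the eigenvalue equation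
  exactly. At length \<open>M\<close> the contribution of the children is missing, and at length
  \<open>M + 1\<close> only that of the parent is left.\<close>

lemma defect_values:
  assumes p: "p \<in> walks" and M: "M \<ge> 1"
  shows "cmod (defect M p) = (if p = [] then \<bar>(q + 1) * u - 2 * sqrt q\<bar>
    else if length p = M then u ^ (M - 1) else if length p = Suc M then u ^ M else 0)"
proof -
  have ch: "(\<Sum>y\<in>children p. test_fun M y)
     = of_real (if Suc (length p) \<le> M then real (card (extensions p)) * u ^ Suc (length p) else 0)"
  proof -
    have "(\<Sum>y\<in>children p. test_fun M y) = (\<Sum>y\<in>children p. of_real (if Suc (length p) \<le> M then u ^ Suc (length p) else 0))"
    proof (rule sum.cong)
      fix y assume "y \<in> children p"
      then have "y \<in> walks" "length y = Suc (length p)" using children_iff[OF p] length_children by auto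
      then show "test_fun M y = of_real (if Suc (length p) \<le> M then u ^ Suc (length p) else 0)"
        by (simp add: test_fun_def)
    qed simp
    then show ?thesis by (simp add: card_children)
  qed
  have A: "tree.A (test_fun M) p = (\<Sum>y\<in>children p. test_fun M y) + (if p = [] then 0 else test_fun M (butlast p))"
    using p by (simp add: tree.A_def sum_nbrs)
  show ?thesis
  proof (cases "p = []")
    case True
    have "defect M p = of_real ((q + 1) * u - 2 * sqrt q)"
      using True M p card_extensions[OF p] unfolding A ch by (simp add: test_fun_def)
    then show ?thesis using True by (simp only: norm_of_real simp_thms if_True)
  next
    case False
    then obtain j where j: "length p = Suc j" by (cases p) auto
    have e1: "q * u ^ Suc (Suc j) = u ^ j" using q_u by (metis mult.assoc mult.left_commute mult_1 power_Suc)
    have e2: "2 * sqrt q * u ^ Suc j = 2 * u ^ j" using sqrt_q_u by (simp add: mult.assoc[symmetric])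
    have "defect M p = of_real ((if Suc (Suc j) \<le> M then q * u ^ Suc (Suc j) else 0) + (if j \<le> M then u ^ j else 0)
        - (if Suc j \<le> M then 2 * sqrt q * u ^ Suc j else 0))"
      using False j p butlast_walks[OF p] card_extensions[OF p] unfolding A ch by (simp add: test_fun_def)
    also have "\<dots> = of_real ((if Suc (Suc j) \<le> M then u ^ j else 0) + (if j \<le> M then u ^ j else 0)
        - (if Suc j \<le> M then 2 * u ^ j else 0))"
      by (simp only: e1 e2)
    finally have "cmod (defect M p) = \<bar>(if Suc (Suc j) \<le> M then u ^ j else 0) + (if j \<le> M then u ^ j else 0)
        - (if Suc j \<le> M then 2 * u ^ j else 0)\<bar>" by (simp only: norm_of_real)
    also have "\<dots> = (if length p = M then u ^ (M - 1) else if length p = Suc M then u ^ M else 0)"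
      using u_pos M unfolding j by (auto simp: not_le less_Suc_eq_le le_Suc_eq)
    finally show ?thesis using False by simp
  qed
qed

text \<open>Each of the two spheres at the cutoff contributes exactly q + 1 at every radius: the
  growth of the sphere cancels the decay of the weight.\<close>

lemma defect_bounded:
  "ell2_bounded walks (defect (Suc m)) (sqrt (((q + 1) * u - 2 * sqrt q)\<^sup>2 + 2 * (q + 1)))"
proof -
  let ?M = "Suc m"
  let ?g = "\<lambda>p. (cmod (defect ?M p))\<^sup>2"
  define Z where "Z = {[]} \<union> sphere ?M \<union> sphere (Suc ?M)"
  have Z: "finite Z" "Z \<subseteq> walks" by (auto simp: Z_def sphere_def[abs_def]) (auto simp flip: sphere_def)
  have zero: "?g p = 0" if "p \<in> walks - Z" for p
    using that defect_values[of p ?M] by (auto simp: Z_def sphere_def)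
  have "(\<Sum>p\<in>Z. ?g p) \<le> (\<Sum>p\<in>{[]}. ?g p) + (\<Sum>p\<in>sphere ?M. ?g p) + (\<Sum>p\<in>sphere (Suc ?M). ?g p)"
  proof -
    have "{[]} \<inter> sphere ?M = {}" "({[]} \<union> sphere ?M) \<inter> sphere (Suc ?M) = {}" by (auto simp: sphere_def)
    then show ?thesis unfolding Z_def by (simp add: sum.union_disjoint)
  qed
  also have "(\<Sum>p\<in>{[]}. ?g p) = ((q + 1) * u - 2 * sqrt q)\<^sup>2"
    using defect_values[of "[]" ?M] by simp
  also have "(\<Sum>p\<in>sphere ?M. ?g p) = real (card (sphere ?M)) * (u * u) ^ m"
  proof -
    have "(\<Sum>p\<in>sphere ?M. ?g p) = (\<Sum>p\<in>sphere ?M. (u * u) ^ m)"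
    proof (rule sum.cong)
      fix p assume "p \<in> sphere ?M"
      then have "p \<in> walks" "length p = ?M" "p \<noteq> []" by (auto simp: sphere_def)
      then have "cmod (defect ?M p) = u ^ m" using defect_values[of p ?M] by simp
      then show "?g p = (u * u) ^ m" by (simp add: power2_eq_square power_mult_distrib)
    qed simp
    then show ?thesis by simp
  qed
  also have "(\<Sum>p\<in>sphere (Suc ?M). ?g p) = real (card (sphere (Suc ?M))) * (u * u) ^ Suc m"
  proof -
    have "(\<Sum>p\<in>sphere (Suc ?M). ?g p) = (\<Sum>p\<in>sphere (Suc ?M). (u * u) ^ Suc m)"
    proof (rule sum.cong)
      fix p assume "p \<in> sphere (Suc ?M)"
      then have "p \<in> walks" "length p = Suc ?M" "p \<noteq> []" by (auto simp: sphere_def)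
      then have "cmod (defect ?M p) = u ^ Suc m" using defect_values[of p ?M] by simp
      then show "?g p = (u * u) ^ Suc m" by (simp only: power2_eq_square power_mult_distrib)
    qed simp
    then show ?thesis by simp
  qed
  also have "((q + 1) * u - 2 * sqrt q)\<^sup>2 + real (card (sphere ?M)) * (u * u) ^ m + real (card (sphere (Suc ?M))) * (u * u) ^ Suc m
      = ((q + 1) * u - 2 * sqrt q)\<^sup>2 + 2 * (q + 1)"
  proof -
    have "real (card (sphere (Suc k))) * (u * u) ^ k = q + 1" for k
    proof -
      have "real (card (sphere (Suc k))) * (u * u) ^ k = (q + 1) * (q * (u * u)) ^ k"
        unfolding card_sphere by (simp only: power_mult_distrib mult_ac)
      then show ?thesis by (simp only: q_u power_one mult_1_right)
    qed
    from this[of m] this[of "Suc m"] show ?thesis by (simp only:) simp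
  qed
  finally have Zle: "(\<Sum>p\<in>Z. ?g p) \<le> ((q + 1) * u - 2 * sqrt q)\<^sup>2 + 2 * (q + 1)" .
  have "(\<Sum>p\<in>F. ?g p) \<le> ((q + 1) * u - 2 * sqrt q)\<^sup>2 + 2 * (q + 1)" if F: "finite F" "F \<subseteq> walks" for F
  proof -
    have "(\<Sum>p\<in>F. ?g p) = (\<Sum>p\<in>F \<inter> Z. ?g p)"
      using F zero by (intro sum.mono_neutral_right) auto
    also have "\<dots> \<le> (\<Sum>p\<in>Z. ?g p)" using Z by (intro sum_mono2) auto
    finally show ?thesis using Zle by linarith
  qed
  moreover have "defect ?M p = 0" if "p \<notin> walks" for p
    using that by (simp add: tree.A_def test_fun_def)
  ultimately show ?thesis unfolding ell2_bounded_def L2_set_def by (auto intro: real_sqrt_le_mono)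
qed

lemma op_spectral_radius_universal_cover:
  "op_spectral_radius (verts T) (adj_op T) = 2 * sqrt q"
proof -
  have "of_real (2 * sqrt q) \<in> op_spectrum walks tree.A"
  proof (rule tree.in_op_spectrum_approx)
    show "test_fun (Suc M) \<in> ell2 walks" for M by (rule test_fun_norm)
    show "real M \<le> (ell2_norm walks (test_fun (Suc M)))\<^sup>2" for M
      using test_fun_norm(2)[of "Suc M"] by simp
    show "ell2_bounded walks (defect (Suc M)) (sqrt (((q + 1) * u - 2 * sqrt q)\<^sup>2 + 2 * (q + 1)))" for M
      by (rule defect_bounded)
  qed
  then have "op_spectral_radius walks tree.A = 2 * sqrt q" by (rule tree.op_spectral_radius_eq)
  moreover have "verts T = walks" by (simp add: universal_cover_def)
  ultimately show ?thesis by (simp add: adj_op_eq_A)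
qed

end

lemma rho_A_regular:
  assumes "fin_digraph \<Omega>" "Digraph_Component.connected \<Omega>" "regular_graph \<Omega> d" "d \<ge> 2"
  shows "rho_A \<Omega> = 2 * sqrt (real d - 1)"
proof -
  have "verts \<Omega> \<noteq> {}"
    using assms(2) by (auto simp: Digraph_Component.connected_def strongly_connected_def mk_symmetric_def)
  then have "(SOME r. r \<in> verts \<Omega>) \<in> verts \<Omega>" by (rule some_in_eq[THEN iffD2])
  then interpret rooted_regular_multigraph \<Omega> d "real d - 1" "SOME r. r \<in> verts \<Omega>"
    using assms by (intro rooted_regular_multigraph.intro regular_multigraph.intro
        rooted_regular_multigraph_axioms.intro) auto
  show ?thesis
    using op_spectral_radius_universal_cover by (simp add: rho_A_def)
qed

section \<open>Convergence\<close>

lemma exists_separating_poly: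
  fixes r e R :: real
  assumes "0 \<le> r" "0 < e"
  obtains P :: "real poly" where "\<And>x. \<bar>x\<bar> \<le> R \<Longrightarrow> 0 \<le> poly P x \<and> poly P x \<le> 1"
    "\<And>x. \<bar>x\<bar> \<le> R \<Longrightarrow> \<bar>x\<bar> \<le> r \<Longrightarrow> poly P x \<le> 1 / 64"
    "\<And>x. \<bar>x\<bar> \<le> R \<Longrightarrow> r + e \<le> \<bar>x\<bar> \<Longrightarrow> 1 / 2 \<le> poly P x"
proof -
  \<comment> \<open>A ramp from 1/128 to 1/128 + 3/4. Approximated up to 1/128 by Stone-Weierstrass,
    it yields values in [0, 1] that are at most 1/64 up to \<open>r\<close> and at least 3/4 from
    \<open>r + e\<close> on.\<close>
  define f where "f x = 1 / 128 + 3 / 4 * min 1 (max 0 ((\<bar>x\<bar> - r) / e))" for x :: real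
  have "continuous_on {-R..R} f"
    unfolding f_def using assms by (intro continuous_intros) auto
  then obtain g where g: "real_polynomial_function g" "\<And>x. x \<in> {-R..R} \<Longrightarrow> \<bar>f x - g x\<bar> < 1 / 128"
    using Stone_Weierstrass_real_polynomial_function[of "{-R..R}" f "1 / 128"] by auto
  then obtain a n where a: "g = (\<lambda>x. \<Sum>i\<le>n. a i * x ^ i)"
    using real_polynomial_function_iff_sum by blast
  define P where "P = (\<Sum>i\<le>n. Polynomial.monom (a i) i)"
  have P: "poly P x = g x" for x by (simp add: P_def a poly_sum poly_monom)
  have near: "\<bar>f x - poly P x\<bar> < 1 / 128" if "\<bar>x\<bar> \<le> R" for x
    using g(2)[of x] that unfolding P by (simp add: abs_le_iff)
  have f1: "1 / 128 \<le> f x" "f x \<le> 1 / 128 + 3 / 4" for x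
    by (auto simp: f_def)
  have f2: "f x = 1 / 128" if "\<bar>x\<bar> \<le> r" for x
  proof -
    have "(\<bar>x\<bar> - r) / e \<le> 0" using that assms by (intro divide_nonpos_pos) auto
    then show ?thesis by (simp add: f_def max_absorb1)
  qed
  have f3: "f x = 1 / 128 + 3 / 4" if "r + e \<le> \<bar>x\<bar>" for x
  proof -
    have "1 \<le> (\<bar>x\<bar> - r) / e" using that assms by (simp add: field_simps)
    then show ?thesis by (simp add: f_def min_def max_def)
  qed
  show thesis
  proof (rule that[of P])
    show "0 \<le> poly P x \<and> poly P x \<le> 1" if "\<bar>x\<bar> \<le> R" for x
    proof -
      have "f x - poly P x < 1 / 128" "poly P x - f x < 1 / 128" using near[OF that] by linarith+
      then show ?thesis using f1[of x] by (intro conjI) linarith+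
    qed
    show "poly P x \<le> 1 / 64" if "\<bar>x\<bar> \<le> R" "\<bar>x\<bar> \<le> r" for x
      using near[OF that(1)] f2[OF that(2)] by linarith
    show "1 / 2 \<le> poly P x" if "\<bar>x\<bar> \<le> R" "r + e \<le> \<bar>x\<bar>" for x
      using near[OF that(1)] f3[OF that(2)] by linarith
  qed
qed

lemma pderiv_falling_poly_0: "\<bar>poly (pderiv (falling_poly 0 K)) 0\<bar> \<le> real K ^ 2"
proof -
  have "poly (pderiv (falling_poly 0 K)) 0 = (\<Sum>l\<in>{0..<K}. - real l)"
    unfolding falling_poly_def pderiv_prod poly_sum by (intro sum.cong) (auto simp: poly_prod pderiv_pCons)
  then have "\<bar>poly (pderiv (falling_poly 0 K)) 0\<bar> \<le> (\<Sum>l\<in>{0..<K}. real K)"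
    by (simp only:) (rule order_trans[OF sum_abs sum_mono], auto)
  then show ?thesis by (simp add: power2_eq_square)
qed

text \<open>Every factor is at least 1 - K/n, and Bernoulli's inequality bounds the power of that.
  Division by the common denominator therefore costs at most a factor 2.\<close>

lemma poly_falling_poly_power_ge_half:
  assumes n: "n \<ge> 1" "real n \<ge> 2 * real E * real K ^ 2" "K \<le> n"
  shows "1 / 2 \<le> poly (falling_poly 0 K) (1 / real n) ^ E"
proof -
  define y where "y = 1 - real K / real n"
  have y: "0 \<le> y" using n by (simp add: y_def)
  have "y ^ K = (\<Prod>l\<in>{0..<K}. y)" by simp
  also have "\<dots> \<le> poly (falling_poly 0 K) (1 / real n)"
    unfolding poly_falling_poly using n y by (intro prod_mono) (auto simp: y_def field_simps)
  finally have "(y ^ K) ^ E \<le> poly (falling_poly 0 K) (1 / real n) ^ E"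
    using y by (intro power_mono) auto
  moreover have "1 + real (K * E) * (- (real K / real n)) \<le> (1 + (- (real K / real n))) ^ (K * E)"
    using n by (intro Bernoulli_inequality) (simp add: field_simps)
  moreover have "real (K * E) * (real K / real n) \<le> 1 / 2"
    using n by (simp add: field_simps power2_eq_square)
  ultimately show ?thesis by (simp add: y_def power_mult)
qed

lemma sum_mset_real_nonneg:
  fixes f :: "'a \<Rightarrow> real"
  shows "(\<And>x. x \<in># M \<Longrightarrow> 0 \<le> f x) \<Longrightarrow> 0 \<le> (\<Sum>x\<in>#M. f x)"
  by (induction M) auto

section \<open>The expected sum of a polynomial over the new spectrum\<close>

context regular_multigraph
begin

definition new_sum :: "real poly \<Rightarrow> nat \<Rightarrow> ('e \<Rightarrow> nat \<Rightarrow> nat) \<Rightarrow> real" where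
  "new_sum h n \<sigma> = (\<Sum>x\<in>#covering_graph.new_spec G n \<sigma>. poly h x)"

definition expected_new_sum :: "real poly \<Rightarrow> nat \<Rightarrow> real" where
  "expected_new_sum h n = measure_pmf.expectation (perm_family (arcs G) n) (new_sum h n)"

lemma integrable_perm_family: "integrable (measure_pmf (perm_family (arcs G) n)) (f :: _ \<Rightarrow> real)"
  by (rule integrable_measure_pmf_finite[OF finite_set_pmf_perm_family[OF finite_arcs]])

lemma expected_new_sum_bounds:
  assumes h: "\<And>x. \<bar>x\<bar> \<le> real d \<Longrightarrow> 0 \<le> poly h x \<and> poly h x \<le> 1" and n: "n \<ge> 1"
  shows "0 \<le> expected_new_sum h n" "expected_new_sum h n \<le> (real n - 1) * real (card V)"
proof -
  let ?M = "perm_family (arcs G) n"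
  have *: "0 \<le> new_sum h n \<sigma> \<and> new_sum h n \<sigma> \<le> (real n - 1) * real (card V)" if "\<sigma> \<in> set_pmf ?M" for \<sigma>
  proof -
    interpret covering_graph G d q n \<sigma> by (rule covering_graph_perm_family[OF that])
    have "0 \<le> (\<Sum>x\<in>#M. poly h x) \<and> (\<Sum>x\<in>#M. poly h x) \<le> real (size M)"
      if "\<And>x. x \<in># M \<Longrightarrow> \<bar>x\<bar> \<le> real d" for M
      using that
    proof (induction M)
      case (add x M)
      then show ?case using h[of x] by force
    qed simp
    from this[of new_spec] new_spec_bound
    have "0 \<le> new_sum h n \<sigma> \<and> new_sum h n \<sigma> \<le> real (size new_spec)"
      by (simp add: new_sum_def)
    moreover have "real (size new_spec) = (real n - 1) * real (card V)"
      using arg_cong[OF size_new_spec[OF n], of real] by (simp add: algebra_simps)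
    ultimately show ?thesis by simp
  qed
  show "0 \<le> expected_new_sum h n"
    unfolding expected_new_sum_def using * by (intro integral_nonneg_AE AE_pmfI) auto
  have "expected_new_sum h n \<le> measure_pmf.expectation ?M (\<lambda>_. (real n - 1) * real (card V))"
    unfolding expected_new_sum_def using * by (intro integral_mono_AE integrable_perm_family AE_pmfI) auto
  then show "expected_new_sum h n \<le> (real n - 1) * real (card V)" by simp
qed

text \<open>Index 0 counts every new eigenvalue twice since \<open>dickson q 0\<close> is 2, and
  even indices bring in the parity term of \<open>closed_nb_eq_trace_dickson\<close>. Both are
  proportional to n - 1; all dependence on the random permutations is in the walk counts.\<close>

lemma expected_new_sum_expansion:
  assumes h: "h = (\<Sum>k\<le>K. Polynomial.smult (b k) (dickson q k))" and n: "n \<ge> 1"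
  shows "expected_new_sum h n
    = (real n - 1) * (2 * b 0 - (\<Sum>k\<in>{1..K}. if even k then b k * (q - 1) else 0)) * real (card V)
      + (\<Sum>k\<in>{1..K}. b k * (expected_cyc_walks n k - real (card (cyc_walks G k))))"
proof -
  let ?M = "perm_family (arcs G) n"
  define c where "c = (real n - 1) * (2 * b 0 - (\<Sum>k\<in>{1..K}. if even k then b k * (q - 1) else 0)) * real (card V)"
  have "expected_new_sum h n = measure_pmf.expectation ?M (\<lambda>\<sigma>. c
      + (\<Sum>k\<in>{1..K}. b k * (real (card (cyc_walks (covering G n \<sigma>) k)) - real (card (cyc_walks G k)))))"
    unfolding expected_new_sum_def
  proof (rule integral_cong_AE)
    show "AE \<sigma> in measure_pmf ?M. new_sum h n \<sigma> = c
      + (\<Sum>k\<in>{1..K}. b k * (real (card (cyc_walks (covering G n \<sigma>) k)) - real (card (cyc_walks G k))))"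
    proof (rule AE_pmfI)
      fix \<sigma> assume "\<sigma> \<in> set_pmf ?M"
      then interpret covering_graph G d q n \<sigma> by (rule covering_graph_perm_family)
      have size: "real (size new_spec) = (real n - 1) * real (card V)"
        using arg_cong[OF size_new_spec[OF n], of real] by (simp add: algebra_simps)
      have "(\<Sum>x\<in>#M. poly h x) = (\<Sum>k\<le>K. b k * (\<Sum>x\<in>#M. poly (dickson q k) x))" for M
        unfolding h by (induction M) (auto simp: poly_sum sum.distrib distrib_left)
      then have "new_sum h n \<sigma> = (\<Sum>k\<le>K. b k * (\<Sum>x\<in>#new_spec. poly (dickson q k) x))"
        by (simp add: new_sum_def)
      also have "{..K} = insert 0 {1..K}" by auto
      also have "(\<Sum>k\<in>insert 0 {1..K}. b k * (\<Sum>x\<in>#new_spec. poly (dickson q k) x))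
        = b 0 * (2 * real (size new_spec)) + (\<Sum>k\<in>{1..K}. b k * (\<Sum>x\<in>#new_spec. poly (dickson q k) x))"
      proof -
        have size0: "(\<Sum>x\<in>#M. poly (dickson q 0) x) = 2 * real (size M)" for M
          by (induction M) auto
        have "0 \<notin> {1..K}" by simp
        show ?thesis unfolding sum.insert[OF finite_atLeastAtMost \<open>0 \<notin> {1..K}\<close>] size0 by (rule refl)
      qed
      also have "(\<Sum>k\<in>{1..K}. b k * (\<Sum>x\<in>#new_spec. poly (dickson q k) x))
        = (\<Sum>k\<in>{1..K}. b k * (real (card (cyc_walks \<Gamma> k)) - real (card (cyc_walks G k)))
            - (real n - 1) * real (card V) * (if even k then b k * (q - 1) else 0))"
        using n by (intro sum.cong refl)
          (auto simp: sum_new_spec_dickson closed_nb_conv_card cover.closed_nb_conv_card algebra_simps)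
      also have "\<dots> = (\<Sum>k\<in>{1..K}. b k * (real (card (cyc_walks \<Gamma> k)) - real (card (cyc_walks G k))))
            - (real n - 1) * real (card V) * (\<Sum>k\<in>{1..K}. if even k then b k * (q - 1) else 0)"
        by (simp only: sum_subtractf sum_distrib_left)
      finally show "new_sum h n \<sigma> = c
        + (\<Sum>k\<in>{1..K}. b k * (real (card (cyc_walks (covering G n \<sigma>) k)) - real (card (cyc_walks G k))))"
        unfolding size c_def by (simp only: algebra_simps)
    qed
  qed auto
  also have "\<dots> = c + (\<Sum>k\<in>{1..K}. b k * (expected_cyc_walks n k - real (card (cyc_walks G k))))"
    by (simp add: integrable_perm_family Bochner_Integration.integral_sum expected_cyc_walks_def
        Bochner_Integration.integral_diff)
  finally show ?thesis by (simp add: c_def)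
qed

lemma expected_new_sum_bound:
  assumes h: "\<And>x. \<bar>x\<bar> \<le> real d \<Longrightarrow> 0 \<le> poly h x \<and> poly h x \<le> 1"
    and small: "\<And>x. \<bar>x\<bar> \<le> 2 * sqrt q \<Longrightarrow> \<bar>poly h x\<bar> \<le> \<alpha>"
    and deg: "degree h \<le> K" and K: "K \<ge> 1" and q1: "q \<ge> 1"
    and M: "M = (card (arcs G) + 1) * K + 1" and n: "n \<ge> 16 * M ^ 3"
  shows "expected_new_sum h n \<le> 2 * (real n * (\<alpha> * real (card V) * (2 + real K * q))
    + (\<alpha> * real (card V) * (2 + real K * q) * (real (card (arcs G)) * real K ^ 2 + 1) + \<alpha> * real K ^ 2 * real (card D))
    + 32768 * real M ^ 12 * real (card V) / real n)"
proof -
  let ?E = "card (arcs G)"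
  let ?v = "real (card V)"
  obtain b where b: "h = (\<Sum>k\<le>K. Polynomial.smult (b k) (dickson q k))"
    using dickson_expansion_exists[OF deg] by blast
  have sq: "(sqrt q)\<^sup>2 = q" "sqrt q \<ge> 1" using q1 by auto
  have bk: "\<bar>b k\<bar> * sqrt q ^ k \<le> \<alpha>" if "k \<le> K" for k
    by (rule dickson_coeff_bound[where s = "sqrt q" and p = h and K = K]) (use b small that sq in auto)
  have bk': "\<bar>b k\<bar> \<le> \<alpha>" if "k \<le> K" for k
  proof -
    have "\<bar>b k\<bar> * 1 \<le> \<bar>b k\<bar> * sqrt q ^ k" using sq by (intro mult_left_mono one_le_power) auto
    then show ?thesis using bk[OF that] by linarith
  qed
  have \<alpha>: "\<alpha> \<ge> 0" using bk'[of 0] by simp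
  \<comment> \<open>The limit of the expected sum divided by n. It equals \<open>card V\<close>
    times the mean of \<open>h\<close> under the Kesten-McKay law, the spectral measure of the
    tree.\<close>
  define \<nu> where "\<nu> = (2 * b 0 - (\<Sum>k\<in>{1..K}. if even k then b k * (q - 1) else 0)) * ?v"
  define F where "F = falling_poly 0 K ^ ?E"
  define S where "S = (\<Sum>k\<in>{1..K}. Polynomial.smult (b k) (pattern_poly K k - Polynomial.smult (real (card (cyc_walks G k))) F))"
  \<comment> \<open>By \<open>val\<close> below, this is the expected sum divided by n, with
    denominators cleared by \<open>F\<close>. The factor 1 - x stands for (n - 1)/n and the shift by
    \<open>pCons\<close> for 1/n.\<close>
  define P where "P = Polynomial.smult \<nu> (F * [:1, -1:]) + pCons 0 S"
  have degF: "degree F \<le> ?E * K"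
  proof -
    have "degree F \<le> degree (falling_poly 0 K) * ?E" unfolding F_def by (rule degree_power_le)
    also have "\<dots> \<le> K * ?E" using degree_falling_poly[of 0 K] by (intro mult_le_mono) auto
    finally show ?thesis by (simp add: mult.commute)
  qed
  have degS: "degree S \<le> ?E * K"
    unfolding S_def
  proof (rule degree_sum_le)
    fix k assume "k \<in> {1..K}"
    then have "degree (pattern_poly K k) \<le> ?E * K" by (intro degree_pattern_poly) auto
    then show "degree (Polynomial.smult (b k) (pattern_poly K k - Polynomial.smult (real (card (cyc_walks G k))) F)) \<le> ?E * K"
      using degF by (intro order_trans[OF degree_smult_le] degree_diff_le order_trans[OF degree_smult_le])
  qed simp
  have "?E * K + 1 \<le> M" by (simp add: M)
  then have degP: "degree P \<le> M"
    unfolding P_def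
  proof (intro degree_add_le order_trans[OF degree_smult_le])
    have "degree (F * [:1, -1:]) \<le> degree F + 1" by (rule order_trans[OF degree_mult_le]) simp
    then show "degree (F * [:1, -1:]) \<le> M" if "?E * K + 1 \<le> M" using degF that by linarith
    show "degree (pCons 0 S) \<le> M" if "?E * K + 1 \<le> M" using degS that degree_pCons_le[of 0 S] by linarith
  qed
  have val: "poly P (1 / real n) = poly F (1 / real n) * (1 / real n) * expected_new_sum h n" if n: "K \<le> n" for n
  proof -
    have n1: "n \<ge> 1" using n K by simp
    have "poly S (1 / real n) = (\<Sum>k\<in>{1..K}. b k * (poly F (1 / real n) * (expected_cyc_walks n k - real (card (cyc_walks G k)))))"
      unfolding S_def poly_sum
      by (intro sum.cong refl) (use n in \<open>simp add: poly_pattern_poly F_def poly_power algebra_simps\<close>)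
    also have "\<dots> = poly F (1 / real n) * (\<Sum>k\<in>{1..K}. b k * (expected_cyc_walks n k - real (card (cyc_walks G k))))"
      by (simp add: sum_distrib_left mult_ac)
    finally have S: "poly S (1 / real n) = poly F (1 / real n) * (\<Sum>k\<in>{1..K}. b k * (expected_cyc_walks n k - real (card (cyc_walks G k))))" .
    have e: "expected_new_sum h n = (real n - 1) * \<nu> + (\<Sum>k\<in>{1..K}. b k * (expected_cyc_walks n k - real (card (cyc_walks G k))))"
      unfolding expected_new_sum_expansion[OF b n1] \<nu>_def by (simp add: mult.assoc)
    have x: "1 - 1 / real n = (1 / real n) * (real n - 1)" using n1 by (simp add: field_simps)
    have "poly P (1 / real n) = \<nu> * (poly F (1 / real n) * (1 - 1 / real n)) + (1 / real n) * poly S (1 / real n)"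
      by (simp add: P_def algebra_simps)
    then show ?thesis unfolding S e x by (simp only: algebra_simps)
  qed
  \<comment> \<open>\<open>h\<close> takes values in [0, 1] on the spectrum, and there are fewer
    than n times \<open>card V\<close> new eigenvalues.\<close>
  have Pbd: "\<bar>poly P (1 / real n)\<bar> \<le> ?v" if n: "K \<le> n" for n
  proof -
    have n1: "n \<ge> 1" using n K by simp
    have F: "0 \<le> poly F (1 / real n)" "poly F (1 / real n) \<le> 1"
      using poly_falling_poly_pos[OF n n1, of 0] by (auto simp: F_def poly_power intro: power_le_one)
    note T = expected_new_sum_bounds[OF h n1]
    have "poly P (1 / real n) \<le> 1 * (1 / real n) * ((real n - 1) * ?v)"
      unfolding val[OF n] using F T by (intro mult_mono) auto
    also have "\<dots> \<le> 1 * ?v"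
    proof -
      have "(1 / real n) * (real n - 1) \<le> 1" using n1 by (simp add: field_simps)
      then have "((1 / real n) * (real n - 1)) * ?v \<le> 1 * ?v" by (rule mult_right_mono) simp
      then show ?thesis by (simp only: mult_1 mult.assoc)
    qed
    moreover have "0 \<le> poly P (1 / real n)" unfolding val[OF n] using F T by simp
    ultimately show ?thesis by simp
  qed
  have \<nu>: "\<bar>\<nu>\<bar> \<le> \<alpha> * ?v * (2 + real K * q)"
  proof -
    have "\<bar>\<Sum>k\<in>{1..K}. if even k then b k * (q - 1) else 0\<bar> \<le> (\<Sum>k\<in>{1..K}. \<alpha> * q)"
    proof (rule order_trans[OF sum_abs sum_mono])
      fix k assume "k \<in> {1..K}"
      then have "\<bar>b k\<bar> * (q - 1) \<le> \<alpha> * q" using bk'[of k] q1 \<alpha> by (intro mult_mono) auto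
      then show "\<bar>if even k then b k * (q - 1) else 0\<bar> \<le> \<alpha> * q" using q1 \<alpha> by (auto simp: abs_mult)
    qed
    then have "\<bar>2 * b 0 - (\<Sum>k\<in>{1..K}. if even k then b k * (q - 1) else 0)\<bar> \<le> \<alpha> * (2 + real K * q)"
      using bk'[of 0] by (simp add: algebra_simps)
    then have "\<bar>\<nu>\<bar> \<le> (\<alpha> * (2 + real K * q)) * ?v"
      unfolding \<nu>_def abs_mult by (intro mult_mono) auto
    then show ?thesis by (simp only: mult_ac)
  qed
  have F0: "poly F 0 = 1" by (simp add: F_def poly_power)
  have P0: "poly P 0 = \<nu>" by (simp add: P_def F0)
  have dF0: "\<bar>poly (pderiv F) 0\<bar> \<le> real ?E * real K ^ 2"
  proof -
    have "poly (pderiv F) 0 = real ?E * poly (pderiv (falling_poly 0 K)) 0"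
    proof (cases ?E)
      case (Suc m)
      show ?thesis unfolding F_def Suc pderiv_power_Suc by (simp add: poly_power)
    qed (simp add: F_def)
    then show ?thesis using pderiv_falling_poly_0[of K] by (simp add: abs_mult mult_left_mono)
  qed
  \<comment> \<open>At 0 the walk counts of the base graph cancel by
    \<open>card_tight_patterns\<close>, and the power of sqrt q that is left is absorbed by the
    coefficient bound \<open>bk\<close>.\<close>
  have S0: "\<bar>poly S 0\<bar> \<le> \<alpha> * real K ^ 2 * real (card D)"
  proof -
    have "\<bar>poly S 0\<bar> \<le> (\<Sum>k\<in>{1..K}. \<alpha> * real K * real (card D))"
      unfolding S_def poly_sum
    proof (rule order_trans[OF sum_abs sum_mono])
      fix k assume k: "k \<in> {1..K}"
      then have k1: "1 \<le> k" "k \<le> K" by auto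
      have "\<bar>real (card (tight_patterns k)) - real (card (cyc_walks G k))\<bar> \<le> real k * real (card D) * sqrt q ^ k"
        using card_tight_patterns[OF k1(1) q1] by simp
      then have "\<bar>b k\<bar> * \<bar>real (card (tight_patterns k)) - real (card (cyc_walks G k))\<bar>
        \<le> \<bar>b k\<bar> * (real k * real (card D) * sqrt q ^ k)" by (intro mult_left_mono) auto
      also have "\<dots> = (\<bar>b k\<bar> * sqrt q ^ k) * (real k * real (card D))" by (simp only: mult_ac)
      also have "\<dots> \<le> \<alpha> * (real K * real (card D))"
        using bk[OF k1(2)] k1 \<alpha> by (intro mult_mono mult_right_mono) auto
      finally show "\<bar>poly (Polynomial.smult (b k) (pattern_poly K k - Polynomial.smult (real (card (cyc_walks G k))) F)) 0\<bar>
        \<le> \<alpha> * real K * real (card D)"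
        using k1 by (simp add: pattern_poly_0 F0 abs_mult mult.assoc)
    qed
    then show ?thesis by (simp add: power2_eq_square mult_ac)
  qed
  have dP0: "\<bar>poly (pderiv P) 0\<bar> \<le> \<alpha> * ?v * (2 + real K * q) * (real ?E * real K ^ 2 + 1) + \<alpha> * real K ^ 2 * real (card D)"
  proof -
    have "poly (pderiv P) 0 = \<nu> * (poly (pderiv F) 0 - 1) + poly S 0"
      by (simp add: P_def pderiv_add pderiv_smult pderiv_mult pderiv_pCons F0 algebra_simps)
    then have "\<bar>poly (pderiv P) 0\<bar> \<le> \<bar>\<nu>\<bar> * \<bar>poly (pderiv F) 0 - 1\<bar> + \<bar>poly S 0\<bar>"
      by (metis abs_mult abs_triangle_ineq)
    moreover have "\<bar>\<nu>\<bar> * \<bar>poly (pderiv F) 0 - 1\<bar> \<le> (\<alpha> * ?v * (2 + real K * q)) * (real ?E * real K ^ 2 + 1)"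
      using \<nu> dF0 by (intro mult_mono) auto
    ultimately show ?thesis using S0 by linarith
  qed
  have MK: "M \<ge> 1" "M \<ge> K" "M \<ge> ?E * K" by (auto simp: M)
  have M3: "M \<le> M ^ 3" "K * (?E * K) \<le> M ^ 3"
  proof -
    have "M * 1 \<le> M * M\<^sup>2" using MK(1) by (intro mult_le_mono) auto
    then show "M \<le> M ^ 3" by (simp add: power3_eq_cube power2_eq_square)
    have "K * (?E * K) * 1 \<le> M * M * M" using MK by (intro mult_le_mono) auto
    then show "K * (?E * K) \<le> M ^ 3" by (simp add: power3_eq_cube)
  qed
  have nK: "K \<le> n" "n \<ge> 1" using n M3 MK by linarith+
  have main: "\<bar>poly P (1 / real n)\<bar> \<le> \<bar>poly P 0\<bar> + \<bar>poly (pderiv P) 0\<bar> / real n + 16384 * real M ^ 12 * ?v * 2 / (real n)\<^sup>2"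
    by (rule poly_first_order_bound[OF degP MK(1,2) Pbd n]) auto
  have "2 * (K * (?E * K)) \<le> n" using n M3 by linarith
  then have "real (2 * (K * (?E * K))) \<le> real n" by (simp only: of_nat_le_iff)
  \<comment> \<open>Removing the factor \<open>F\<close> again is responsible for the leading 2 in
    the bound.\<close>
  then have half: "1 / 2 \<le> poly F (1 / real n)"
    unfolding F_def poly_power using nK by (intro poly_falling_poly_power_ge_half) (auto simp: power2_eq_square mult_ac)
  have "(1 / 2) * ((1 / real n) * expected_new_sum h n) \<le> poly F (1 / real n) * ((1 / real n) * expected_new_sum h n)"
    using half expected_new_sum_bounds(1)[OF h nK(2)] by (intro mult_right_mono) auto
  also have "\<dots> = poly P (1 / real n)" unfolding val[OF nK(1)] by (simp only: mult.assoc)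
  also have "\<dots> \<le> \<bar>\<nu>\<bar> + \<bar>poly (pderiv P) 0\<bar> / real n + 16384 * real M ^ 12 * ?v * 2 / (real n)\<^sup>2"
    using main unfolding P0 by linarith
  finally have le: "(1 / 2) * ((1 / real n) * expected_new_sum h n)
    \<le> \<bar>\<nu>\<bar> + \<bar>poly (pderiv P) 0\<bar> / real n + 16384 * real M ^ 12 * ?v * 2 / (real n)\<^sup>2" .
  have "expected_new_sum h n = 2 * real n * ((1 / 2) * ((1 / real n) * expected_new_sum h n))"
    using nK(2) by simp
  also have "\<dots> \<le> 2 * real n * (\<bar>\<nu>\<bar> + \<bar>poly (pderiv P) 0\<bar> / real n + 16384 * real M ^ 12 * ?v * 2 / (real n)\<^sup>2)"
    by (rule mult_left_mono[OF le]) simp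
  also have "\<dots> = 2 * (real n * \<bar>\<nu>\<bar> + \<bar>poly (pderiv P) 0\<bar> + 32768 * real M ^ 12 * ?v / real n)"
    using nK(2) by (simp add: field_simps power2_eq_square)
  also have "\<dots> \<le> 2 * (real n * (\<alpha> * ?v * (2 + real K * q))
    + (\<alpha> * ?v * (2 + real K * q) * (real ?E * real K ^ 2 + 1) + \<alpha> * real K ^ 2 * real (card D))
    + 32768 * real M ^ 12 * ?v / real n)"
    using \<nu> dP0 by (intro mult_left_mono add_mono) auto
  finally show ?thesis .
qed

section \<open>From the expectation to the probability\<close>

lemma prob_lambda_ge:
  assumes P: "\<And>x. \<bar>x\<bar> \<le> real d \<Longrightarrow> 0 \<le> poly P x \<and> poly P x \<le> 1"
    and big: "\<And>x. \<bar>x\<bar> \<le> real d \<Longrightarrow> thr \<le> \<bar>x\<bar> \<Longrightarrow> 1 / 2 \<le> poly P x"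
    and n: "n \<ge> 2" and V: "V \<noteq> {}"
  shows "measure_pmf.prob (perm_family (arcs G) n) {\<sigma>. \<not> lambda_A G (covering G n \<sigma>) < thr}
    \<le> 2 ^ m * expected_new_sum (P ^ m) n"
proof -
  let ?M = "perm_family (arcs G) n"
  let ?S = "{\<sigma>. \<not> lambda_A G (covering G n \<sigma>) < thr}"
  have "measure_pmf.prob ?M ?S = measure_pmf.expectation ?M (indicator ?S)" by simp
  also have "\<dots> \<le> measure_pmf.expectation ?M (\<lambda>\<sigma>. 2 ^ m * new_sum (P ^ m) n \<sigma>)"
  proof (intro integral_mono_AE integrable_perm_family AE_pmfI)
    fix \<sigma> assume "\<sigma> \<in> set_pmf ?M"
    then interpret covering_graph G d q n \<sigma> by (rule covering_graph_perm_family)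
    have nonneg: "0 \<le> poly (P ^ m) x" if "x \<in># new_spec" for x
      using P[OF new_spec_bound[OF that]] by (simp add: poly_power)
    show "indicator ?S \<sigma> \<le> 2 ^ m * new_sum (P ^ m) n \<sigma>"
    proof (cases "\<sigma> \<in> ?S")
      case True
      have "card V \<ge> 1" using V by (simp add: Suc_le_eq card_gt_0_iff)
      \<comment> \<open>With two or more sheets the new spectrum is nonempty, so the maximum in
        \<open>lambda_A\<close> is attained and not an unspecified value.\<close>
      then have "n * card V > card V" using n by simp
      then have "new_spec \<noteq> {#}" using size_new_spec n by force
      then have "Max (cmod ` set_mset (image_mset complex_of_real new_spec)) \<in> cmod ` set_mset (image_mset complex_of_real new_spec)"
        by (intro Max_in) auto
      then obtain x where x: "x \<in># new_spec" "lambda_A G \<Gamma> = \<bar>x\<bar>"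
        using n by (auto simp: lambda_A_def adj_spec_diff)
      then have "thr \<le> \<bar>x\<bar>" using True by simp
      then have "1 / 2 \<le> poly P x" by (rule big[OF new_spec_bound[OF x(1)]])
      \<comment> \<open>A single large eigenvalue already contributes 2^(-m), and all other terms
        are nonnegative; this is Markov's inequality.\<close>
      then have "(1 / 2) ^ m \<le> poly (P ^ m) x" unfolding poly_power by (intro power_mono) auto
      also have "poly (P ^ m) x \<le> new_sum (P ^ m) n \<sigma>"
      proof -
        obtain N where N: "new_spec = add_mset x N" using x(1) by (metis mset_add)
        have "0 \<le> (\<Sum>y\<in>#N. poly (P ^ m) y)" using nonneg unfolding N by (intro sum_mset_real_nonneg) auto
        then show ?thesis by (simp add: new_sum_def N)
      qed
      finally have "2 ^ m * (1 / 2) ^ m \<le> 2 ^ m * new_sum (P ^ m) n \<sigma>" by (intro mult_left_mono) auto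
      then show ?thesis using True by (simp add: power_one_over)
    next
      case False
      have "0 \<le> new_sum (P ^ m) n \<sigma>" unfolding new_sum_def using nonneg by (intro sum_mset_real_nonneg) auto
      then show ?thesis using False by simp
    qed
  qed
  also have "\<dots> = 2 ^ m * expected_new_sum (P ^ m) n" by (simp add: expected_new_sum_def)
  finally show ?thesis .
qed

lemma prob_lambda_lt_tendsto:
  assumes q1: "q \<ge> 1" and V: "V \<noteq> {}" and \<epsilon>: "\<epsilon> > 0"
  shows "(\<lambda>n. measure_pmf.prob (perm_family (arcs G) n) {\<sigma>. lambda_A G (covering G n \<sigma>) < 2 * sqrt q + \<epsilon>}) \<longlonglongrightarrow> 1"
proof -
  obtain P where P: "\<And>x. \<bar>x\<bar> \<le> real d \<Longrightarrow> 0 \<le> poly P x \<and> poly P x \<le> 1"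
    "\<And>x. \<bar>x\<bar> \<le> real d \<Longrightarrow> \<bar>x\<bar> \<le> 2 * sqrt q \<Longrightarrow> poly P x \<le> 1 / 64"
    "\<And>x. \<bar>x\<bar> \<le> real d \<Longrightarrow> 2 * sqrt q + \<epsilon> \<le> \<bar>x\<bar> \<Longrightarrow> 1 / 2 \<le> poly P x"
    using exists_separating_poly[of "2 * sqrt q" \<epsilon> "real d"] q1 \<epsilon> by auto
  \<comment> \<open>The tree spectrum lies in [-d, d], where the bounds on \<open>P\<close>
    hold.\<close>
  have "0 \<le> (sqrt q - 1)\<^sup>2" by simp
  then have rho_d: "2 * sqrt q \<le> real d"
    using q1 unfolding q by (simp add: power2_diff)
  define \<kappa> where "\<kappa> = degree P + 1"
  define E where "E = card (arcs G)"
  define v where "v = real (card V)"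
  define D' where "D' = real (card D)"
  define c where "c = (E + 1) * \<kappa> + 1"
  define c1 where "c1 = v * (2 + real \<kappa> * q)"
  define c2 where "c2 = c1 * (real E * real \<kappa> ^ 2 + 1) + real \<kappa> ^ 2 * D'"
  define c3 where "c3 = 32768 * real c ^ 12 * v"
  \<comment> \<open>With h at most 64^(-m) on the tree spectrum and n between 4^m and 4^(m+1), the
    three terms decay like 8^(-m), 32^(-m) and 2^(-m), up to powers of m.\<close>
  define bound where "bound m = 2 ^ m * (2 * (4 * 4 ^ m * ((1 / 64) ^ m * (c1 * real m)) + (1 / 64) ^ m * (c2 * real m ^ 3)
     + c3 * real m ^ 12 / 4 ^ m))" for m :: nat
  have nonneg: "v \<ge> 0" "D' \<ge> 0" "c1 \<ge> 0" "q \<ge> 0" using q1 by (auto simp: v_def D'_def c1_def)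
  have step: "measure_pmf.prob (perm_family (arcs G) n) {\<sigma>. \<not> lambda_A G (covering G n \<sigma>) < 2 * sqrt q + \<epsilon>} \<le> bound m"
    if m: "m \<ge> 1" and n: "4 ^ m \<le> n" "n < 4 ^ (m + 1)" and large: "16 * (c * m) ^ 3 \<le> 4 ^ m" for n m
  proof -
    define K where "K = m * \<kappa>"
    define M where "M = (card (arcs G) + 1) * K + 1"
    define \<alpha> where "\<alpha> = (1 / 64 :: real) ^ m"
    define x where "x = real m"
    have x1: "x \<ge> 1" using m by (simp add: x_def)
    have \<alpha>0: "\<alpha> \<ge> 0" by (simp add: \<alpha>_def)
    have Mcm: "M \<le> c * m" using m unfolding M_def K_def c_def E_def by (simp add: algebra_simps)
    have nM: "16 * M ^ 3 \<le> n"
    proof -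
      have "16 * M ^ 3 \<le> 16 * (c * m) ^ 3" using Mcm by (intro mult_le_mono power_mono) auto
      then show ?thesis using large n by linarith
    qed
    have n2: "n \<ge> 2"
    proof -
      have "(4 :: nat) ^ 1 \<le> 4 ^ m" using m by (intro power_increasing) auto
      then show ?thesis using n by simp
    qed
    have K1: "K \<ge> 1" using m by (simp add: K_def \<kappa>_def)
    have h1: "0 \<le> poly (P ^ m) y \<and> poly (P ^ m) y \<le> 1" if "\<bar>y\<bar> \<le> real d" for y
      using P(1)[OF that] by (simp add: poly_power power_le_one)
    have h2: "\<bar>poly (P ^ m) y\<bar> \<le> \<alpha>" if "\<bar>y\<bar> \<le> 2 * sqrt q" for y
    proof -
      have yd: "\<bar>y\<bar> \<le> real d" using that rho_d by linarith
      show ?thesis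
        using P(1)[OF yd] P(2)[OF yd that] unfolding poly_power \<alpha>_def power_abs by (intro power_mono) auto
    qed
    have degh: "degree (P ^ m) \<le> K"
      by (rule order_trans[OF degree_power_le]) (simp add: K_def \<kappa>_def)
    have Kx: "real K = x * real \<kappa>" by (simp add: K_def x_def)
    have e1: "\<alpha> * v * (2 + real K * q) \<le> \<alpha> * (c1 * x)"
    proof -
      have "2 * 1 + x * (real \<kappa> * q) \<le> 2 * x + x * (real \<kappa> * q)" using x1 by simp
      then have "\<alpha> * v * (2 * 1 + x * (real \<kappa> * q)) \<le> \<alpha> * v * (2 * x + x * (real \<kappa> * q))"
        using \<alpha>0 nonneg by (intro mult_left_mono) auto
      then show ?thesis unfolding Kx c1_def by (simp add: algebra_simps)
    qed
    have e2: "real E * real K ^ 2 + 1 \<le> (real E * real \<kappa> ^ 2 + 1) * x ^ 2"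
      using one_le_power[OF x1, of 2] unfolding Kx by (simp add: algebra_simps power_mult_distrib)
    have e3: "\<alpha> * v * (2 + real K * q) * (real E * real K ^ 2 + 1) + \<alpha> * real K ^ 2 * D' \<le> \<alpha> * (c2 * x ^ 3)"
    proof -
      have "\<alpha> * v * (2 + real K * q) * (real E * real K ^ 2 + 1) \<le> \<alpha> * (c1 * x) * ((real E * real \<kappa> ^ 2 + 1) * x ^ 2)"
        using \<alpha>0 nonneg x1 by (intro mult_mono[OF e1 e2]) auto
      moreover have "\<alpha> * real K ^ 2 * D' \<le> \<alpha> * (real \<kappa> ^ 2 * D') * x ^ 3"
      proof -
        have "x ^ 2 \<le> x ^ 3" using x1 by (intro power_increasing) auto
        then have "(\<alpha> * (real \<kappa> ^ 2 * D')) * x ^ 2 \<le> (\<alpha> * (real \<kappa> ^ 2 * D')) * x ^ 3"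
          using \<alpha>0 nonneg by (intro mult_left_mono) auto
        then show ?thesis unfolding Kx by (simp add: power_mult_distrib mult_ac)
      qed
      ultimately have "\<alpha> * v * (2 + real K * q) * (real E * real K ^ 2 + 1) + \<alpha> * real K ^ 2 * D'
        \<le> \<alpha> * (c1 * x) * ((real E * real \<kappa> ^ 2 + 1) * x ^ 2) + \<alpha> * (real \<kappa> ^ 2 * D') * x ^ 3" by linarith
      also have "\<dots> = \<alpha> * (c2 * x ^ 3)" by (simp add: c2_def algebra_simps power3_eq_cube power2_eq_square)
      finally show ?thesis .
    qed
    have n4: "real n \<le> 4 * 4 ^ m" "4 ^ m \<le> real n"
    proof -
      have "real n \<le> real (4 ^ (m + 1))" "real (4 ^ m) \<le> real n"
        using n unfolding of_nat_le_iff by simp_all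
      then show "real n \<le> 4 * 4 ^ m" "4 ^ m \<le> real n" by simp_all
    qed
    have "expected_new_sum (P ^ m) n \<le> 2 * (real n * (\<alpha> * v * (2 + real K * q))
      + (\<alpha> * v * (2 + real K * q) * (real E * real K ^ 2 + 1) + \<alpha> * real K ^ 2 * D')
      + 32768 * real M ^ 12 * v / real n)"
      unfolding v_def E_def D'_def
      by (rule expected_new_sum_bound[OF h1 h2 degh K1 q1 M_def nM])
    also have "\<dots> \<le> 2 * (4 * 4 ^ m * (\<alpha> * (c1 * x)) + \<alpha> * (c2 * x ^ 3) + c3 * x ^ 12 / 4 ^ m)"
    proof (intro mult_left_mono add_mono e3)
      have "0 \<le> \<alpha> * (c1 * x)" using \<alpha>0 nonneg x1 by simp
      then show "real n * (\<alpha> * v * (2 + real K * q)) \<le> 4 * 4 ^ m * (\<alpha> * (c1 * x))"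
        using \<alpha>0 nonneg by (intro mult_mono[OF n4(1) e1]) auto
      have "real M \<le> real c * x" using Mcm unfolding x_def by (metis of_nat_le_iff of_nat_mult)
      then have "real M ^ 12 \<le> (real c * x) ^ 12" by (intro power_mono) auto
      then have "32768 * real M ^ 12 * v \<le> c3 * x ^ 12"
        using nonneg by (simp add: c3_def power_mult_distrib mult_ac mult_left_mono)
      then show "32768 * real M ^ 12 * v / real n \<le> c3 * x ^ 12 / 4 ^ m"
        using n4 nonneg x1 by (intro frac_le) (auto simp: c3_def)
    qed auto
    finally have "2 ^ m * expected_new_sum (P ^ m) n \<le> bound m"
      unfolding bound_def \<alpha>_def x_def by (intro mult_left_mono) auto
    moreover have "measure_pmf.prob (perm_family (arcs G) n) {\<sigma>. \<not> lambda_A G (covering G n \<sigma>) < 2 * sqrt q + \<epsilon>}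
      \<le> 2 ^ m * expected_new_sum (P ^ m) n"
      by (rule prob_lambda_ge[OF P(1) P(3) n2 V])
    ultimately show ?thesis by linarith
  qed
  have lim: "bound \<longlonglongrightarrow> 0"
  proof -
    have "(\<lambda>m. real m * (1 / 8) ^ m) \<longlonglongrightarrow> 0" "(\<lambda>m. real m ^ 3 * (1 / 32) ^ m) \<longlonglongrightarrow> 0"
      "(\<lambda>m. real m ^ 12 * (1 / 2) ^ m) \<longlonglongrightarrow> 0" by real_asymp+
    then have lim0: "(\<lambda>m. 8 * c1 * (real m * (1 / 8) ^ m) + 2 * c2 * (real m ^ 3 * (1 / 32) ^ m) + 2 * c3 * (real m ^ 12 * (1 / 2) ^ m))
      \<longlonglongrightarrow> 8 * c1 * 0 + 2 * c2 * 0 + 2 * c3 * 0" by (intro tendsto_intros)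
    have eq: "bound m = 8 * c1 * (real m * (1 / 8) ^ m) + 2 * c2 * (real m ^ 3 * (1 / 32) ^ m) + 2 * c3 * (real m ^ 12 * (1 / 2) ^ m)" for m
    proof -
      have "(2 :: real) ^ m * 4 ^ m * (1 / 64) ^ m = (1 / 8) ^ m" "(2 :: real) ^ m * (1 / 64) ^ m = (1 / 32) ^ m"
        "(2 :: real) ^ m / 4 ^ m = (1 / 2) ^ m" by (simp_all flip: power_mult_distrib power_divide)
      moreover have "bound m = 8 * c1 * (real m * (2 ^ m * 4 ^ m * (1 / 64) ^ m)) + 2 * c2 * (real m ^ 3 * (2 ^ m * (1 / 64) ^ m))
         + 2 * c3 * (real m ^ 12 * (2 ^ m / 4 ^ m))"
        unfolding bound_def by (simp add: distrib_left mult_ac)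
      ultimately show ?thesis by simp
    qed
    show ?thesis using lim0 unfolding eq[abs_def] by simp
  qed
  \<comment> \<open>\<open>expected_new_sum_bound\<close> needs n to exceed the cube of a degree
    proportional to m, whereas n is exponential in m.\<close>
  have large: "eventually (\<lambda>m. 16 * (c * m) ^ 3 \<le> 4 ^ m) sequentially"
  proof -
    have "(\<lambda>m. real m ^ 3 / 4 ^ m) \<longlonglongrightarrow> 0" by real_asymp
    then have "(\<lambda>m. 16 * real c ^ 3 * (real m ^ 3 / 4 ^ m)) \<longlonglongrightarrow> 16 * real c ^ 3 * 0"
      by (intro tendsto_intros)
    then have "eventually (\<lambda>m. 16 * real c ^ 3 * (real m ^ 3 / 4 ^ m) < 1) sequentially"
      by (intro order_tendstoD(2)) auto
    then show ?thesis
    proof eventually_elim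
      case (elim m)
      then have "16 * (real c * real m) ^ 3 \<le> 4 ^ m" by (simp add: power_mult_distrib field_simps)
      then have "real (16 * (c * m) ^ 3) \<le> real (4 ^ m)" by simp
      then show ?case by (simp only: of_nat_le_iff)
    qed
  qed
  have "(\<lambda>n. measure_pmf.prob (perm_family (arcs G) n) {\<sigma>. \<not> lambda_A G (covering G n \<sigma>) < 2 * sqrt q + \<epsilon>}) \<longlonglongrightarrow> 0"
  proof (rule LIMSEQ_I)
    fix \<delta> :: real assume "\<delta> > 0"
    then have "eventually (\<lambda>m. bound m < \<delta>) sequentially" using lim by (intro order_tendstoD(2))
    then have "eventually (\<lambda>m. bound m < \<delta> \<and> 16 * (c * m) ^ 3 \<le> 4 ^ m) sequentially"
      using large by eventually_elim auto
    then obtain m0 where m0: "\<And>m. m \<ge> m0 \<Longrightarrow> bound m < \<delta> \<and> 16 * (c * m) ^ 3 \<le> 4 ^ m"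
      unfolding eventually_sequentially by blast
    have "norm (measure_pmf.prob (perm_family (arcs G) n) {\<sigma>. \<not> lambda_A G (covering G n \<sigma>) < 2 * sqrt q + \<epsilon>} - 0) < \<delta>"
      if n: "n \<ge> 4 ^ (m0 + 1)" for n
    proof -
      have "n \<ge> 1" using n by (metis le_trans one_le_numeral one_le_power)
      then obtain m where m: "4 ^ m \<le> n" "n < 4 ^ (m + 1)" using ex_power_ivl1[of 4 n] by auto
      have "(4 :: nat) ^ (m0 + 1) < 4 ^ (m + 1)" using n m by linarith
      then have "m0 + 1 < m + 1" by (rule power_less_imp_less_exp[rotated]) simp
      then show ?thesis using step[OF _ m] m0[of m] by fastforce
    qed
    then show "\<exists>N. \<forall>n\<ge>N. norm (measure_pmf.prob (perm_family (arcs G) n) {\<sigma>. \<not> lambda_A G (covering G n \<sigma>) < 2 * sqrt q + \<epsilon>} - 0) < \<delta>"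
      by blast
  qed
  then have "(\<lambda>n. 1 - measure_pmf.prob (perm_family (arcs G) n) {\<sigma>. \<not> lambda_A G (covering G n \<sigma>) < 2 * sqrt q + \<epsilon>}) \<longlonglongrightarrow> 1 - 0"
    by (intro tendsto_intros)
  moreover have "1 - measure_pmf.prob M {\<sigma>. \<not> Q \<sigma>} = measure_pmf.prob M {\<sigma>. Q \<sigma>}" for M :: "('e \<Rightarrow> nat \<Rightarrow> nat) pmf" and Q
    using measure_pmf.prob_compl[of "{\<sigma>. Q \<sigma>}" M] by (simp add: Compl_eq_Diff_UNIV[symmetric] Collect_neg_eq)
  ultimately show ?thesis by simp
qed

end

theorem theorem5:
  fixes \<Omega> :: "('v, 'e) pre_digraph" and d :: nat
  assumes "fin_digraph \<Omega>"
    and "Digraph_Component.connected \<Omega>"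
    and "regular_graph \<Omega> d"
    and "d \<ge> 3"
  shows "rho_A \<Omega> + 0.84 = 2 * sqrt (real d - 1) + 0.84 \<and>
    (\<lambda>n. measure_pmf.prob (random_covering n \<Omega>) {\<Gamma>. lambda_A \<Omega> \<Gamma> < rho_A \<Omega> + 0.84})
      \<longlonglongrightarrow> 1"
proof -
  interpret regular_multigraph \<Omega> d "real d - 1"
    using assms by (intro regular_multigraph.intro) auto
  have rho: "rho_A \<Omega> = 2 * sqrt (real d - 1)"
    using assms by (intro rho_A_regular) auto
  have V: "verts \<Omega> \<noteq> {}"
    using assms(2) by (auto simp: Digraph_Component.connected_def strongly_connected_def mk_symmetric_def)
  \<comment> \<open>The random covering is the image of the random permutations under
    \<open>covering\<close>, so the event is pulled back to them.\<close>
  have "measure_pmf.prob (random_covering n \<Omega>) {\<Gamma>. lambda_A \<Omega> \<Gamma> < rho_A \<Omega> + 0.84}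
     = measure_pmf.prob (perm_family (arcs \<Omega>) n) {\<sigma>. lambda_A \<Omega> (covering \<Omega> n \<sigma>) < 2 * sqrt (real d - 1) + 0.84}" for n
    unfolding random_covering_def perm_family_def[symmetric] by (simp add: vimage_def rho)
  then show ?thesis
    using prob_lambda_lt_tendsto[OF _ V, of "0.84"] assms(4) rho by simp
qed

end
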